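(* Let $X$ be a Banach space having property $M^*(1,s)$ for some $0<s\leq 1$. Then the following assertions are equivalent: (i) $X$ is reflexive; (ii) $X$ has the Radon-Nikodým property; (iii) $X$ has the point of continuity property (PCP); (iv) there is a point in $S_X$ at which the relative weak and norm topologies sequentially agree; (v) $X$ has the Kadec-Klee property (KKP); (vi) $X$ does not contain an isomorphic copy of $c_0$.
   Context: $B_X$ and $S_X$ denote the closed unit ball and the unit sphere of $X$. Property $M^*(r,s)$: given $r,s\in(0,1]$, $X$ has property $M^*(r,s)$ if whenever $u,v\in X^*$ satisfy $\|u\|\leq\|v\|$ and $(x_\alpha)$ is a bounded weak$^*$-null net in $X^*$, then $\limsup_\alpha\|ru+sx_\alpha\|\leq\limsup_\alpha\|v+x_\alpha\|$. PCP: every non-empty (weakly) closed subset $K$ of $B_X$ admits a point at which the identity map on $K$ is weak-to-norm continuous. The relative weak and norm topologies on $S_X$ sequentially agree at $x_0\in S_X$ if every sequence in $S_X$ converging weakly to $x_0$ converges to $x_0$ in norm. KKP: every sequence in $S_X$ which converges weakly to a point of $S_X$ converges to it in norm. *)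

theory Defs
  imports "HOL-Analysis.Analysis"
begin

definition weak_topology :: "'a::real_normed_vector topology" where
  "weak_topology = pullback_topology UNIV (\<lambda>x (f :: 'a \<Rightarrow>\<^sub>L real). blinfun_apply f x) euclidean"

(* On the dual space the strong operator topology is pointwise convergence on 'a. *)
abbreviation weak_star_topology :: "('a::real_normed_vector \<Rightarrow>\<^sub>L real) topology" where
  "weak_star_topology \<equiv> strong_operator_topology"

lemma limitin_pullback_UNIV_euclidean:
  "limitin (pullback_topology UNIV j euclidean) x l F \<longleftrightarrow> ((\<lambda>i. j (x i)) \<longlongrightarrow> j l) F"
  unfolding limitin_def tendsto_def
  by (auto simp: openin_pullback_topology topspace_pullback_topology)

lemma tendsto_fun_iff:
  fixes f :: "'i \<Rightarrow> 'b \<Rightarrow> 'c::topological_space"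
  shows "(f \<longlongrightarrow> l) F \<longleftrightarrow> (\<forall>y. ((\<lambda>i. f i y) \<longlongrightarrow> l y) F)"
  using limitin_componentwise[of "\<lambda>_. euclidean" UNIV f l F]
  by (simp add: euclidean_product_topology)

lemma limitin_weak_topology_iff:
  fixes l :: "'a::real_normed_vector"
  shows "limitin weak_topology x l F \<longleftrightarrow>
    (\<forall>f :: 'a \<Rightarrow>\<^sub>L real. ((\<lambda>i. blinfun_apply f (x i)) \<longlongrightarrow> blinfun_apply f l) F)"
  unfolding weak_topology_def limitin_pullback_UNIV_euclidean by (subst tendsto_fun_iff) simp

lemma limitin_weak_star_topology_iff:
  fixes l :: "'a::real_normed_vector \<Rightarrow>\<^sub>L real"
  shows "limitin weak_star_topology x l F \<longleftrightarrow>
    (\<forall>y. ((\<lambda>i. blinfun_apply (x i) y) \<longlongrightarrow> blinfun_apply l y) F)"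
  unfolding strong_operator_topology_def limitin_pullback_UNIV_euclidean
  by (subst tendsto_fun_iff) simp

(* A net in the dual space enters only through its filter of tails, and every proper filter
   is the filter of tails of a net; F ranges over these filters.  See also
   property_Mstar_net. *)
definition property_Mstar :: "'a::real_normed_vector itself \<Rightarrow> real \<Rightarrow> real \<Rightarrow> bool" where
  "property_Mstar _ r s \<longleftrightarrow>
    (\<forall>(u :: 'a \<Rightarrow>\<^sub>L real) v F.
      norm u \<le> norm v \<longrightarrow> F \<noteq> bot \<longrightarrow> (\<exists>B. eventually (\<lambda>x. norm x \<le> B) F) \<longrightarrow>
      limitin weak_star_topology (\<lambda>x. x) 0 F \<longrightarrow>
      Limsup F (\<lambda>x. ereal (norm (r *\<^sub>R u + s *\<^sub>R x)))
        \<le> Limsup F (\<lambda>x. ereal (norm (v + x))))"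

lemma property_Mstar_net:
  fixes x :: "'i \<Rightarrow> 'a::real_normed_vector \<Rightarrow>\<^sub>L real"
  assumes "property_Mstar TYPE('a) r s" "norm u \<le> norm v" "F \<noteq> bot"
    and "eventually (\<lambda>i. norm (x i) \<le> B) F" "limitin weak_star_topology x 0 F"
  shows "Limsup F (\<lambda>i. ereal (norm (r *\<^sub>R u + s *\<^sub>R x i)))
    \<le> Limsup F (\<lambda>i. ereal (norm (v + x i)))"
proof -
  have *: "Limsup (filtermap x F) h = Limsup F (\<lambda>i. h (x i))"
    for h :: "('a \<Rightarrow>\<^sub>L real) \<Rightarrow> ereal"
  proof (rule antisym)
    show "Limsup (filtermap x F) h \<le> Limsup F (\<lambda>i. h (x i))"
      by (subst Limsup_le_iff) (auto simp: eventually_filtermap dest: Limsup_lessD)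
  qed (rule Limsup_filtermap_ge)
  have "\<exists>B. eventually (\<lambda>y. norm y \<le> B) (filtermap x F)"
    using assms(4) by (auto simp: eventually_filtermap)
  moreover have "limitin weak_star_topology (\<lambda>y. y) 0 (filtermap x F)"
    using assms(5) by (simp add: limitin_def eventually_filtermap)
  moreover have "filtermap x F \<noteq> bot"
    using assms(3) by (simp add: filtermap_bot_iff)
  ultimately have "Limsup (filtermap x F) (\<lambda>y. ereal (norm (r *\<^sub>R u + s *\<^sub>R y)))
      \<le> Limsup (filtermap x F) (\<lambda>y. ereal (norm (v + y)))"
    using assms(1,2) unfolding property_Mstar_def by blast
  then show ?thesis
    by (simp add: *)
qed

lift_definition bidual_embedding ::
    "'a::real_normed_vector \<Rightarrow> (('a \<Rightarrow>\<^sub>L real) \<Rightarrow>\<^sub>L real)"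
  is "\<lambda>x (f :: 'a \<Rightarrow>\<^sub>L real). blinfun_apply f x"
  by (rule blinfun.bounded_linear_left)

definition reflexive_space :: "'a::real_normed_vector itself \<Rightarrow> bool" where
  "reflexive_space _ \<longleftrightarrow>
    surj (bidual_embedding :: 'a \<Rightarrow> (('a \<Rightarrow>\<^sub>L real) \<Rightarrow>\<^sub>L real))"

(* The definition of has_bochner_integral, whose sort constraint second_countable_topology
   would exclude non-separable spaces. *)
definition has_Bochner_integral ::
    "'w measure \<Rightarrow> ('w \<Rightarrow> 'a::real_normed_vector) \<Rightarrow> 'a \<Rightarrow> bool" where
  "has_Bochner_integral M f x \<longleftrightarrow>
    f \<in> borel_measurable M \<and>
    (\<exists>s. (\<forall>i. Bochner_Integration.simple_bochner_integrable M (s i)) \<and>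
      (\<lambda>i. \<integral>\<^sup>+w. ennreal (norm (f w - s i w)) \<partial>M) \<longlonglongrightarrow> 0 \<and>
      (\<lambda>i. Bochner_Integration.simple_bochner_integral M (s i)) \<longlonglongrightarrow> x)"

lemma has_Bochner_integral_iff:
  fixes f :: "'w \<Rightarrow> 'a::{real_normed_vector, second_countable_topology}"
  shows "has_Bochner_integral M f x \<longleftrightarrow> has_bochner_integral M f x"
  unfolding has_Bochner_integral_def has_bochner_integral.simps by auto

definition vector_measure :: "'w measure \<Rightarrow> ('w set \<Rightarrow> 'a::real_normed_vector) \<Rightarrow> bool" where
  "vector_measure M G \<longleftrightarrow>
    (\<forall>A. range A \<subseteq> sets M \<longrightarrow> disjoint_family A \<longrightarrow>
      (\<lambda>i :: nat. G (A i)) sums G (\<Union>i. A i))"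

definition bounded_variation_measure ::
    "'w measure \<Rightarrow> ('w set \<Rightarrow> 'a::real_normed_vector) \<Rightarrow> bool" where
  "bounded_variation_measure M G \<longleftrightarrow>
    (\<exists>C. \<forall>P. finite P \<longrightarrow> P \<subseteq> sets M \<longrightarrow> partition_on (space M) P \<longrightarrow>
      (\<Sum>E\<in>P. norm (G E)) \<le> C)"

(* HOL cannot quantify over all measure spaces inside a formula, so this is the
   Radon-Nikodym property with respect to the finite measure spaces whose points are
   taken from 'w.  It is degenerate for, say, finite 'w; use it with 'w left arbitrary but
   large enough for Lebesgue measure, such as 'w + real. *)
definition radon_nikodym_property ::
    "'w itself \<Rightarrow> 'a::real_normed_vector itself \<Rightarrow> bool" where
  "radon_nikodym_property _ _ \<longleftrightarrow>
    (\<forall>(M :: 'w measure) (G :: 'w set \<Rightarrow> 'a).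
      finite_measure M \<longrightarrow> vector_measure M G \<longrightarrow> bounded_variation_measure M G \<longrightarrow>
      (\<forall>E\<in>null_sets M. G E = 0) \<longrightarrow>
      (\<exists>g. \<forall>E\<in>sets M. has_Bochner_integral M (\<lambda>w. indicator E w *\<^sub>R g w) (G E)))"

(* K ranges over all norm closed subsets, in particular over the weakly closed ones. *)
definition point_of_continuity_property :: "'a::real_normed_vector itself \<Rightarrow> bool" where
  "point_of_continuity_property _ \<longleftrightarrow>
    (\<forall>K :: 'a set. K \<noteq> {} \<longrightarrow> closed K \<longrightarrow> K \<subseteq> cball 0 1 \<longrightarrow>
      (\<exists>x\<in>K. topcontinuous_at (subtopology weak_topology K) euclidean (\<lambda>y. y) x))"

definition sphere_topologies_seq_agree_at :: "'a::real_normed_vector \<Rightarrow> bool" where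
  "sphere_topologies_seq_agree_at x0 \<longleftrightarrow>
    (\<forall>x :: nat \<Rightarrow> 'a. range x \<subseteq> sphere 0 1 \<longrightarrow>
      limitin weak_topology x x0 sequentially \<longrightarrow> x \<longlonglongrightarrow> x0)"

definition kadec_klee_property :: "'a::real_normed_vector itself \<Rightarrow> bool" where
  "kadec_klee_property _ \<longleftrightarrow>
    (\<forall>(x :: nat \<Rightarrow> 'a) x0. range x \<subseteq> sphere 0 1 \<longrightarrow> x0 \<in> sphere 0 1 \<longrightarrow>
      limitin weak_topology x x0 sequentially \<longrightarrow> x \<longlonglongrightarrow> x0)"

(* As nat is discrete, bounded continuous functions on nat with their supremum norm are
   the bounded sequences. *)
definition c0 :: "(nat \<Rightarrow>\<^sub>C real) set" where
  "c0 = {a. (\<lambda>n. apply_bcontfun a n) \<longlonglongrightarrow> 0}"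

definition contains_copy_of_c0 :: "'a::real_normed_vector itself \<Rightarrow> bool" where
  "contains_copy_of_c0 _ \<longleftrightarrow>
    (\<exists>(T :: (nat \<Rightarrow>\<^sub>C real) \<Rightarrow> 'a) m C. m > 0 \<and>
      (\<forall>a\<in>c0. \<forall>b\<in>c0. T (a + b) = T a + T b) \<and>
      (\<forall>a\<in>c0. \<forall>k. T (k *\<^sub>R a) = k *\<^sub>R T a) \<and>
      (\<forall>a\<in>c0. m * norm a \<le> norm (T a) \<and> norm (T a) \<le> C * norm a))"

end

theory Submission
  imports Defs
begin

text \<open>Call a unit vector \<open>x0\<close> flat if there are vectors \<open>y\<close>, bounded away from \<open>0\<close> but arbitrarily small
  on any finite set of functionals, with \<open>norm (x0 + y)\<close> arbitrarily close to \<open>1\<close>.  Property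
  \<open>M\<^sup>*(1, s)\<close> dualises to: for a weakly null net \<open>(y)\<close>, the limit superior of \<open>norm (x + s y)\<close> is at most
  that of \<open>norm (x0 + y)\<close> whenever \<open>norm x \<le> norm x0\<close>.  Hence the \<open>y\<close> of one flat point, scaled by \<open>s\<close>,
  can be added at any finite set of points of the ball at once without leaving it by much, and
  inductively this gives a copy of \<open>c0\<close> as well as sequences refuting the agreement of the
  topologies at every point of the sphere.

  If the space is not reflexive, then all points of the sphere are flat: for a functional \<open>\<psi>\<close> on the
  bidual that annihilates the space, \<open>M\<^sup>*(1, s)\<close> gives \<open>norm (u + t \<psi>) \<ge> norm u + s t norm \<psi>\<close>, and a
  separation argument turns this into flatness.  Conversely, a reflexive space contains no \<open>c0\<close>, so it
  has no flat point, which is to say that the norm has the Kadec property for nets.  Together with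
  weak compactness, this yields PCP and RNP: slicing by norming functionals makes
  the norm almost constant, and the Kadec property then makes the slices small.\<close>

subsection \<open>Linear functionals and weak limits\<close>

text \<open>No separability is assumed, so the argument runs on weakly null nets. They are handled
  as ultrafilters, along which every bounded real family converges and, pointwise, every bounded
  family of functionals. Sequences return only in the induction, where each stage asks for finitely
  many inequalities; this is why flatness speaks of finite sets of functionals.

  Two features make the sequence span \<open>c0\<close>. Summable errors keep all signed sums in the
  ball of radius 2, and this alone gives the upper estimate and weak nullity. The lower estimate
  needs almost biorthogonal functionals: they are norming functionals of the \<open>y\<close> minus
  their weak-star limit, and so small on the vectors chosen before.

  The implications from PCP and RNP to reflexivity both pass through \<open>c0\<close>, on which
  each property fails.

  All extension and separation results come from one form of the Hahn-Banach theorem, with lower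
  bounds prescribed on a cone of pairs (vector, real); only the cone and the dominating sublinear
  function vary.\<close>

definition sublinear :: "('v::real_vector \<Rightarrow> real) \<Rightarrow> bool" where
  "sublinear p \<longleftrightarrow>
    (\<forall>x y. p (x + y) \<le> p x + p y) \<and> (\<forall>t x. 0 \<le> t \<longrightarrow> p (t *\<^sub>R x) = t * p x)"

lemma sublinear_add: "sublinear p \<Longrightarrow> p (x + y) \<le> p x + p y"
  by (simp add: sublinear_def)

lemma sublinear_scale: "sublinear p \<Longrightarrow> 0 \<le> t \<Longrightarrow> p (t *\<^sub>R x) = t * p x"
  by (simp add: sublinear_def)

lemma sublinear_0: "sublinear p \<Longrightarrow> p 0 = 0"
  using sublinear_scale[of p 0 0] by simp

lemma sublinear_ge: "sublinear p \<Longrightarrow> - p (- x) \<le> p x"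
  using sublinear_add[of p x "- x"] sublinear_0[of p] by simp

text \<open>One inequality for homogeneity is enough: the same inequality for the inverse factor
  gives the reverse one.\<close>

lemma sublinearI:
  assumes "\<And>x y. p (x + y) \<le> p x + p y"
    and "p 0 = 0"
    and "\<And>t x. 0 < t \<Longrightarrow> p (t *\<^sub>R x) \<le> t * p x"
  shows "sublinear p"
proof -
  have "p (t *\<^sub>R x) = t * p x" if "0 \<le> t" for t x
  proof (cases "t = 0")
    case False
    then have t: "0 < t" using that by simp
    have "p x \<le> inverse t * p (t *\<^sub>R x)"
      using assms(3)[of "inverse t" "t *\<^sub>R x"] t by simp
    then have "t * p x \<le> p (t *\<^sub>R x)"
      using t by (simp add: field_simps)
    with assms(3)[OF t, of x] show ?thesis by simp
  qed (simp add: assms(2))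
  with assms(1) show ?thesis by (simp add: sublinear_def)
qed

text \<open>Passing from \<open>p\<close> to the infimum of \<open>p (y + x) - r\<close> over the
  cone builds the constraints \<open>r \<le> f x\<close> into the dominating function: any linear
  \<open>f\<close> below \<open>q\<close> has \<open>f (- x) \<le> - r\<close>. The infimum is
  finite because \<open>r \<le> p x\<close> and subadditivity bound it below by
  \<open>- p (- y)\<close>.\<close>

lemma sublinear_inf_cone:
  fixes p :: "'v::real_vector \<Rightarrow> real" and K :: "('v \<times> real) set"
  assumes p: "sublinear p"
    and K: "0 \<in> K" "\<And>a b. a \<in> K \<Longrightarrow> b \<in> K \<Longrightarrow> a + b \<in> K"
      "\<And>t a. 0 \<le> t \<Longrightarrow> a \<in> K \<Longrightarrow> t *\<^sub>R a \<in> K"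
    and le: "\<And>x r. (x, r) \<in> K \<Longrightarrow> r \<le> p x"
  obtains q where "sublinear q" "\<And>x. q x \<le> p x" "\<And>x r. (x, r) \<in> K \<Longrightarrow> q (- x) \<le> - r"
proof -
  define q where "q y = (INF a\<in>K. p (y + fst a) - snd a)" for y
  have low: "- p (- y) \<le> p (y + fst a) - snd a" if "a \<in> K" for y a
    using sublinear_add[OF p, of "y + fst a" "- y"] le[of "fst a" "snd a"] that by simp
  then have bdd: "bdd_below ((\<lambda>a. p (y + fst a) - snd a) ` K)" for y
    by (intro bdd_belowI2)
  have q_le: "q y \<le> p (y + fst a) - snd a" if "a \<in> K" for y a
    unfolding q_def by (rule cINF_lower[OF bdd that])
  have q_ge: "c \<le> q y" if "\<And>a. a \<in> K \<Longrightarrow> c \<le> p (y + fst a) - snd a" for c y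
    unfolding q_def by (rule cINF_greatest) (use K(1) that in auto)
  show ?thesis
  proof (rule that)
    show "sublinear q"
    proof (rule sublinearI)
      fix y z
      have "q (y + z) - (p (z + fst b) - snd b) \<le> q y" if "b \<in> K" for b
      proof (rule q_ge)
        fix a assume "a \<in> K"
        have "q (y + z) \<le> p ((y + fst a) + (z + fst b)) - (snd a + snd b)"
          using q_le[OF K(2)[OF \<open>a \<in> K\<close> that], of "y + z"] by (simp add: algebra_simps)
        also have "\<dots> \<le> p (y + fst a) + p (z + fst b) - (snd a + snd b)"
          using sublinear_add[OF p] by simp
        finally show "q (y + z) - (p (z + fst b) - snd b) \<le> p (y + fst a) - snd a" by simp
      qed
      then have "q (y + z) - q y \<le> q z"
        by (intro q_ge) (simp add: algebra_simps)
      then show "q (y + z) \<le> q y + q z" by simp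
    next
      show "q 0 = 0"
        using q_le[OF K(1), of 0] q_ge[of 0 0] low[of _ 0] sublinear_0[OF p] by fastforce
    next
      fix t :: real and y assume t: "0 < t"
      have "q (t *\<^sub>R y) / t \<le> q y"
      proof (rule q_ge)
        fix a assume "a \<in> K"
        then have "t *\<^sub>R a \<in> K" using K(3) t by simp
        from q_le[OF this, of "t *\<^sub>R y"]
        have "q (t *\<^sub>R y) \<le> t * (p (y + fst a) - snd a)"
          using sublinear_scale[OF p, of t "y + fst a"] t by (simp add: algebra_simps)
        then show "q (t *\<^sub>R y) / t \<le> p (y + fst a) - snd a"
          using t by (simp add: field_simps)
      qed
      then show "q (t *\<^sub>R y) \<le> t * q y" using t by (simp add: field_simps)
    qed
    show "q x \<le> p x" for x using q_le[OF K(1), of x] by simp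
    show "q (- x) \<le> - r" if "(x, r) \<in> K" for x r
      using q_le[OF that, of "- x"] sublinear_0[OF p] by simp
  qed
qed

text \<open>A minimal sublinear functional is linear, and Zorn's lemma provides one below \<open>p\<close>.\<close>

lemma hahn_banach_sublinear:
  fixes p :: "'v::real_vector \<Rightarrow> real"
  assumes p: "sublinear p"
  obtains f where "linear f" "\<And>x. f x \<le> p x"
proof -
  define A where "A = {q. sublinear q \<and> q \<le> p}"
  have "\<exists>m\<in>A. \<forall>a\<in>A. a \<le> m \<longrightarrow> a = m"
  proof (rule predicate_Zorn[where P="\<lambda>a b. b \<le> a", simplified, rotated])
    show "partial_order_on A (relation_of (\<lambda>a b. b \<le> a) A)"
      by (auto simp: partial_order_on_def preorder_on_def relation_of_def refl_on_def
          intro!: transI antisymI)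
    fix C assume "C \<in> Chains (relation_of (\<lambda>a b. b \<le> a) A)"
    then have CA: "C \<subseteq> A" and chain: "\<And>a b. a \<in> C \<Longrightarrow> b \<in> C \<Longrightarrow> a \<le> b \<or> b \<le> a"
      by (auto simp: Chains_def relation_of_def)
    show "\<exists>u\<in>A. \<forall>a\<in>C. u \<le> a"
    proof (cases "C = {}")
      case True
      then show ?thesis using p by (auto simp: A_def)
    next
      case False
      \<comment> \<open>The pointwise infimum of the chain is finite, since a sublinear
        \<open>q \<le> p\<close> satisfies \<open>- p (- x) \<le> q x\<close>.\<close>
      define u where "u x = (INF q\<in>C. q x)" for x
      have "- p (- x) \<le> q x" if "q \<in> C" for q x
        using sublinear_ge[of q x] that CA le_funD[of q p "- x"] by (force simp: A_def)
      then have bdd: "bdd_below ((\<lambda>q. q x) ` C)" for x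
        by (intro bdd_belowI2)
      have u_le: "u x \<le> q x" if "q \<in> C" for q x
        unfolding u_def by (rule cINF_lower[OF bdd that])
      have u_ge: "c \<le> u x" if "\<And>q. q \<in> C \<Longrightarrow> c \<le> q x" for c x
        unfolding u_def by (rule cINF_greatest) (use False that in auto)
      have "sublinear u"
      proof (rule sublinearI)
        fix x y
        have *: "u (x + y) \<le> q x + r y" if qr: "q \<in> C" "r \<in> C" for q r
        proof -
          obtain m where m: "m \<in> C" "m \<le> q" "m \<le> r" using chain[OF qr] qr by auto
          have "u (x + y) \<le> m (x + y)" by (rule u_le[OF m(1)])
          also have "\<dots> \<le> m x + m y" using m(1) CA by (auto simp: A_def sublinear_def)
          also have "\<dots> \<le> q x + r y" using m by (intro add_mono) (auto simp: le_fun_def)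
          finally show ?thesis .
        qed
        have "u (x + y) - r y \<le> u x" if "r \<in> C" for r
          by (rule u_ge) (use * that in \<open>simp add: algebra_simps\<close>)
        then have "u (x + y) - u x \<le> u y" by (intro u_ge) (simp add: algebra_simps)
        then show "u (x + y) \<le> u x + u y" by simp
      next
        have *: "q 0 = 0" if "q \<in> C" for q using that CA sublinear_0 by (auto simp: A_def)
        obtain q where "q \<in> C" using False by auto
        then have "u 0 \<le> 0" using u_le[of q 0] *[of q] by simp
        moreover have "0 \<le> u 0" by (rule u_ge) (metis * order_refl)
        ultimately show "u 0 = 0" by simp
      next
        fix t :: real and x assume t: "0 < t"
        have "u (t *\<^sub>R x) / t \<le> u x"
        proof (rule u_ge)
          fix q assume "q \<in> C"
          then have "sublinear q" using CA by (auto simp: A_def)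
          then have "u (t *\<^sub>R x) \<le> t * q x"
            using u_le[OF \<open>q \<in> C\<close>, of "t *\<^sub>R x"] sublinear_scale[of q t x] t by simp
          then show "u (t *\<^sub>R x) / t \<le> q x" using t by (simp add: field_simps)
        qed
        then show "u (t *\<^sub>R x) \<le> t * u x" using t by (simp add: field_simps)
      qed
      moreover have "u \<le> p"
      proof -
        obtain q where "q \<in> C" using False by auto
        then have "u \<le> q" "q \<le> p" using u_le CA by (auto simp: le_fun_def A_def)
        then show ?thesis by simp
      qed
      ultimately show ?thesis using u_le by (auto simp: A_def le_fun_def)
    qed
  qed
  then obtain m where m: "sublinear m" "m \<le> p" and min: "\<And>a. sublinear a \<Longrightarrow> a \<le> m \<Longrightarrow> a = m"
    by (auto simp: A_def dest: order_trans)
  have add: "m (x + y) = m x + m y" for x y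
  proof -
    \<comment> \<open>\<open>K\<close> is the ray through \<open>(x, m x)\<close>. The functional
      obtained from it lies below \<open>m\<close>, so it equals \<open>m\<close> by minimality, and
      its bound at \<open>- x\<close> is the missing half of additivity.\<close>
    define K where "K = (\<lambda>t. (t *\<^sub>R x, t * m x)) ` {0..}"
    obtain q where q: "sublinear q" "\<And>z. q z \<le> m z" "\<And>z r. (z, r) \<in> K \<Longrightarrow> q (- z) \<le> - r"
    proof (rule sublinear_inf_cone[OF m(1), of K])
      show "0 \<in> K" by (auto simp: K_def zero_prod_def intro!: image_eqI[of _ _ 0])
      show "a + b \<in> K" if "a \<in> K" "b \<in> K" for a b
        using that unfolding K_def by (auto simp flip: scaleR_add_left distrib_right)
      show "t *\<^sub>R a \<in> K" if "0 \<le> t" "a \<in> K" for t a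
        using that unfolding K_def by (auto simp: mult.assoc[symmetric])
      show "r \<le> m z" if "(z, r) \<in> K" for z r
        using that sublinear_scale[OF m(1)] by (auto simp: K_def)
    qed blast
    have "q = m" using q(1,2) by (intro min) (auto simp: le_fun_def)
    moreover have "(x, m x) \<in> K" by (auto simp: K_def intro!: image_eqI[of _ _ 1])
    ultimately have "m (- x) \<le> - m x" using q(3) by blast
    with sublinear_add[OF m(1), of "x + y" "- x"] sublinear_add[OF m(1), of x y]
    show ?thesis by simp
  qed
  have neg: "m (- x) = - m x" for x
    using add[of x "- x"] sublinear_0[OF m(1)] by simp
  have "m (t *\<^sub>R x) = t * m x" for t x
  proof (cases "0 \<le> t")
    case True
    then show ?thesis by (rule sublinear_scale[OF m(1)])
  next
    case False
    then show ?thesis using sublinear_scale[OF m(1), of "- t" x] neg[of "t *\<^sub>R x"] by simp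
  qed
  with add have "linear m" by (auto intro!: linearI)
  with m(2) that show ?thesis by (auto simp: le_fun_def)
qed

text \<open>The cone is absorbed into a smaller sublinear function first, so that plain domination
  suffices afterwards; evaluating at \<open>- x\<close> recovers the lower bound on
  \<open>f x\<close>.\<close>

lemma mazur_orlicz_cone:
  fixes p :: "'v::real_vector \<Rightarrow> real" and K :: "('v \<times> real) set"
  assumes "sublinear p"
    and "0 \<in> K" "\<And>a b. a \<in> K \<Longrightarrow> b \<in> K \<Longrightarrow> a + b \<in> K"
      "\<And>t a. 0 \<le> t \<Longrightarrow> a \<in> K \<Longrightarrow> t *\<^sub>R a \<in> K"
    and "\<And>x r. (x, r) \<in> K \<Longrightarrow> r \<le> p x"
  obtains f where "linear f" "\<And>x. f x \<le> p x" "\<And>x r. (x, r) \<in> K \<Longrightarrow> r \<le> f x"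
proof -
  obtain q where q: "sublinear q" "\<And>x. q x \<le> p x" "\<And>x r. (x, r) \<in> K \<Longrightarrow> q (- x) \<le> - r"
    by (rule sublinear_inf_cone[OF assms]) blast+
  obtain f where f: "linear f" "\<And>x. f x \<le> q x" using hahn_banach_sublinear[OF q(1)] by blast
  show ?thesis
  proof (rule that[OF f(1)])
    show "f x \<le> p x" for x using f(2) q(2) order_trans by blast
    show "r \<le> f x" if "(x, r) \<in> K" for x r
      using f(2)[of "- x"] q(3)[OF that] linear_neg[OF f(1), of x] by simp
  qed
qed

lemma mazur_orlicz_norm:
  fixes K :: "('v::real_normed_vector \<times> real) set"
  assumes C: "0 \<le> C"
    and K: "0 \<in> K" "\<And>a b. a \<in> K \<Longrightarrow> b \<in> K \<Longrightarrow> a + b \<in> K"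
      "\<And>t a. 0 \<le> t \<Longrightarrow> a \<in> K \<Longrightarrow> t *\<^sub>R a \<in> K"
    and "\<And>x r. (x, r) \<in> K \<Longrightarrow> r \<le> C * norm x"
  obtains f :: "'v \<Rightarrow>\<^sub>L real" where "norm f \<le> C" "\<And>x r. (x, r) \<in> K \<Longrightarrow> r \<le> blinfun_apply f x"
proof -
  have "sublinear (\<lambda>x::'v. C * norm x)"
  proof (rule sublinearI)
    show "C * norm (x + y) \<le> C * norm x + C * norm y" for x y :: 'v
      using mult_left_mono[OF norm_triangle_ineq[of x y] C] by (simp add: distrib_left)
  qed simp_all
  from mazur_orlicz_cone[OF this K] assms(5)
  obtain f where f: "linear f" "\<And>x. f x \<le> C * norm x" "\<And>x r. (x, r) \<in> K \<Longrightarrow> r \<le> f x"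
    by blast
  have abs: "norm (f x) \<le> C * norm x" for x
    using f(2)[of x] f(2)[of "- x"] linear_neg[OF f(1), of x] by simp
  then have bl: "bounded_linear f"
    using f(1) by (intro bounded_linear_intro[of f C]) (auto simp: linear_add linear_scale mult.commute)
  show ?thesis
  proof (rule that[of "Blinfun f"])
    show "norm (Blinfun f) \<le> C"
      using abs by (intro norm_blinfun_bound C) (simp add: bounded_linear_Blinfun_apply[OF bl])
  qed (simp add: bounded_linear_Blinfun_apply[OF bl] f(3))
qed

lemma blinfun_apply_le: "blinfun_apply f x \<le> norm f * norm x" for f :: "'v::real_normed_vector \<Rightarrow>\<^sub>L real"
  using norm_blinfun[of f x] by simp

lemma blinfun_apply_le_1:
  fixes f :: "'v::real_normed_vector \<Rightarrow>\<^sub>L real"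
  shows "norm f \<le> 1 \<Longrightarrow> blinfun_apply f x \<le> norm x"
  using blinfun_apply_le[of f x] mult_right_mono[of "norm f" 1 "norm x"] by simp

lemma norming_functional:
  fixes x :: "'v::real_normed_vector"
  obtains f :: "'v \<Rightarrow>\<^sub>L real" where "norm f \<le> 1" "blinfun_apply f x = norm x"
proof -
  define K where "K = (\<lambda>t. (t *\<^sub>R x, t * norm x)) ` {0..}"
  obtain f :: "'v \<Rightarrow>\<^sub>L real" where f: "norm f \<le> 1" "\<And>z r. (z, r) \<in> K \<Longrightarrow> r \<le> blinfun_apply f z"
  proof (rule mazur_orlicz_norm[of 1 K])
    show "0 \<in> K" by (auto simp: K_def zero_prod_def intro!: image_eqI[of _ _ 0])
    show "a + b \<in> K" if "a \<in> K" "b \<in> K" for a b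
      using that unfolding K_def by (auto simp flip: scaleR_add_left distrib_right)
    show "t *\<^sub>R a \<in> K" if "0 \<le> t" "a \<in> K" for t a
      using that unfolding K_def by (auto simp: mult.assoc[symmetric])
  qed (auto simp: K_def)
  have "(x, norm x) \<in> K" by (auto simp: K_def intro!: image_eqI[of _ _ 1])
  then have "blinfun_apply f x = norm x"
    using f(2) blinfun_apply_le_1[OF f(1), of x] by (intro antisym)
  with f(1) that show ?thesis by blast
qed

lemma norm_le_functional:
  fixes x :: "'v::real_normed_vector"
  assumes "\<And>f :: 'v \<Rightarrow>\<^sub>L real. norm f \<le> 1 \<Longrightarrow> blinfun_apply f x \<le> c"
  shows "norm x \<le> c"
  using norming_functional[of x] assms by metis

lemma blinfun_almost_norming:
  fixes u :: "'v::real_normed_vector \<Rightarrow>\<^sub>L real"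
  assumes "0 < e"
  obtains x where "norm x \<le> 1" "norm u - e < blinfun_apply u x"
proof (rule ccontr)
  assume *: "\<not> thesis"
  note thesisI = that
  have le: "blinfun_apply u x \<le> norm u - e" if "norm x \<le> 1" for x
    using * that thesisI[of x] by force
  have ge: "0 \<le> norm u - e" using le[of 0] by simp
  have "norm u \<le> norm u - e"
  proof (rule norm_blinfun_bound[OF ge])
    fix x
    show "norm (blinfun_apply u x) \<le> (norm u - e) * norm x"
    proof (cases "x = 0")
      case False
      have "\<bar>blinfun_apply u (x /\<^sub>R norm x)\<bar> \<le> norm u - e"
        using le[of "x /\<^sub>R norm x"] le[of "- (x /\<^sub>R norm x)"] False
        by (simp add: blinfun.minus_right)
      then show ?thesis
        using False by (simp add: blinfun.scaleR_right abs_mult field_simps)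
    qed simp
  qed
  with assms show False by simp
qed

section \<open>Separation by finitely many functionals\<close>

text \<open>Induction on \<open>W\<close>. If some \<open>z\<close> is killed by the old functionals
  but not by \<open>w j\<close>, subtracting a multiple of \<open>w j\<close> makes \<open>f\<close>
  vanish at \<open>z\<close>; a common zero of the old functionals can then be moved along
  \<open>z\<close> into the kernel of \<open>w j\<close>.\<close>

lemma linear_functional_in_span:
  fixes w :: "'i \<Rightarrow> 'v::real_vector \<Rightarrow> real"
  assumes "finite W" "\<And>i. i \<in> W \<Longrightarrow> linear (w i)" "linear f"
    and "\<And>x. (\<And>i. i \<in> W \<Longrightarrow> w i x = 0) \<Longrightarrow> f x = 0"
  shows "\<exists>a. \<forall>x. f x = (\<Sum>i\<in>W. a i * w i x)"
  using assms
proof (induction W arbitrary: f)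
  case (insert j W)
  show ?case
  proof (cases "\<exists>z. (\<forall>i\<in>W. w i z = 0) \<and> w j z \<noteq> 0")
    case False
    then obtain a where "\<forall>x. f x = (\<Sum>i\<in>W. a i * w i x)"
      using insert.IH[of f] insert.prems by blast
    then have "\<forall>x. f x = (\<Sum>i\<in>insert j W. (a(j := 0)) i * w i x)"
      using insert.hyps by (auto intro!: sum.cong)
    then show ?thesis by blast
  next
    case True
    then obtain z where z: "\<And>i. i \<in> W \<Longrightarrow> w i z = 0" "w j z \<noteq> 0" by blast
    define g where "g x = f x - (f z / w j z) * w j x" for x
    have lin: "linear (w i)" if "i \<in> insert j W" for i using insert.prems that by blast
    have "linear g"
      unfolding g_def using insert.prems(2) lin
      by (intro linearI) (auto simp: linear_add linear_scale algebra_simps)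
    moreover have "g x = 0" if x: "\<And>i. i \<in> W \<Longrightarrow> w i x = 0" for x
    proof -
      have "w i (x - (w j x / w j z) *\<^sub>R z) = 0" if "i \<in> insert j W" for i
        using that z x lin[OF that] by (auto simp: linear_diff linear_scale)
      then have "f (x - (w j x / w j z) *\<^sub>R z) = 0" by (rule insert.prems(3))
      then show ?thesis
        using insert.prems(2) by (simp add: g_def linear_diff linear_scale)
    qed
    ultimately obtain a where a: "\<forall>x. g x = (\<Sum>i\<in>W. a i * w i x)"
      using insert.IH[of g] lin by blast
    have "f x = (\<Sum>i\<in>insert j W. (a(j := f z / w j z)) i * w i x)" for x
    proof -
      have "(\<Sum>i\<in>W. (a(j := f z / w j z)) i * w i x) = (\<Sum>i\<in>W. a i * w i x)"
        using insert.hyps by (intro sum.cong) auto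
      also have "\<dots> = f x - (f z / w j z) * w j x" using a by (simp add: g_def)
      finally show ?thesis using insert.hyps by simp
    qed
    then show ?thesis by blast
  qed
qed auto

text \<open>The seminorm \<open>\<rho>\<close>, the sum of the absolute values of the
  \<open>w i\<close>, is at least \<open>e\<close> on all differences \<open>p - d\<close>, so a
  linear \<open>f\<close> below \<open>\<rho>\<close> can be required to be at least
  \<open>e\<close> there. Being below \<open>\<rho>\<close>, it vanishes on the common kernel and
  hence is a combination of the \<open>w i\<close>.\<close>

lemma finite_separation:
  fixes w :: "'i \<Rightarrow> 'v::real_vector \<Rightarrow> real"
  assumes W: "finite W" "\<And>i. i \<in> W \<Longrightarrow> linear (w i)"
    and C: "convex C" and e: "0 < e"
    and far: "\<And>d. d \<in> C \<Longrightarrow> \<exists>i\<in>W. e \<le> \<bar>w i (p - d)\<bar>"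
  obtains a where "\<And>d. d \<in> C \<Longrightarrow> (\<Sum>i\<in>W. a i * w i d) + e \<le> (\<Sum>i\<in>W. a i * w i p)"
proof (cases "C = {}")
  case False
  then obtain d0 where d0: "d0 \<in> C" by blast
  define \<rho> where "\<rho> x = (\<Sum>i\<in>W. \<bar>w i x\<bar>)" for x
  have sub: "sublinear \<rho>"
    unfolding sublinear_def \<rho>_def using W(2)
    by (auto simp: linear_add linear_scale abs_mult sum_distrib_left simp flip: sum.distrib
        intro!: sum_mono sum.cong)
  define K where "K = {(t *\<^sub>R (p - d), t * e) |t d. 0 \<le> t \<and> d \<in> C}"
  have K: "(t *\<^sub>R (p - d), t * e) \<in> K" if "0 \<le> t" "d \<in> C" for t d
    using that by (auto simp: K_def)
  obtain f where f: "linear f" "\<And>x. f x \<le> \<rho> x" "\<And>x r. (x, r) \<in> K \<Longrightarrow> r \<le> f x"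
  proof (rule mazur_orlicz_cone[OF sub, of K])
    show "0 \<in> K" using K[of 0 d0] d0 by (simp add: zero_prod_def)
    fix a b assume "a \<in> K" "b \<in> K"
    then obtain t d t' d' where *: "0 \<le> t" "d \<in> C" "a = (t *\<^sub>R (p - d), t * e)"
        "0 \<le> t'" "d' \<in> C" "b = (t' *\<^sub>R (p - d'), t' * e)"
      by (auto simp: K_def)
    show "a + b \<in> K"
    proof (cases "t + t' = 0")
      case True
      then have "t = 0" "t' = 0" using * by auto
      then show ?thesis using K[of 0 d0] d0 * by simp
    next
      case False
      define d'' where "d'' = (t / (t + t')) *\<^sub>R d + (t' / (t + t')) *\<^sub>R d'"
      have "d'' \<in> C"
        unfolding d''_def using * False by (intro convexD[OF C]) (auto simp: add_divide_distrib[symmetric])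
      moreover have "(t + t') *\<^sub>R d'' = t *\<^sub>R d + t' *\<^sub>R d'"
        using False by (simp add: d''_def scaleR_add_right)
      ultimately show ?thesis
        using K[of "t + t'" d''] * by (simp add: algebra_simps)
    qed
  next
    fix t :: real and a assume "0 \<le> t" "a \<in> K"
    then obtain t' d' where "0 \<le> t'" "d' \<in> C" "a = (t' *\<^sub>R (p - d'), t' * e)"
      by (auto simp: K_def)
    then show "t *\<^sub>R a \<in> K" using K[of "t * t'" d'] \<open>0 \<le> t\<close> by (simp add: mult.assoc)
  next
    fix x r assume "(x, r) \<in> K"
    then obtain t d where *: "0 \<le> t" "d \<in> C" "x = t *\<^sub>R (p - d)" "r = t * e"
      by (auto simp: K_def)
    obtain i where "i \<in> W" "e \<le> \<bar>w i (p - d)\<bar>" using far *(2) by blast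
    then have "e \<le> \<rho> (p - d)"
      unfolding \<rho>_def using W(1) member_le_sum[of i W "\<lambda>i. \<bar>w i (p - d)\<bar>"] by simp
    then show "r \<le> \<rho> x" using * sublinear_scale[OF sub] by (simp add: mult_left_mono)
  qed blast
  have "f x = 0" if "\<And>i. i \<in> W \<Longrightarrow> w i x = 0" for x
  proof -
    have "\<rho> x = 0" "\<rho> (- x) = 0" using that W(2) by (auto simp: \<rho>_def linear_neg)
    then show ?thesis using f(2)[of x] f(2)[of "- x"] linear_neg[OF f(1), of x] by simp
  qed
  with linear_functional_in_span[of W w f] W f(1)
  obtain a where a: "\<And>x. f x = (\<Sum>i\<in>W. a i * w i x)" by blast
  show ?thesis
  proof (rule that)
    fix d assume "d \<in> C"
    then have "e \<le> f (p - d)" using K[of 1 d] f(3) by simp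
    then show "(\<Sum>i\<in>W. a i * w i d) + e \<le> (\<Sum>i\<in>W. a i * w i p)"
      by (simp add: linear_diff[OF f(1)] flip: a)
  qed
qed (rule that, simp)

section \<open>The canonical embedding and Goldstine's theorem\<close>

lemma bidual_embedding_apply [simp]:
  "blinfun_apply (bidual_embedding x) f = blinfun_apply f x"
  by transfer simp

lemma bidual_embedding_diff: "bidual_embedding (x - y) = bidual_embedding x - bidual_embedding y"
  by (rule blinfun_eqI) (simp add: blinfun.diff_left blinfun.diff_right)

lemma norm_bidual_embedding [simp]: "norm (bidual_embedding x) = norm x"
proof (rule antisym)
  show "norm (bidual_embedding x) \<le> norm x"
    by (rule norm_blinfun_bound[OF norm_ge_zero]) (metis bidual_embedding_apply norm_blinfun mult.commute)
  obtain f where "norm f \<le> 1" "blinfun_apply f x = norm x" by (rule norming_functional)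
  then show "norm x \<le> norm (bidual_embedding x)"
    using blinfun_apply_le[of "bidual_embedding x" f] mult_left_mono[of "norm f" 1 "norm (bidual_embedding x)"]
    by simp
qed

lemma blinfun_sum_scaleR_apply:
  "blinfun_apply (\<Sum>i\<in>W. a i *\<^sub>R (i :: 'v::real_normed_vector \<Rightarrow>\<^sub>L real)) x = (\<Sum>i\<in>W. a i * blinfun_apply i x)"
  by (simp add: blinfun.sum_left blinfun.scaleR_left)

lemma linear_blinfun_apply: "linear (blinfun_apply f)"
  by (intro linearI) (auto simp: blinfun.add_right blinfun.scaleR_right)

text \<open>Otherwise \<open>finite_separation\<close> splits \<open>\<zeta>\<close> from the image
  of the ball. The separating combination is evaluation at a single functional \<open>u\<close>, and
  its supremum over the ball is \<open>norm \<zeta> * norm u\<close>, which contradicts the bound on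
  \<open>\<zeta>\<close> at \<open>u\<close>. The result is applied below both to the space and to
  its dual.\<close>

lemma goldstine:
  fixes \<zeta> :: "('v::real_normed_vector \<Rightarrow>\<^sub>L real) \<Rightarrow>\<^sub>L real"
  assumes "finite W" "0 < e"
  obtains z where "norm z \<le> norm \<zeta>" "\<And>w. w \<in> W \<Longrightarrow> \<bar>blinfun_apply w z - blinfun_apply \<zeta> w\<bar> < e"
proof (rule ccontr)
  assume neg: "\<not> thesis"
  note thesisI = that
  define C where "C = (bidual_embedding :: 'v \<Rightarrow> _) ` cball 0 (norm \<zeta>)"
  have emb: "linear (bidual_embedding :: 'v \<Rightarrow> _)"
    by (intro linearI blinfun_eqI)
      (auto simp: blinfun.add_left blinfun.add_right blinfun.scaleR_left blinfun.scaleR_right)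
  have C: "convex C" unfolding C_def by (intro convex_linear_image emb convex_cball)
  have far: "\<exists>w\<in>W. e \<le> \<bar>blinfun_apply (\<zeta> - d) w\<bar>" if d: "d \<in> C" for d
  proof -
    obtain z where z: "z \<in> cball 0 (norm \<zeta>)" "d = bidual_embedding z"
      using d unfolding C_def by blast
    have "\<not> (\<forall>w\<in>W. \<bar>blinfun_apply w z - blinfun_apply \<zeta> w\<bar> < e)"
      using neg thesisI[of z] z(1) by auto
    then show ?thesis using z by (auto simp: blinfun.diff_left abs_minus_commute not_less)
  qed
  have lin: "linear (\<lambda>\<xi> :: ('v \<Rightarrow>\<^sub>L real) \<Rightarrow>\<^sub>L real. blinfun_apply \<xi> w)" for w
    by (intro linearI) (auto simp: blinfun.add_left blinfun.scaleR_left)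
  obtain a where a: "\<And>d. d \<in> C \<Longrightarrow>
      (\<Sum>w\<in>W. a w * blinfun_apply d w) + e \<le> (\<Sum>w\<in>W. a w * blinfun_apply \<zeta> w)"
    by (rule finite_separation[of W "\<lambda>w \<xi>. blinfun_apply \<xi> w" C e \<zeta>, OF assms(1) lin C assms(2) far]) blast+
  define u where "u = (\<Sum>w\<in>W. a w *\<^sub>R w)"
  have u: "(\<Sum>w\<in>W. a w * blinfun_apply w z) = blinfun_apply u z" for z
    by (simp add: u_def blinfun_sum_scaleR_apply)
  have \<zeta>u: "(\<Sum>w\<in>W. a w * blinfun_apply \<zeta> w) = blinfun_apply \<zeta> u"
    by (simp add: u_def blinfun.sum_right blinfun.scaleR_right)
  have "norm \<zeta> * norm u + e \<le> blinfun_apply \<zeta> u"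
  proof (rule field_le_epsilon)
    fix \<eta> :: real assume \<eta>: "0 < \<eta>"
    have p: "0 < norm \<zeta> + 1" by (simp add: add_nonneg_pos)
    define \<eta>' where "\<eta>' = \<eta> / (norm \<zeta> + 1)"
    have \<eta>': "0 < \<eta>'" "norm \<zeta> * \<eta>' \<le> \<eta>" using \<eta> p by (auto simp: \<eta>'_def divide_simps algebra_simps)
    obtain x where x: "norm x \<le> 1" "norm u - \<eta>' < blinfun_apply u x"
      by (rule blinfun_almost_norming[OF \<eta>'(1)])
    have "norm \<zeta> * norm x \<le> norm \<zeta>" using x(1) by (simp add: mult_left_le)
    then have "bidual_embedding (norm \<zeta> *\<^sub>R x) \<in> C" by (auto simp: C_def)
    from a[OF this] have "norm \<zeta> * blinfun_apply u x + e \<le> blinfun_apply \<zeta> u"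
      unfolding bidual_embedding_apply u \<zeta>u by (simp add: blinfun.scaleR_right)
    moreover have "norm \<zeta> * (norm u - \<eta>') \<le> norm \<zeta> * blinfun_apply u x"
      using x(2) by (intro mult_left_mono) auto
    ultimately show "norm \<zeta> * norm u + e \<le> blinfun_apply \<zeta> u + \<eta>"
      using \<eta>'(2) by (simp add: algebra_simps)
  qed
  with blinfun_apply_le[of \<zeta> u] assms(2) show False by simp
qed

section \<open>Ultrafilters and weak limits\<close>

definition ultrafilter :: "'i filter \<Rightarrow> bool" where
  "ultrafilter U \<longleftrightarrow> U \<noteq> bot \<and> (\<forall>P. eventually P U \<or> eventually (\<lambda>x. \<not> P x) U)"

lemma ex_ultrafilter:
  assumes "F \<noteq> bot"
  obtains U where "U \<le> F" "ultrafilter U"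
proof -
  define A where "A = {G. G \<le> F \<and> G \<noteq> bot}"
  have "\<exists>m\<in>A. \<forall>a\<in>A. a \<le> m \<longrightarrow> a = m"
  proof (rule predicate_Zorn[where P="\<lambda>a b. b \<le> a", simplified, rotated])
    show "partial_order_on A (relation_of (\<lambda>a b. b \<le> a) A)"
      by (auto simp: partial_order_on_def preorder_on_def relation_of_def refl_on_def
          intro!: transI antisymI)
    fix C assume "C \<in> Chains (relation_of (\<lambda>a b. b \<le> a) A)"
    then have CA: "C \<subseteq> A" and chain: "\<And>a b. a \<in> C \<Longrightarrow> b \<in> C \<Longrightarrow> a \<le> b \<or> b \<le> a"
      by (auto simp: Chains_def relation_of_def)
    show "\<exists>u\<in>A. \<forall>a\<in>C. u \<le> a"
    proof (cases "C = {}")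
      case True
      then show ?thesis using assms by (auto simp: A_def)
    next
      case False
      have ev: "eventually P (Inf C) \<longleftrightarrow> (\<exists>b\<in>C. eventually P b)" for P
        by (rule eventually_Inf_base[OF False]) (use chain in \<open>metis inf.orderI inf_commute inf.absorb1 order_refl\<close>)
      have "Inf C \<noteq> bot" using ev[of "\<lambda>_. False"] CA by (auto simp: trivial_limit_def A_def)
      moreover have "Inf C \<le> F" using False CA by (auto simp: A_def intro: Inf_lower2)
      ultimately show ?thesis by (auto simp: A_def intro: Inf_lower)
    qed
  qed
  then obtain U where U: "U \<le> F" "U \<noteq> bot" and min: "\<And>a. a \<le> F \<Longrightarrow> a \<noteq> bot \<Longrightarrow> a \<le> U \<Longrightarrow> a = U"
    by (auto simp: A_def)
  have "eventually P U" if "\<not> eventually (\<lambda>x. \<not> P x) U" for P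
  proof -
    have "inf U (principal {x. P x}) \<noteq> bot"
      using that by (auto simp: trivial_limit_def eventually_inf_principal)
    then have "inf U (principal {x. P x}) = U" using U(1) by (intro min) (auto intro: le_infI1)
    moreover have "eventually P (inf U (principal {x. P x}))"
      by (simp add: eventually_inf_principal)
    ultimately show ?thesis by simp
  qed
  with U that show ?thesis unfolding ultrafilter_def by blast
qed

lemma ultrafilter_bounded_tendsto:
  fixes h :: "'i \<Rightarrow> real"
  assumes U: "ultrafilter U" and b: "eventually (\<lambda>i. \<bar>h i\<bar> \<le> B) U"
  obtains l where "(h \<longlongrightarrow> l) U"
proof -
  have "filtermap h U \<noteq> bot" using U by (simp add: ultrafilter_def filtermap_bot_iff)
  moreover have "eventually (\<lambda>x. x \<in> {-B..B}) (filtermap h U)"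
    using b unfolding eventually_filtermap by eventually_elim auto
  ultimately obtain l where l: "inf (nhds l) (filtermap h U) \<noteq> bot"
    using compact_Icc[of "-B" B] unfolding compact_filter by blast
  have "(h \<longlongrightarrow> l) U"
    unfolding tendsto_def
  proof (intro allI impI)
    fix S assume S: "open S" "l \<in> S"
    show "eventually (\<lambda>x. h x \<in> S) U"
    proof (rule ccontr)
      assume "\<not> ?thesis"
      then have "eventually (\<lambda>x. h x \<notin> S) U" using U by (auto simp: ultrafilter_def)
      then have "eventually (\<lambda>x. x \<notin> S) (inf (nhds l) (filtermap h U))"
        by (intro filter_leD[OF inf_le2]) (simp add: eventually_filtermap)
      moreover have "eventually (\<lambda>x. x \<in> S) (inf (nhds l) (filtermap h U))"
        by (intro filter_leD[OF inf_le1] eventually_nhds_in_open S)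
      ultimately have "eventually (\<lambda>_. False) (inf (nhds l) (filtermap h U))"
        by eventually_elim auto
      with l show False by (simp add: trivial_limit_def)
    qed
  qed
  with that show ?thesis .
qed

text \<open>Banach-Alaoglu along an ultrafilter: the values at each point converge because they are
  bounded, and linearity and the norm bound pass to the limit.\<close>

lemma ultrafilter_weak_star_limit:
  fixes f :: "'i \<Rightarrow> 'v::real_normed_vector \<Rightarrow>\<^sub>L real"
  assumes U: "ultrafilter U" and b: "eventually (\<lambda>i. norm (f i) \<le> B) U"
  obtains l :: "'v \<Rightarrow>\<^sub>L real"
  where "norm l \<le> B" "\<And>x. ((\<lambda>i. blinfun_apply (f i) x) \<longlongrightarrow> blinfun_apply l x) U"
proof -
  have nb: "U \<noteq> bot" using U by (simp add: ultrafilter_def)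
  have bx: "eventually (\<lambda>i. \<bar>blinfun_apply (f i) x\<bar> \<le> B * norm x) U" for x
    using b by eventually_elim (metis norm_blinfun mult_right_mono norm_ge_zero order_trans real_norm_def)
  have "\<exists>l. ((\<lambda>i. blinfun_apply (f i) x) \<longlongrightarrow> l) U" for x
    using ultrafilter_bounded_tendsto[OF U bx] by blast
  then obtain l where l: "\<And>x. ((\<lambda>i. blinfun_apply (f i) x) \<longlongrightarrow> l x) U" by metis
  have "0 \<le> B"
    using eventually_happens[OF b] nb by (auto intro: order_trans[OF norm_ge_zero])
  have lb: "norm (l x) \<le> B * norm x" for x
    using tendsto_upperbound[OF tendsto_rabs[OF l[of x]] bx[of x] nb] by simp
  have "linear l"
  proof (rule linearI)
    show "l (x + y) = l x + l y" for x y
      using tendsto_unique[OF nb l[of "x + y"]] tendsto_add[OF l[of x] l[of y]]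
      by (simp add: blinfun.add_right)
    show "l (r *\<^sub>R x) = r *\<^sub>R l x" for r x
      using tendsto_unique[OF nb l[of "r *\<^sub>R x"]] tendsto_mult_left[OF l[of x], of r]
      by (simp add: blinfun.scaleR_right)
  qed
  then have bl: "bounded_linear l"
    using lb by (intro bounded_linear_intro[of l B]) (auto simp: linear_add linear_scale mult.commute)
  show ?thesis
    using lb by (intro that[of "Blinfun l"])
      (auto simp: bounded_linear_Blinfun_apply[OF bl] l intro!: norm_blinfun_bound \<open>0 \<le> B\<close>)
qed

text \<open>Embed into the bidual, take the weak-star limit there, and pull it back by
  surjectivity.\<close>

lemma reflexive_weak_limit:
  fixes z :: "'i \<Rightarrow> 'v::real_normed_vector"
  assumes "reflexive_space TYPE('v)" "ultrafilter U" "eventually (\<lambda>i. norm (z i) \<le> B) U"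
  obtains x where "\<And>w :: 'v \<Rightarrow>\<^sub>L real. ((\<lambda>i. blinfun_apply w (z i)) \<longlongrightarrow> blinfun_apply w x) U"
proof -
  have "eventually (\<lambda>i. norm (bidual_embedding (z i)) \<le> B) U" using assms(3) by simp
  then obtain l where l: "\<And>w. ((\<lambda>i. blinfun_apply (bidual_embedding (z i)) w) \<longlongrightarrow> blinfun_apply l w) U"
    using ultrafilter_weak_star_limit[OF assms(2), of "\<lambda>i. bidual_embedding (z i)" B] by metis
  obtain x where "l = bidual_embedding x"
    using assms(1) unfolding reflexive_space_def surj_def by blast
  with l that[of x] show ?thesis by simp
qed

text \<open>This converts approximation on finite sets into convergence of every coordinate. The
  coordinates \<open>w j\<close> are arbitrary real functions, so that a norm excess can be
  controlled along with functionals.\<close>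

lemma ex_ultrafilter_finite_approx:
  fixes w :: "'j \<Rightarrow> 'v \<Rightarrow> real"
  assumes "\<And>W \<eta>. finite W \<Longrightarrow> W \<subseteq> J \<Longrightarrow> 0 < \<eta> \<Longrightarrow> \<exists>z\<in>S. \<forall>j\<in>W. \<bar>w j z - l j\<bar> \<le> \<eta>"
  obtains U where "ultrafilter U" "eventually (\<lambda>z. z \<in> S) U" "\<And>j. j \<in> J \<Longrightarrow> ((w j) \<longlongrightarrow> l j) U"
proof -
  define N where "N = (\<lambda>(W, \<eta>). {z\<in>S. \<forall>j\<in>W. \<bar>w j z - l j\<bar> \<le> \<eta>})"
  define I where "I = {(W, \<eta>). finite W \<and> W \<subseteq> J \<and> 0 < (\<eta> :: real)}"
  define F where "F = (INF i\<in>I. principal (N i))"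
  have I: "I \<noteq> {}" by (auto simp: I_def intro!: exI[of _ "{}"] exI[of _ 1])
  have ev: "eventually P F \<longleftrightarrow> (\<exists>i\<in>I. eventually P (principal (N i)))" for P
    unfolding F_def
  proof (rule eventually_INF_base[OF I])
    fix a b assume "a \<in> I" "b \<in> I"
    then obtain W \<eta> W' \<eta>' where "a = (W, \<eta>)" "b = (W', \<eta>')" "finite W" "W \<subseteq> J" "0 < \<eta>"
      "finite W'" "W' \<subseteq> J" "0 < \<eta>'" by (auto simp: I_def)
    then show "\<exists>x\<in>I. principal (N x) \<le> inf (principal (N a)) (principal (N b))"
      by (intro bexI[of _ "(W \<union> W', min \<eta> \<eta>')"]) (auto simp: I_def N_def)
  qed
  have "F \<noteq> bot"
    using assms unfolding trivial_limit_def ev by (fastforce simp: eventually_principal I_def N_def)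
  then obtain U where U: "U \<le> F" "ultrafilter U" by (rule ex_ultrafilter)
  have evI: "eventually (\<lambda>z. z \<in> N i) U" if "i \<in> I" for i
    by (rule filter_leD[OF U(1)]) (use ev that in \<open>auto simp: eventually_principal\<close>)
  show ?thesis
  proof (rule that[OF U(2)])
    obtain i where "i \<in> I" using I by blast
    from evI[OF this] show "eventually (\<lambda>z. z \<in> S) U"
      by eventually_elim (auto simp: N_def split: prod.splits)
    fix j assume "j \<in> J"
    show "(w j \<longlongrightarrow> l j) U"
    proof (rule tendstoI)
      fix e :: real assume "0 < e"
      then have "({j}, e / 2) \<in> I" using \<open>j \<in> J\<close> by (auto simp: I_def)
      from evI[OF this] show "eventually (\<lambda>z. dist (w j z) (l j) < e) U"
        by eventually_elim (use \<open>0 < e\<close> in \<open>auto simp: N_def dist_real_def\<close>)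
    qed
  qed
qed

subsection \<open>Flat points and c0-sequences\<close>

text \<open>The comparison of limits superior costs strictness: an eventual bound \<open>b\<close>
  on one side yields every larger \<open>b'\<close> on the other.\<close>

lemma property_Mstar_eventually:
  fixes k :: "'i \<Rightarrow> 'a::real_normed_vector \<Rightarrow>\<^sub>L real"
  assumes M: "property_Mstar TYPE('a) 1 s" and "norm u \<le> norm v" and "F \<noteq> bot"
    and "eventually (\<lambda>i. norm (k i) \<le> B) F"
    and null: "\<And>x. ((\<lambda>i. blinfun_apply (k i) x) \<longlongrightarrow> 0) F"
    and le: "eventually (\<lambda>i. norm (v + k i) \<le> b) F" and "b < b'"
  shows "eventually (\<lambda>i. norm (u + s *\<^sub>R k i) < b') F"
proof -
  have "limitin weak_star_topology k 0 F"
    using null by (simp add: limitin_weak_star_topology_iff)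
  from property_Mstar_net[OF assms(1-4) this]
  have "Limsup F (\<lambda>i. ereal (norm (u + s *\<^sub>R k i))) \<le> Limsup F (\<lambda>i. ereal (norm (v + k i)))"
    by simp
  also have "\<dots> \<le> ereal b"
    by (rule Limsup_bounded) (use le in simp)
  also have "\<dots> < ereal b'" using \<open>b < b'\<close> by simp
  finally show ?thesis by (auto dest: Limsup_lessD)
qed

definition flat_at :: "'a::real_normed_vector \<Rightarrow> bool" where
  "flat_at x0 \<longleftrightarrow> norm x0 = 1 \<and>
    (\<exists>c>0. \<forall>(W :: ('a \<Rightarrow>\<^sub>L real) set) \<eta>. finite W \<longrightarrow> 0 < \<eta> \<longrightarrow>
      (\<exists>y. c \<le> norm y \<and> norm (x0 + y) \<le> 1 + \<eta> \<and> (\<forall>w\<in>W. \<bar>blinfun_apply w y\<bar> \<le> \<eta>)))"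

text \<open>Testing \<open>x + s y\<close> on norming functionals \<open>F y\<close> with weak\<open>*\<close> limit \<open>f\<close>, and \<open>x0 + y\<close> on
  \<open>norm f \<cdot> n + s (F y - f)\<close> with \<open>n\<close> norming \<open>x0\<close>, turns property \<open>M\<^sup>*\<close> into its
  predual version.\<close>

lemma flat_transfer:
  fixes U :: "'a::real_normed_vector filter"
  assumes M: "property_Mstar TYPE('a) 1 s" and s: "0 < s"
    and U: "ultrafilter U"
    and null: "\<And>w :: 'a \<Rightarrow>\<^sub>L real. ((\<lambda>y. blinfun_apply w y) \<longlongrightarrow> 0) U"
    and x0: "norm x0 = 1"
    and flat: "\<And>e. 0 < e \<Longrightarrow> eventually (\<lambda>y. norm (x0 + y) \<le> 1 + e) U"
    and x: "norm x \<le> 1" and e: "0 < e"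
  shows "eventually (\<lambda>y. norm (x + s *\<^sub>R y) \<le> 1 + e) U"
proof -
  have nb: "U \<noteq> bot" using U by (simp add: ultrafilter_def)
  have "\<exists>f :: 'a \<Rightarrow>\<^sub>L real. norm f \<le> 1 \<and> blinfun_apply f (x + s *\<^sub>R y) = norm (x + s *\<^sub>R y)" for y
    using norming_functional by metis
  then obtain F :: "'a \<Rightarrow> 'a \<Rightarrow>\<^sub>L real" where F: "\<And>y. norm (F y) \<le> 1"
      "\<And>y. blinfun_apply (F y) (x + s *\<^sub>R y) = norm (x + s *\<^sub>R y)"
    by metis
  obtain f where f: "norm f \<le> 1" "\<And>z. ((\<lambda>y. blinfun_apply (F y) z) \<longlongrightarrow> blinfun_apply f z) U"
    using ultrafilter_weak_star_limit[OF U, of F 1] F(1) by auto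
  define k where "k y = F y - f" for y
  have k0: "((\<lambda>y. blinfun_apply (k y) z) \<longlongrightarrow> 0) U" for z
    using tendsto_diff[OF f(2)[of z] tendsto_const[of "blinfun_apply f z"]]
    by (simp add: k_def blinfun.diff_left)
  have kb: "norm (k y) \<le> 2" for y
    using norm_triangle_ineq4[of "F y" f] F(1)[of y] f(1) by (simp add: k_def)
  obtain n :: "'a \<Rightarrow>\<^sub>L real" where n: "norm n \<le> 1" "blinfun_apply n x0 = 1"
    using norming_functional[of x0] x0 by auto
  \<comment> \<open>Since \<open>norm u \<le> norm f\<close>, property M-star compares
    \<open>u + s k\<close> with \<open>f + k = F\<close>, whose norm is at most 1. The multiple is
    chosen so that \<open>u\<close> has the value \<open>norm f\<close> at
    \<open>x0\<close>.\<close>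
  define u where "u = norm f *\<^sub>R n"
  have u: "norm u \<le> norm f" using n(1) by (simp add: u_def mult_left_le)
  \<comment> \<open>With \<open>e' \<le> 1\<close> the square of \<open>1 + e'\<close> is at most
    \<open>1 + 3 * e'\<close>, which is within \<open>1 + e / 2\<close>.\<close>
  define e' where "e' = min 1 (e / 6)"
  have e': "0 < e'" "e' \<le> 1" "6 * e' \<le> e" using e by (auto simp: e'_def)
  have ev1: "eventually (\<lambda>y. norm (u + s *\<^sub>R k y) < 1 + e') U"
    by (rule property_Mstar_eventually[OF M u nb, where B=2 and b=1])
      (use kb k0 F(1) e' in \<open>auto simp: k_def\<close>)
  \<comment> \<open>Every cross term vanishes along \<open>U\<close>: \<open>k y\<close> is
    weak-star null at the fixed vectors, and \<open>y\<close> is weakly null under the fixed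
    functionals. The only other mixed term, \<open>s\<close> times \<open>k y\<close> at
    \<open>y\<close>, occurs identically in both pairings.\<close>
  have "((\<lambda>y. blinfun_apply (k y) x + s * blinfun_apply f y - blinfun_apply u y
      - s * blinfun_apply (k y) x0) \<longlongrightarrow> 0 + s * 0 - 0 - s * 0) U"
    by (intro tendsto_intros k0 null)
  then have ev2: "eventually (\<lambda>y. blinfun_apply (k y) x + s * blinfun_apply f y - blinfun_apply u y
      - s * blinfun_apply (k y) x0 < e / 2) U"
    using e by (intro order_tendstoD(2)[where y=0]) auto
  show ?thesis
    using ev1 ev2 flat[OF e'(1)]
  proof eventually_elim
    case (elim y)
    have "blinfun_apply (u + s *\<^sub>R k y) (x0 + y) \<le> norm (u + s *\<^sub>R k y) * norm (x0 + y)"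
      by (rule blinfun_apply_le)
    also have "\<dots> \<le> (1 + e') * (1 + e')"
      using elim e' by (intro mult_mono) auto
    also have "\<dots> = 1 + 2 * e' + e' * e'" by (simp add: algebra_simps)
    also have "\<dots> \<le> 1 + e / 2"
      using e' mult_left_mono[of e' 1 e'] by linarith
    finally have *: "norm f + blinfun_apply u y + s * blinfun_apply (k y) x0
        + s * blinfun_apply (k y) y \<le> 1 + e / 2"
      by (simp add: blinfun.add_left blinfun.add_right blinfun.scaleR_left u_def n(2) algebra_simps)
    have "norm (x + s *\<^sub>R y) = blinfun_apply (f + k y) (x + s *\<^sub>R y)"
      by (simp add: k_def F(2))
    also have "\<dots> = blinfun_apply f x + blinfun_apply (k y) x + s * blinfun_apply f y
        + s * blinfun_apply (k y) y"
      by (simp add: blinfun.add_left blinfun.add_right blinfun.scaleR_right algebra_simps)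
    also have "blinfun_apply f x \<le> norm f"
      using blinfun_apply_le[of f x] mult_left_mono[OF x, of "norm f"] by simp
    finally show ?case using * elim(2) by simp
  qed
qed

text \<open>One ultrafilter at a single flat point supplies everything. \<open>flat_transfer\<close>
  gives the two norm bounds for the scaled vector \<open>s y\<close>, and the functional is a
  norming functional \<open>V y\<close> minus the limit \<open>v\<close> of these: it is small on
  any finite set, but still large at \<open>y\<close> because \<open>v\<close> at \<open>y\<close>
  tends to 0.\<close>

lemma flat_selection:
  fixes x0 :: "'a::real_normed_vector"
  assumes M: "property_Mstar TYPE('a) 1 s" and s: "0 < s" and flat: "flat_at x0"
  obtains d where "0 < d" "d \<le> 1"
    "\<And>(Z :: 'a set) (W :: ('a \<Rightarrow>\<^sub>L real) set) e. finite Z \<Longrightarrow> finite W \<Longrightarrow> 0 < e \<Longrightarrow>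
      \<exists>y (g :: 'a \<Rightarrow>\<^sub>L real). norm g \<le> 2 \<and> d \<le> blinfun_apply g y \<and>
        (\<forall>z\<in>Z. \<bar>blinfun_apply g z\<bar> < e \<and>
          norm (z + y) \<le> max 1 (norm z) + e \<and> norm (z - y) \<le> max 1 (norm z) + e) \<and>
        (\<forall>w\<in>W. \<bar>blinfun_apply w y\<bar> < e)"
proof -
  obtain c where c: "0 < c" and sel: "\<And>(W :: ('a \<Rightarrow>\<^sub>L real) set) \<eta>. finite W \<Longrightarrow> 0 < \<eta> \<Longrightarrow>
      \<exists>y. c \<le> norm y \<and> norm (x0 + y) \<le> 1 + \<eta> \<and> (\<forall>w\<in>W. \<bar>blinfun_apply w y\<bar> \<le> \<eta>)"
    and x0: "norm x0 = 1"
    using flat unfolding flat_at_def by blast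
  \<comment> \<open>The index \<open>None\<close> measures how far \<open>x0 + y\<close> leaves the
    unit ball, the indices \<open>Some w\<close> the functionals; a single ultrafilter then controls
    both.\<close>
  define h where "h j y = (case j of None \<Rightarrow> max 0 (norm (x0 + y) - 1)
      | Some w \<Rightarrow> blinfun_apply w y)" for j :: "('a \<Rightarrow>\<^sub>L real) option" and y
  obtain U where U: "ultrafilter U" "eventually (\<lambda>y. y \<in> {y. c \<le> norm y}) U"
      "\<And>j. (h j \<longlongrightarrow> 0) U"
  proof (rule ex_ultrafilter_finite_approx[of UNIV "{y. c \<le> norm y}" h "\<lambda>_. 0"])
    fix W :: "('a \<Rightarrow>\<^sub>L real) option set" and \<eta> :: real
    assume "finite W" "0 < \<eta>"
    then obtain y where y: "c \<le> norm y" "norm (x0 + y) \<le> 1 + \<eta>"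
        "\<And>w. Some w \<in> W \<Longrightarrow> \<bar>blinfun_apply w y\<bar> \<le> \<eta>"
      using sel[of "Some -` W" \<eta>] by (auto simp: finite_vimageI)
    then show "\<exists>z\<in>{y. c \<le> norm y}. \<forall>j\<in>W. \<bar>h j z - 0\<bar> \<le> \<eta>"
      using \<open>0 < \<eta>\<close> by (intro bexI[of _ y]) (auto simp: h_def split: option.splits)
  qed auto
  have nb: "U \<noteq> bot" using U(1) by (simp add: ultrafilter_def)
  have null: "((\<lambda>y. blinfun_apply w y) \<longlongrightarrow> 0) U" for w :: "'a \<Rightarrow>\<^sub>L real"
  proof -
    have "h (Some w) = blinfun_apply w" by (rule ext) (simp add: h_def)
    then show ?thesis using U(3)[of "Some w"] by simp
  qed
  have flatU: "eventually (\<lambda>y. norm (x0 + y) \<le> 1 + e) U" if "0 < e" for e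
  proof -
    have "eventually (\<lambda>y. h None y < e) U" using U(3)[of None] that by (rule order_tendstoD(2))
    then show ?thesis by eventually_elim (auto simp: h_def)
  qed
  have "\<exists>f :: 'a \<Rightarrow>\<^sub>L real. norm f \<le> 1 \<and> blinfun_apply f y = norm y" for y
    using norming_functional by metis
  then obtain V :: "'a \<Rightarrow> 'a \<Rightarrow>\<^sub>L real" where V: "\<And>y. norm (V y) \<le> 1"
      "\<And>y. blinfun_apply (V y) y = norm y"
    by metis
  obtain v where v: "norm v \<le> 1" "\<And>z. ((\<lambda>y. blinfun_apply (V y) z) \<longlongrightarrow> blinfun_apply v z) U"
    using ultrafilter_weak_star_limit[OF U(1), of V 1] V(1) by auto
  define g where "g y = V y - v" for y
  have g0: "((\<lambda>y. blinfun_apply (g y) z) \<longlongrightarrow> 0) U" for z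
    using tendsto_diff[OF v(2)[of z] tendsto_const[of "blinfun_apply v z"]]
    by (simp add: g_def blinfun.diff_left)
  have gb: "norm (g y) \<le> 2" for y
    using norm_triangle_ineq4[of "V y" v] V(1)[of y] v(1) by (simp add: g_def)
  \<comment> \<open>From \<open>norm y \<ge> c\<close> and \<open>v\<close> at \<open>y\<close>
    below \<open>c / 2\<close>, the difference \<open>V y - v\<close> is at least
    \<open>c / 2\<close> at \<open>y\<close>; the factor \<open>s\<close> is the scaling of
    \<open>y\<close>. The cap at 1 serves the error estimate of the induction.\<close>
  define d where "d = min 1 (s * c / 2)"
  show ?thesis
  proof (rule that[of d])
    show "0 < d" "d \<le> 1" using s c by (auto simp: d_def)
    fix Z :: "'a set" and W :: "('a \<Rightarrow>\<^sub>L real) set" and e :: real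
    assume fin: "finite Z" "finite W" and e: "0 < e"
    have tr: "eventually (\<lambda>y. norm (z + s *\<^sub>R y) \<le> 1 + e) U" if "norm z \<le> 1" for z
      by (rule flat_transfer[OF M s U(1) null x0]) (use flatU e that in auto)
    have ball: "eventually (\<lambda>y. norm (z + s *\<^sub>R y) \<le> max 1 (norm z) + e) U" for z
    proof (cases "norm z \<le> 1")
      case True
      from tr[OF True] show ?thesis
        by eventually_elim auto
    next
      case False
      \<comment> \<open>A point outside the unit ball is a unit vector \<open>z'\<close> plus
        \<open>(norm z - 1)\<close> times \<open>z'\<close>; only the first summand is perturbed by
        \<open>s y\<close>.\<close>
      define z' where "z' = z /\<^sub>R norm z"
      have nz: "norm z \<noteq> 0" using False by auto
      then have z': "norm z' \<le> 1" by (simp add: z'_def)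
      from tr[OF z'] show ?thesis
      proof eventually_elim
        case (elim y)
        have zz: "z = norm z *\<^sub>R z'" using nz by (simp add: z'_def)
        then have eq: "z + s *\<^sub>R y = (norm z - 1) *\<^sub>R z' + (z' + s *\<^sub>R y)"
          by (simp add: scaleR_diff_left)
        have "norm (z + s *\<^sub>R y) \<le> norm ((norm z - 1) *\<^sub>R z') + norm (z' + s *\<^sub>R y)"
          unfolding eq by (rule norm_triangle_ineq)
        also have "norm ((norm z - 1) *\<^sub>R z') = (norm z - 1) * norm z'"
          using False by simp
        also have "(norm z - 1) * norm z' \<le> norm z - 1"
          using z' False by (intro mult_left_le) auto
        finally show ?case using elim by simp
      qed
    qed
    have "eventually (\<lambda>y. \<bar>blinfun_apply (g y) z\<bar> < e \<and>
          norm (z + s *\<^sub>R y) \<le> max 1 (norm z) + e \<and> norm (z - s *\<^sub>R y) \<le> max 1 (norm z) + e) U" for z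
    proof (intro eventually_conj)
      show "eventually (\<lambda>y. \<bar>blinfun_apply (g y) z\<bar> < e) U"
        using tendstoD[OF g0 e, of z] by simp
      show "eventually (\<lambda>y. norm (z - s *\<^sub>R y) \<le> max 1 (norm z) + e) U"
        using ball[of "- z"] by eventually_elim (simp add: norm_minus_commute)
    qed (rule ball)
    then have ev1: "eventually (\<lambda>y. \<forall>z\<in>Z. \<bar>blinfun_apply (g y) z\<bar> < e \<and>
          norm (z + s *\<^sub>R y) \<le> max 1 (norm z) + e \<and> norm (z - s *\<^sub>R y) \<le> max 1 (norm z) + e) U"
      by (intro eventually_ball_finite fin) auto
    have "((\<lambda>y. blinfun_apply w (s *\<^sub>R y)) \<longlongrightarrow> 0) U" for w :: "'a \<Rightarrow>\<^sub>L real"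
      using tendsto_mult_left[OF null[of w], of s] by (simp add: blinfun.scaleR_right)
    then have ev2: "eventually (\<lambda>y. \<forall>w\<in>W. \<bar>blinfun_apply w (s *\<^sub>R y)\<bar> < e) U"
      using tendstoD[OF _ e] by (intro eventually_ball_finite fin) fastforce
    have ev3: "eventually (\<lambda>y. blinfun_apply v y < c / 2) U"
      using null[of v] c by (intro order_tendstoD(2)) auto
    obtain y where y: "c \<le> norm y" "blinfun_apply v y < c / 2"
        "\<forall>z\<in>Z. \<bar>blinfun_apply (g y) z\<bar> < e \<and>
          norm (z + s *\<^sub>R y) \<le> max 1 (norm z) + e \<and> norm (z - s *\<^sub>R y) \<le> max 1 (norm z) + e"
        "\<forall>w\<in>W. \<bar>blinfun_apply w (s *\<^sub>R y)\<bar> < e"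
      using eventually_happens'[OF nb eventually_conj[OF U(2) eventually_conj[OF ev1 eventually_conj[OF ev2 ev3]]]]
      by auto
    have "d \<le> s * (c / 2)" by (simp add: d_def)
    also have "\<dots> \<le> s * blinfun_apply (g y) y"
      using s y(1,2) by (intro mult_left_mono) (auto simp: g_def blinfun.diff_left V(2))
    finally show "\<exists>y (g :: 'a \<Rightarrow>\<^sub>L real). norm g \<le> 2 \<and> d \<le> blinfun_apply g y \<and>
        (\<forall>z\<in>Z. \<bar>blinfun_apply g z\<bar> < e \<and>
          norm (z + y) \<le> max 1 (norm z) + e \<and> norm (z - y) \<le> max 1 (norm z) + e) \<and>
        (\<forall>w\<in>W. \<bar>blinfun_apply w y\<bar> < e)"
      using gb y by (intro exI[of _ "s *\<^sub>R y"] exI[of _ "g y"]) (auto simp: blinfun.scaleR_right)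
  qed
qed

section \<open>Sequences that span a copy of \<open>c0\<close>\<close>

definition c0_sequence :: "'a::real_normed_vector \<Rightarrow> (nat \<Rightarrow> 'a) \<Rightarrow> (nat \<Rightarrow> 'a \<Rightarrow>\<^sub>L real) \<Rightarrow> real \<Rightarrow> bool" where
  "c0_sequence x y g d \<longleftrightarrow> 0 < d \<and>
    (\<forall>k. norm (g k) \<le> 2 \<and> d \<le> blinfun_apply (g k) (y k) \<and> norm (x + y k) \<le> 1 + (1/2) ^ k) \<and>
    (\<forall>k l. k \<noteq> l \<longrightarrow> \<bar>blinfun_apply (g k) (y l)\<bar> \<le> d / 8 * (1/2) ^ l) \<and>
    (\<forall>n e. (\<forall>k. e k \<in> {-1, 0, 1 :: real}) \<longrightarrow> norm (\<Sum>k<n. e k *\<^sub>R y k) \<le> 2)"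

text \<open>The induction carries a finite set \<open>Z\<close> that contains \<open>x\<close> and
  all signed sums so far, and the finite set \<open>W\<close> of functionals so far. Each new vector
  is added to and subtracted from all of \<open>Z\<close>, so the signed sums need no separate
  argument.\<close>

lemma flat_imp_c0_sequence:
  fixes x0 x :: "'a::real_normed_vector"
  assumes "property_Mstar TYPE('a) 1 s" "0 < s" "flat_at x0" and x: "norm x \<le> 1"
  obtains y g d where "c0_sequence x y g d"
proof -
  obtain d where d: "0 < d" "d \<le> 1" and sel:
    "\<And>(Z :: 'a set) (W :: ('a \<Rightarrow>\<^sub>L real) set) e. finite Z \<Longrightarrow> finite W \<Longrightarrow> 0 < e \<Longrightarrow>
      \<exists>y (g :: 'a \<Rightarrow>\<^sub>L real). norm g \<le> 2 \<and> d \<le> blinfun_apply g y \<and>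
        (\<forall>z\<in>Z. \<bar>blinfun_apply g z\<bar> < e \<and>
          norm (z + y) \<le> max 1 (norm z) + e \<and> norm (z - y) \<le> max 1 (norm z) + e) \<and>
        (\<forall>w\<in>W. \<bar>blinfun_apply w y\<bar> < e)"
    using flat_selection[OF assms(1-3)] by blast
  \<comment> \<open>As \<open>d \<le> 1\<close>, the error is at most \<open>(1/2) ^ Suc n\<close>,
    exactly the amount by which the radius \<open>2 - (1/2) ^ n\<close> grows in the next
    step.\<close>
  define \<epsilon> where "\<epsilon> n = d / 8 * (1/2) ^ n" for n :: nat
  have \<epsilon>: "0 < \<epsilon> n" "\<epsilon> n \<le> (1/2) ^ Suc n" for n
  proof -
    show "0 < \<epsilon> n" using d by (simp add: \<epsilon>_def)
    have "\<epsilon> n \<le> 1 / 2 * (1/2) ^ n" unfolding \<epsilon>_def using d by (intro mult_right_mono) auto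
    then show "\<epsilon> n \<le> (1/2) ^ Suc n" by simp
  qed
  \<comment> \<open>At stage 0 the radius is 1, which admits \<open>x\<close>. The vector and
    functional stored in the initial state are dummies; \<open>insert 0 W\<close> allows for the
    functional.\<close>
  define P where "P n = (\<lambda>(Z, W, y, g). finite Z \<and> finite (W :: ('a \<Rightarrow>\<^sub>L real) set) \<and>
      Z \<subseteq> cball 0 (2 - (1/2) ^ n) \<and> 0 \<in> Z \<and> x \<in> Z \<and> (y :: 'a) \<in> Z \<and> (g :: 'a \<Rightarrow>\<^sub>L real) \<in> insert 0 W)"
    for n :: nat
  define Q where "Q n = (\<lambda>(Z, W, _ :: 'a, _ :: 'a \<Rightarrow>\<^sub>L real) (Z', W', y' :: 'a, g' :: 'a \<Rightarrow>\<^sub>L real).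
      Z' = Z \<union> (\<lambda>z. z + y') ` Z \<union> (\<lambda>z. z - y') ` Z \<and> W' = insert g' W \<and>
      norm g' \<le> 2 \<and> d \<le> blinfun_apply g' y' \<and> norm (x + y') \<le> 1 + \<epsilon> n \<and>
      (\<forall>z\<in>Z. \<bar>blinfun_apply g' z\<bar> < \<epsilon> n) \<and> (\<forall>w\<in>W. \<bar>blinfun_apply w y'\<bar> < \<epsilon> n))"
    for n :: nat
  have "\<exists>f. \<forall>n. P n (f n) \<and> Q n (f n) (f (Suc n))"
  proof (rule dependent_nat_choice)
    show "\<exists>st. P 0 st"
      using x by (intro exI[of _ "({0, x}, {}, 0, 0)"]) (auto simp: P_def)
    fix st n assume "P n st"
    then obtain Z W y g where st: "st = (Z, W, y, g)" and fin: "finite Z" "finite W"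
      and Z: "Z \<subseteq> cball 0 (2 - (1/2) ^ n)" "0 \<in> Z" "x \<in> Z"
      by (auto simp: P_def split: prod.splits)
    obtain y' g' where *: "norm g' \<le> 2" "d \<le> blinfun_apply g' y'"
        "\<forall>z\<in>Z. \<bar>blinfun_apply g' z\<bar> < \<epsilon> n \<and>
          norm (z + y') \<le> max 1 (norm z) + \<epsilon> n \<and> norm (z - y') \<le> max 1 (norm z) + \<epsilon> n"
        "\<forall>w\<in>W. \<bar>blinfun_apply w y'\<bar> < \<epsilon> n"
      using sel[OF fin \<epsilon>(1)] by metis
    define Z' where "Z' = Z \<union> (\<lambda>z. z + y') ` Z \<union> (\<lambda>z. z - y') ` Z"
    have "(1/2 :: real) ^ n \<le> 1" by (simp add: power_le_one)
    then have le: "max 1 (norm z) + \<epsilon> n \<le> 2 - (1/2) ^ Suc n" if "z \<in> Z" for z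
      using Z(1) that \<epsilon>(2)[of n] by (auto simp: subset_iff)
    have "norm z \<le> 2 - (1/2) ^ Suc n" if "z \<in> Z" for z
      using le[OF that] \<epsilon>(1)[of n] by simp
    moreover have "norm (z + y') \<le> 2 - (1/2) ^ Suc n" "norm (z - y') \<le> 2 - (1/2) ^ Suc n"
      if "z \<in> Z" for z
      using *(3) le[OF that] that by (meson order_trans)+
    ultimately have "Z' \<subseteq> cball 0 (2 - (1/2) ^ Suc n)"
      unfolding Z'_def by auto
    moreover have "y' \<in> Z'" using Z(2) by (auto simp: Z'_def intro!: image_eqI[of _ _ 0])
    ultimately have "P (Suc n) (Z', insert g' W, y', g')"
      unfolding P_def using fin Z by (auto simp: Z'_def)
    moreover have "Q n st (Z', insert g' W, y', g')"
      unfolding Q_def st using * Z(3) x by (fastforce simp: Z'_def)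
    ultimately show "\<exists>st'. P (Suc n) st' \<and> Q n st st'" by blast
  qed
  then obtain f where f: "\<And>n. P n (f n)" "\<And>n. Q n (f n) (f (Suc n))" by blast
  define Z where "Z n = fst (f n)" for n
  define W where "W n = fst (snd (f n))" for n
  \<comment> \<open>The vector and the functional with index \<open>n\<close> are chosen in the step
    from \<open>n\<close> to \<open>Suc n\<close>, hence read from the later state.\<close>
  define y where "y n = fst (snd (snd (f (Suc n))))" for n
  define g where "g n = snd (snd (snd (f (Suc n))))" for n
  have fS: "f (Suc n) = (Z (Suc n), W (Suc n), y n, g n)" for n
    by (simp add: Z_def W_def y_def g_def)
  have fn: "f n = (Z n, W n, fst (snd (snd (f n))), snd (snd (snd (f n))))" for n
    by (simp add: Z_def W_def)
  have Q: "Z (Suc n) = Z n \<union> (\<lambda>z. z + y n) ` Z n \<union> (\<lambda>z. z - y n) ` Z n"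
      "W (Suc n) = insert (g n) (W n)" "norm (g n) \<le> 2" "d \<le> blinfun_apply (g n) (y n)"
      "norm (x + y n) \<le> 1 + \<epsilon> n" "\<And>z. z \<in> Z n \<Longrightarrow> \<bar>blinfun_apply (g n) z\<bar> < \<epsilon> n"
      "\<And>w. w \<in> W n \<Longrightarrow> \<bar>blinfun_apply w (y n)\<bar> < \<epsilon> n" for n
    using f(2)[of n] unfolding fS[of n] by (subst (asm) fn[of n], simp add: Q_def)+
  have Zn: "Z n \<subseteq> cball 0 (2 - (1/2) ^ n)" "0 \<in> Z n" for n
    using f(1)[of n] by (subst (asm) fn[of n], simp add: P_def)+
  have Zmono: "Z m \<subseteq> Z n" if "m \<le> n" for m n
    by (rule lift_Suc_mono_le[OF _ that]) (simp add: Q(1) subset_iff)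
  have Wmono: "W m \<subseteq> W n" if "m \<le> n" for m n
    by (rule lift_Suc_mono_le[OF _ that]) (auto simp add: Q(2))
  \<comment> \<open>For \<open>k < l\<close> the functional \<open>g k\<close> is already in
    \<open>W l\<close> when \<open>y l\<close> is chosen; for \<open>l < k\<close> the vector
    \<open>y l\<close> is already in \<open>Z k\<close> when \<open>g k\<close> is chosen, and
    \<open>\<epsilon>\<close> decreases.\<close>
  have off: "\<bar>blinfun_apply (g k) (y l)\<bar> \<le> d / 8 * (1/2) ^ l" if "k \<noteq> l" for k l
  proof (cases "k < l")
    case True
    then have "g k \<in> W l" using Q(2)[of k] Wmono[of "Suc k" l] by auto
    from Q(7)[OF this] show ?thesis by (simp add: \<epsilon>_def)
  next
    case False
    then have lk: "l < k" using that by simp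
    have "y l \<in> Z (Suc l)" using Q(1)[of l] Zn(2)[of l] by (auto intro!: image_eqI[of _ _ 0])
    then have "y l \<in> Z k" using Zmono[of "Suc l" k] lk by auto
    then have "\<bar>blinfun_apply (g k) (y l)\<bar> \<le> \<epsilon> k" using Q(6) by (simp add: less_imp_le)
    also have "\<dots> \<le> \<epsilon> l"
      unfolding \<epsilon>_def using d lk by (intro mult_left_mono power_decreasing) auto
    finally show ?thesis by (simp add: \<epsilon>_def)
  qed
  have inZ: "(\<Sum>k<n. e k *\<^sub>R y k) \<in> Z n" if "\<And>k. e k \<in> {-1, 0, 1 :: real}" for n e
  proof (induction n)
    case (Suc n)
    show ?case using that[of n] Suc unfolding Q(1)[of n] by auto
  qed (simp add: Zn)
  have sums: "norm (\<Sum>k<n. e k *\<^sub>R y k) \<le> 2" if "\<And>k. e k \<in> {-1, 0, 1 :: real}" for n e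
  proof -
    have "norm (\<Sum>k<n. e k *\<^sub>R y k) \<le> 2 - (1/2) ^ n"
      using subsetD[OF Zn(1) inZ[OF that]] by simp
    also have "\<dots> \<le> 2" by simp
    finally show ?thesis .
  qed
  have "norm (x + y k) \<le> 1 + (1/2) ^ k" for k
    using Q(5)[of k] \<epsilon>(2)[of k] \<epsilon>(1)[of k] by simp
  then have "c0_sequence x y g d"
    unfolding c0_sequence_def using d Q(3,4) off sums by blast
  then show ?thesis by (rule that)
qed

text \<open>Taking the signs of the values as coefficients turns the sum of absolute values into one
  value of \<open>f\<close>. The radius \<open>R\<close> is kept general because the estimate also
  applies to the unit vectors of a given copy of \<open>c0\<close>.\<close>

lemma c0_sequence_sum_abs:
  fixes y :: "nat \<Rightarrow> 'a::real_normed_vector" and f :: "'a \<Rightarrow>\<^sub>L real"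
  assumes y: "\<And>n e. (\<And>k. e k \<in> {-1, 0, 1 :: real}) \<Longrightarrow> norm (\<Sum>k<n. e k *\<^sub>R y k) \<le> R"
    and A: "finite A"
  shows "(\<Sum>k\<in>A. \<bar>blinfun_apply f (y k)\<bar>) \<le> norm f * R"
proof -
  obtain n where n: "A \<subseteq> {..<n}" using A by (meson finite_nat_iff_bounded)
  define e where "e k = (if k \<in> A then sgn (blinfun_apply f (y k)) else 0)" for k
  have "e k \<in> {-1, 0, 1}" for k by (auto simp: e_def sgn_if)
  from y[OF this] have *: "norm (\<Sum>k<n. e k *\<^sub>R y k) \<le> R" .
  have "(\<Sum>k\<in>A. \<bar>blinfun_apply f (y k)\<bar>) = (\<Sum>k<n. e k * blinfun_apply f (y k))"
    using n by (intro sum.mono_neutral_cong_left) (auto simp: e_def abs_sgn mult.commute)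
  also have "\<dots> = blinfun_apply f (\<Sum>k<n. e k *\<^sub>R y k)"
    by (simp add: blinfun.sum_right blinfun.scaleR_right)
  also have "\<dots> \<le> norm f * R"
    using blinfun_apply_le[of f] mult_left_mono[OF *, of "norm f"] order_trans by fastforce
  finally show ?thesis .
qed

text \<open>Coefficients beyond \<open>-1, 0, 1\<close> are reached by duality: against a functional
  in the dual ball, the sum of absolute values is at most \<open>R\<close>.\<close>

lemma c0_sequence_sum_bound:
  fixes y :: "nat \<Rightarrow> 'a::real_normed_vector"
  assumes y: "\<And>n e. (\<And>k. e k \<in> {-1, 0, 1 :: real}) \<Longrightarrow> norm (\<Sum>k<n. e k *\<^sub>R y k) \<le> R"
    and A: "finite A" and a: "\<And>k. k \<in> A \<Longrightarrow> \<bar>a k\<bar> \<le> b" and b: "0 \<le> b"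
  shows "norm (\<Sum>k\<in>A. a k *\<^sub>R y k) \<le> R * b"
proof (rule norm_le_functional)
  fix f :: "'a \<Rightarrow>\<^sub>L real" assume f: "norm f \<le> 1"
  have "0 \<le> R" using y[of "\<lambda>_. 0" 0] by simp
  have "blinfun_apply f (\<Sum>k\<in>A. a k *\<^sub>R y k) = (\<Sum>k\<in>A. a k * blinfun_apply f (y k))"
    by (simp add: blinfun.sum_right blinfun.scaleR_right)
  also have "\<dots> \<le> (\<Sum>k\<in>A. b * \<bar>blinfun_apply f (y k)\<bar>)"
  proof (rule sum_mono)
    fix k assume "k \<in> A"
    have "a k * blinfun_apply f (y k) \<le> \<bar>a k\<bar> * \<bar>blinfun_apply f (y k)\<bar>"
      by (simp flip: abs_mult)
    also have "\<dots> \<le> b * \<bar>blinfun_apply f (y k)\<bar>"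
      using a[OF \<open>k \<in> A\<close>] by (intro mult_right_mono) auto
    finally show "a k * blinfun_apply f (y k) \<le> b * \<bar>blinfun_apply f (y k)\<bar>" .
  qed
  also have "\<dots> = b * (\<Sum>k\<in>A. \<bar>blinfun_apply f (y k)\<bar>)" by (simp add: sum_distrib_left)
  also have "\<dots> \<le> b * (norm f * R)"
    by (intro mult_left_mono c0_sequence_sum_abs[OF y A] b)
  also have "\<dots> \<le> b * (1 * R)"
    using f \<open>0 \<le> R\<close> b by (intro mult_left_mono mult_right_mono) auto
  finally show "blinfun_apply f (\<Sum>k\<in>A. a k *\<^sub>R y k) \<le> R * b" by (simp add: mult.commute)
qed

text \<open>Bounded signed sums make the values of each functional absolutely summable.\<close>

lemma c0_sequence_weakly_null:
  fixes y :: "nat \<Rightarrow> 'a::real_normed_vector" and f :: "'a \<Rightarrow>\<^sub>L real"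
  assumes y: "\<And>n e. (\<And>k. e k \<in> {-1, 0, 1 :: real}) \<Longrightarrow> norm (\<Sum>k<n. e k *\<^sub>R y k) \<le> R"
  shows "(\<lambda>k. blinfun_apply f (y k)) \<longlonglongrightarrow> 0"
proof -
  have "summable (\<lambda>k. \<bar>blinfun_apply f (y k)\<bar>)"
    by (rule bounded_imp_summable[where B="norm f * R"]) (auto intro: c0_sequence_sum_abs[OF y])
  then show ?thesis by (intro tendsto_rabs_zero_cancel[OF summable_LIMSEQ_zero])
qed

text \<open>The upper estimate on blocks gives the Cauchy condition and, by completeness, the sum.
  For the lower estimate, \<open>g k\<close> at \<open>T a\<close> is at least \<open>d\<close>
  times the modulus of the coordinate \<open>k\<close> minus \<open>d * norm a / 4\<close>, while
  \<open>norm (g k) \<le> 2\<close>; the supremum over \<open>k\<close> leaves the constant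
  \<open>3 * d / 8\<close>.\<close>

lemma c0_sequence_imp_copy:
  fixes y :: "nat \<Rightarrow> 'a::banach"
  assumes "c0_sequence x y g d"
  shows "contains_copy_of_c0 TYPE('a)"
proof -
  have d: "0 < d" and g: "\<And>k. norm (g k) \<le> 2" "\<And>k. d \<le> blinfun_apply (g k) (y k)"
    and off: "\<And>k l. k \<noteq> l \<Longrightarrow> \<bar>blinfun_apply (g k) (y l)\<bar> \<le> d / 8 * (1/2) ^ l"
    and y: "\<And>n e. (\<And>k. e k \<in> {-1, 0, 1 :: real}) \<Longrightarrow> norm (\<Sum>k<n. e k *\<^sub>R y k) \<le> 2"
    using assms unfolding c0_sequence_def by auto
  define T where "T a = (\<Sum>k. apply_bcontfun a k *\<^sub>R y k)" for a :: "nat \<Rightarrow>\<^sub>C real"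
  have summ: "summable (\<lambda>k. apply_bcontfun a k *\<^sub>R y k)" if "a \<in> c0" for a
    unfolding summable_Cauchy
  proof (intro allI impI)
    fix e :: real assume e: "0 < e"
    then have "eventually (\<lambda>k. \<bar>apply_bcontfun a k\<bar> < e / 4) sequentially"
      using tendstoD[of "apply_bcontfun a" 0 sequentially "e / 4"] that by (simp add: c0_def)
    then obtain N where N: "\<And>k. N \<le> k \<Longrightarrow> \<bar>apply_bcontfun a k\<bar> < e / 4"
      by (auto simp: eventually_sequentially)
    have "norm (\<Sum>k\<in>{m..<n}. apply_bcontfun a k *\<^sub>R y k) < e" if "N \<le> m" for m n
    proof -
      have "norm (\<Sum>k\<in>{m..<n}. apply_bcontfun a k *\<^sub>R y k) \<le> 2 * (e / 4)"
        by (rule c0_sequence_sum_bound[OF y]) (use N that e in \<open>auto intro: less_imp_le\<close>)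
      with e show ?thesis by simp
    qed
    then show "\<exists>N. \<forall>m\<ge>N. \<forall>n. norm (\<Sum>k\<in>{m..<n}. apply_bcontfun a k *\<^sub>R y k) < e"
      by blast
  qed
  have lim: "(\<lambda>n. \<Sum>k<n. apply_bcontfun a k *\<^sub>R y k) \<longlonglongrightarrow> T a" if "a \<in> c0" for a
    unfolding T_def by (rule summable_LIMSEQ[OF summ[OF that]])
  have ub: "norm (T a) \<le> 2 * norm a" if "a \<in> c0" for a
  proof (rule Lim_bounded[OF tendsto_norm[OF lim[OF that]]], intro allI impI)
    show "norm (\<Sum>k<n. apply_bcontfun a k *\<^sub>R y k) \<le> 2 * norm a" for n
      using norm_bounded[of a] by (auto intro!: c0_sequence_sum_bound[OF y])
  qed
  have lb: "(3 * d / 8) * norm a \<le> norm (T a)" if "a \<in> c0" for a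
  proof -
    have "\<bar>apply_bcontfun a k\<bar> \<le> 2 * norm (T a) / d + norm a / 4" for k
    proof -
      have "d * \<bar>apply_bcontfun a k\<bar> - d * norm a / 4 \<le> \<bar>blinfun_apply (g k) (T a)\<bar>"
      proof (rule tendsto_lowerbound[OF tendsto_rabs[OF blinfun.tendsto[OF tendsto_const lim[OF that]]]])
        show "eventually (\<lambda>n. d * \<bar>apply_bcontfun a k\<bar> - d * norm a / 4
            \<le> \<bar>blinfun_apply (g k) (\<Sum>l<n. apply_bcontfun a l *\<^sub>R y l)\<bar>) sequentially"
          using eventually_gt_at_top[of k]
        proof eventually_elim
          case (elim n)
          define r where "r = (\<Sum>l\<in>{..<n} - {k}. apply_bcontfun a l * blinfun_apply (g k) (y l))"
          have "\<bar>r\<bar> \<le> (\<Sum>l\<in>{..<n} - {k}. norm a * (d / 8 * (1/2) ^ l))"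
            unfolding r_def
          proof (rule order_trans[OF sum_abs sum_mono])
            fix l assume "l \<in> {..<n} - {k}"
            then have "k \<noteq> l" by auto
            from off[OF this] norm_bounded[of a l]
            show "\<bar>apply_bcontfun a l * blinfun_apply (g k) (y l)\<bar> \<le> norm a * (d / 8 * (1/2) ^ l)"
              unfolding abs_mult by (intro mult_mono) auto
          qed
          also have "\<dots> \<le> (\<Sum>l<n. norm a * (d / 8 * (1/2) ^ l))"
            using d by (intro sum_mono2) auto
          also have "\<dots> = norm a * d / 8 * (\<Sum>l<n. (1/2) ^ l)"
            by (simp add: sum_distrib_left mult.assoc)
          also have "\<dots> \<le> norm a * d / 8 * 2"
            using d by (intro mult_left_mono) (auto simp: geometric_sum)
          finally have r: "\<bar>r\<bar> \<le> d * norm a / 4" by (simp add: mult.commute)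
          have "blinfun_apply (g k) (\<Sum>l<n. apply_bcontfun a l *\<^sub>R y l)
              = apply_bcontfun a k * blinfun_apply (g k) (y k) + r"
            using elim unfolding blinfun.sum_right blinfun.scaleR_right r_def
            by (subst sum.remove[of _ k]) auto
          moreover have "d * \<bar>apply_bcontfun a k\<bar> \<le> \<bar>apply_bcontfun a k * blinfun_apply (g k) (y k)\<bar>"
            using mult_left_mono[OF g(2)[of k], of "\<bar>apply_bcontfun a k\<bar>"] g(2)[of k] d
            by (simp add: abs_mult mult.commute)
          ultimately show ?case using r by linarith
        qed
      qed simp
      also have "\<dots> \<le> 2 * norm (T a)"
        using norm_blinfun[of "g k" "T a"] mult_right_mono[OF g(1)[of k], of "norm (T a)"] by simp
      finally show ?thesis using d by (simp add: field_simps)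
    qed
    then have "norm a \<le> 2 * norm (T a) / d + norm a / 4"
      by (intro norm_bound) simp
    then show ?thesis using d by (simp add: field_simps)
  qed
  have add: "T (a + b) = T a + T b" if "a \<in> c0" "b \<in> c0" for a b
    unfolding T_def using suminf_add[OF summ[OF that(1)] summ[OF that(2)]]
    by (simp add: plus_bcontfun.rep_eq scaleR_add_left)
  have scale: "T (k *\<^sub>R a) = k *\<^sub>R T a" if "a \<in> c0" for a k
    unfolding T_def using suminf_scaleR_right[OF summ[OF that], of k]
    by (simp add: scaleR_bcontfun.rep_eq)
  show ?thesis
    unfolding contains_copy_of_c0_def using d add scale lb ub
    by (intro exI[of _ T] exI[of _ "3 * d / 8"] exI[of _ 2]) simp
qed

text \<open>The vectors \<open>x + y k\<close> have norms tending to 1, so after normalisation they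
  converge weakly to \<open>x\<close> within the sphere. Norm convergence would force
  \<open>y\<close> to tend to 0, against \<open>d \<le> 2 * norm (y k)\<close>.\<close>

lemma c0_sequence_imp_not_agree:
  fixes x :: "'a::real_normed_vector"
  assumes "c0_sequence x y g d" and x: "norm x = 1"
  shows "\<not> sphere_topologies_seq_agree_at x"
proof
  assume agree: "sphere_topologies_seq_agree_at x"
  have d: "0 < d" and g: "\<And>k. norm (g k) \<le> 2" "\<And>k. d \<le> blinfun_apply (g k) (y k)"
    and xy: "\<And>k. norm (x + y k) \<le> 1 + (1/2) ^ k"
    and y: "\<And>n e. (\<And>k. e k \<in> {-1, 0, 1 :: real}) \<Longrightarrow> norm (\<Sum>k<n. e k *\<^sub>R y k) \<le> 2"
    using assms unfolding c0_sequence_def by auto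
  note null = c0_sequence_weakly_null[OF y]
  \<comment> \<open>A functional norming \<open>x\<close> bounds the norms of \<open>x + y k\<close>
    from below by quantities tending to 1.\<close>
  obtain n :: "'a \<Rightarrow>\<^sub>L real" where n: "norm n \<le> 1" "blinfun_apply n x = 1"
    using norming_functional[of x] x by auto
  have norm1: "(\<lambda>k. norm (x + y k)) \<longlonglongrightarrow> 1"
  proof (rule tendsto_sandwich)
    show "eventually (\<lambda>k. 1 + blinfun_apply n (y k) \<le> norm (x + y k)) sequentially"
      using blinfun_apply_le_1[OF n(1), of "x + y _"] by (simp add: blinfun.add_right n(2))
    show "(\<lambda>k. 1 + blinfun_apply n (y k)) \<longlonglongrightarrow> 1"
      using tendsto_add[OF tendsto_const[of 1] null[of n]] by simp
    show "(\<lambda>k. 1 + (1/2 :: real) ^ k) \<longlonglongrightarrow> 1"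
      using tendsto_add[OF tendsto_const[of 1] LIMSEQ_power_zero[of "1/2 :: real"]] by simp
  qed (use xy in simp)
  \<comment> \<open>The default \<open>x\<close> keeps the whole sequence on the sphere; it can
    occur only for finitely many \<open>k\<close>.\<close>
  define z where "z k = (if x + y k = 0 then x else sgn (x + y k))" for k
  have evz: "eventually (\<lambda>k. z k = (x + y k) /\<^sub>R norm (x + y k) \<and> x + y k = norm (x + y k) *\<^sub>R z k) sequentially"
    using order_tendstoD(1)[OF norm1, of 0, simplified]
    by eventually_elim (auto simp: z_def sgn_div_norm)
  have "z \<longlonglongrightarrow> x"
  proof -
    have "range z \<subseteq> sphere 0 1" by (auto simp: z_def x norm_sgn)
    moreover have "limitin weak_topology z x sequentially"
      unfolding limitin_weak_topology_iff
    proof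
      fix f :: "'a \<Rightarrow>\<^sub>L real"
      have "(\<lambda>k. inverse (norm (x + y k)) * (blinfun_apply f x + blinfun_apply f (y k)))
          \<longlonglongrightarrow> inverse 1 * (blinfun_apply f x + 0)"
        by (intro tendsto_intros norm1 null) auto
      then have "(\<lambda>k. inverse (norm (x + y k)) * (blinfun_apply f x + blinfun_apply f (y k)))
          \<longlonglongrightarrow> blinfun_apply f x" by simp
      then show "(\<lambda>k. blinfun_apply f (z k)) \<longlonglongrightarrow> blinfun_apply f x"
        by (rule Lim_transform_eventually)
          (use evz in eventually_elim, simp add: blinfun.scaleR_right blinfun.add_right)
    qed
    ultimately show ?thesis using agree unfolding sphere_topologies_seq_agree_at_def by blast
  qed
  then have "(\<lambda>k. norm (x + y k) *\<^sub>R z k - x) \<longlonglongrightarrow> 1 *\<^sub>R x - x"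
    by (intro tendsto_intros norm1)
  then have "(\<lambda>k. norm (x + y k) *\<^sub>R z k - x) \<longlonglongrightarrow> 0" by simp
  then have "y \<longlonglongrightarrow> 0"
    by (rule Lim_transform_eventually)
      (use evz in \<open>eventually_elim, metis add_diff_cancel_left'\<close>)
  then have "eventually (\<lambda>k. norm (y k) < d / 2) sequentially"
    using d tendstoD[of y 0 sequentially "d / 2"] by simp
  then obtain k where k: "norm (y k) < d / 2" by (auto simp: eventually_sequentially)
  have "d \<le> 2 * norm (y k)"
    using g(2)[of k] blinfun_apply_le[of "g k" "y k"] mult_right_mono[OF g(1)[of k], of "norm (y k)"]
    by simp
  with k show False by simp
qed

subsection \<open>Nonreflexive spaces\<close>

lemma bidual_embedding_add: "bidual_embedding (x + y) = bidual_embedding x + bidual_embedding y"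
  by (rule blinfun_eqI) (simp add: blinfun.add_left blinfun.add_right)

lemma bidual_embedding_scaleR: "bidual_embedding (t *\<^sub>R x) = t *\<^sub>R bidual_embedding x"
  by (rule blinfun_eqI) (simp add: blinfun.scaleR_left blinfun.scaleR_right)

lemma bounded_linear_bidual_embedding: "bounded_linear bidual_embedding"
  by (rule bounded_linear_intro[of _ 1])
    (auto simp: bidual_embedding_add bidual_embedding_scaleR)

text \<open>The embedding is isometric and the space complete, so its range is closed, and a point
  \<open>\<xi>\<close> outside it has positive distance \<open>d\<close> from it. Hahn-Banach in the
  bidual then gives a functional that vanishes on the range.\<close>

lemma nonreflexive_annihilator:
  assumes "\<not> reflexive_space TYPE('a :: banach)"
  obtains \<psi> :: "(('a::banach \<Rightarrow>\<^sub>L real) \<Rightarrow>\<^sub>L real) \<Rightarrow>\<^sub>L real"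
  where "norm \<psi> = 1" "\<And>x. blinfun_apply \<psi> (bidual_embedding x) = 0"
proof -
  let ?J = "bidual_embedding :: 'a \<Rightarrow> ('a \<Rightarrow>\<^sub>L real) \<Rightarrow>\<^sub>L real"
  obtain \<xi> where \<xi>: "\<xi> \<notin> range ?J"
    using assms unfolding reflexive_space_def by (metis UNIV_eq_I)
  have "closed (range ?J)"
    unfolding closed_sequential_limits
  proof (intro allI impI)
    fix z l assume "(\<forall>n. z n \<in> range ?J) \<and> z \<longlonglongrightarrow> l"
    then have "\<forall>n. \<exists>x. z n = ?J x" and l: "z \<longlonglongrightarrow> l" by auto
    then obtain x where x: "\<And>n. z n = ?J (x n)" by metis
    have "dist (x m) (x n) = dist (z m) (z n)" for m n
      by (simp add: x dist_norm flip: bidual_embedding_diff)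
    then have "Cauchy x"
      using LIMSEQ_imp_Cauchy[OF l] by (simp add: Cauchy_def)
    then obtain x' where x': "x \<longlonglongrightarrow> x'" using Cauchy_convergent convergent_def by blast
    have "z \<longlonglongrightarrow> ?J x'"
      unfolding x[abs_def] by (rule bounded_linear.tendsto[OF bounded_linear_bidual_embedding x'])
    with l have "l = ?J x'" by (rule LIMSEQ_unique)
    then show "l \<in> range ?J" by simp
  qed
  then have "open (- range ?J)" by (simp add: open_Compl)
  then obtain d where d: "0 < d" "ball \<xi> d \<subseteq> - range ?J"
    using \<xi> by (meson ComplI openE)
  have dist: "d \<le> norm (\<xi> - ?J x)" for x
  proof (rule ccontr)
    assume "\<not> ?thesis"
    then have "?J x \<in> ball \<xi> d" by (simp add: dist_norm)
    with d(2) show False by blast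
  qed
  \<comment> \<open>This cone contains both signs of each embedded vector with second component 0,
    so the lower bounds force \<open>f\<close> to vanish on the range, while \<open>f\<close> is at
    least \<open>d\<close> at \<open>\<xi>\<close>.\<close>
  define K where "K = {(t *\<^sub>R \<xi> + ?J x, t * d) |t x. True}"
  have K: "(t *\<^sub>R \<xi> + ?J x, t * d) \<in> K" for t x by (auto simp: K_def)
  obtain f where f: "norm f \<le> 1" "\<And>z r. (z, r) \<in> K \<Longrightarrow> r \<le> blinfun_apply f z"
  proof (rule mazur_orlicz_norm[of 1 K])
    have "?J 0 = 0" using bidual_embedding_scaleR[of 0 "0 :: 'a"] by simp
    then show "0 \<in> K" using K[of 0 0] by (simp add: zero_prod_def)
    fix a b assume "a \<in> K" "b \<in> K"
    then obtain t x t' x' where "a = (t *\<^sub>R \<xi> + ?J x, t * d)" "b = (t' *\<^sub>R \<xi> + ?J x', t' * d)"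
      by (auto simp: K_def)
    then show "a + b \<in> K"
      using K[of "t + t'" "x + x'"] by (simp add: bidual_embedding_add algebra_simps)
  next
    fix t :: real and a assume "a \<in> K"
    then obtain t' x where "a = (t' *\<^sub>R \<xi> + ?J x, t' * d)"
      by (auto simp: K_def)
    then show "t *\<^sub>R a \<in> K"
      using K[of "t * t'" "t *\<^sub>R x"] by (simp add: bidual_embedding_scaleR algebra_simps)
  next
    fix z r assume "(z, r) \<in> K"
    then obtain t x where z: "z = t *\<^sub>R \<xi> + ?J x" "r = t * d" by (auto simp: K_def)
    show "r \<le> 1 * norm z"
    proof (cases "t \<le> 0")
      case True
      then have "r \<le> 0" using z d by (simp add: mult_nonpos_nonneg)
      then show ?thesis using norm_ge_zero[of z] by linarith
    next
      case False
      then have "z = t *\<^sub>R (\<xi> - ?J ((- 1 / t) *\<^sub>R x))"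
        unfolding z bidual_embedding_scaleR scaleR_diff_right by simp
      then have "norm z = t * norm (\<xi> - ?J ((- 1 / t) *\<^sub>R x))" using False by simp
      then show ?thesis using dist[of "(- 1 / t) *\<^sub>R x"] z False by simp
    qed
  qed simp_all
  have ge: "0 \<le> blinfun_apply f (?J x)" for x using f(2)[OF K[of 0 x]] by simp
  have f0: "blinfun_apply f (?J x) = 0" for x
    using ge[of x] ge[of "(- 1) *\<^sub>R x"]
    by (simp only: bidual_embedding_scaleR blinfun.scaleR_right) simp
  have "d \<le> blinfun_apply f \<xi>" using f(2)[OF K[of 1 0]] f0[of 0] by (simp add: blinfun.add_right)
  then have "f \<noteq> 0" using d(1) by auto
  then show ?thesis
    by (intro that[of "f /\<^sub>R norm f"]) (auto simp: blinfun.scaleR_left f0)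
qed

text \<open>With \<open>\<phi> = u + t \<psi>\<close>, Goldstine's theorem in the dual approximates
  \<open>\<phi>\<close> by functionals \<open>f\<close> with
  \<open>norm f \<le> norm \<phi>\<close>. Because \<open>\<psi>\<close> vanishes on the space,
  \<open>f - u\<close> is weak-star null, and property M-star applies to \<open>u + (f - u)\<close>.
  Testing the outcome on a \<open>\<zeta>\<close> that almost norms \<open>\<psi>\<close> recovers
  the term \<open>s * t\<close>.\<close>

lemma Mstar_norm_annihilator:
  fixes \<psi> :: "(('a::real_normed_vector \<Rightarrow>\<^sub>L real) \<Rightarrow>\<^sub>L real) \<Rightarrow>\<^sub>L real"
  assumes M: "property_Mstar TYPE('a) 1 s" and s: "0 < s"
    and \<psi>: "norm \<psi> = 1" "\<And>x. blinfun_apply \<psi> (bidual_embedding x) = 0" and t: "0 \<le> t"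
  shows "norm u + s * t \<le> norm (bidual_embedding u + t *\<^sub>R \<psi>)"
proof -
  define \<phi> where "\<phi> = bidual_embedding u + t *\<^sub>R \<psi>"
  have \<phi>: "blinfun_apply \<phi> \<zeta> = blinfun_apply \<zeta> u + t * blinfun_apply \<psi> \<zeta>" for \<zeta>
    by (simp add: \<phi>_def blinfun.add_left blinfun.scaleR_left)
  obtain U where U: "ultrafilter U" "eventually (\<lambda>f. f \<in> {f. norm f \<le> norm \<phi>}) U"
    "\<And>\<zeta>. \<zeta> \<in> UNIV \<Longrightarrow> (blinfun_apply \<zeta> \<longlongrightarrow> blinfun_apply \<phi> \<zeta>) U"
  proof (rule ex_ultrafilter_finite_approx[of UNIV "{f. norm f \<le> norm \<phi>}" blinfun_apply "blinfun_apply \<phi>"])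
    fix W :: "(('a \<Rightarrow>\<^sub>L real) \<Rightarrow>\<^sub>L real) set" and \<eta> :: real
    assume "finite W" "0 < \<eta>"
    then obtain z where "norm z \<le> norm \<phi>" "\<And>w. w \<in> W \<Longrightarrow> \<bar>blinfun_apply w z - blinfun_apply \<phi> w\<bar> < \<eta>"
      by (rule goldstine) blast
    then show "\<exists>z\<in>{f. norm f \<le> norm \<phi>}. \<forall>j\<in>W. \<bar>blinfun_apply j z - blinfun_apply \<phi> j\<bar> \<le> \<eta>"
      by (auto intro: less_imp_le)
  qed blast
  have nb: "U \<noteq> bot" using U(1) by (simp add: ultrafilter_def)
  have ineq: "norm u * (1 - 2 * e) + s * t * (1 - e) \<le> norm \<phi> + e" if e: "0 < e" for e
  proof -
    obtain \<zeta> where \<zeta>: "norm \<zeta> \<le> 1" "1 - e < blinfun_apply \<psi> \<zeta>"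
      using blinfun_almost_norming[OF e, of \<psi>] \<psi>(1) by metis
    have \<zeta>e: "1 - e \<le> norm \<zeta>" using blinfun_apply_le[of \<psi> \<zeta>] \<zeta>(2) \<psi>(1) by simp
    obtain v where v: "norm v \<le> 1" "norm \<zeta> - e < blinfun_apply \<zeta> v"
      using blinfun_almost_norming[OF e, of \<zeta>] by metis
    \<comment> \<open>Property M-star allows \<open>u\<close> to be replaced by any functional of
      norm at most \<open>norm u\<close>; this one is aligned with \<open>\<zeta>\<close>, so that
      the full \<open>norm u\<close> is recovered together with the contribution of
      \<open>\<psi>\<close>.\<close>
    define v' where "v' = norm u *\<^sub>R v"
    have v': "norm v' \<le> norm u" using v(1) by (simp add: v'_def mult_left_le)
    have null: "((\<lambda>f. blinfun_apply (f - u) x) \<longlongrightarrow> 0) U" for x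
      using tendsto_diff[OF U(3)[of "bidual_embedding x"] tendsto_const[of "blinfun_apply u x"]]
      by (simp add: \<phi> \<psi>(2) blinfun.diff_left)
    have ev: "eventually (\<lambda>f. norm (v' + s *\<^sub>R (f - u)) < norm \<phi> + e) U"
    proof (rule property_Mstar_eventually[OF M v' nb _ null, where B="norm \<phi> + norm u" and b="norm \<phi>"])
      show "eventually (\<lambda>f. norm (f - u) \<le> norm \<phi> + norm u) U"
        using U(2) by eventually_elim (auto intro: order_trans[OF norm_triangle_ineq4])
      show "eventually (\<lambda>f. norm (u + (f - u)) \<le> norm \<phi>) U"
        using U(2) by eventually_elim simp
    qed (use e in simp)
    have "((\<lambda>f. blinfun_apply \<zeta> v' + s * (blinfun_apply \<zeta> f - blinfun_apply \<zeta> u))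
        \<longlongrightarrow> blinfun_apply \<zeta> v' + s * (blinfun_apply \<phi> \<zeta> - blinfun_apply \<zeta> u)) U"
      by (intro tendsto_intros U(3)) simp
    moreover have "eventually (\<lambda>f. blinfun_apply \<zeta> v' + s * (blinfun_apply \<zeta> f - blinfun_apply \<zeta> u)
        \<le> norm \<phi> + e) U"
      using ev
    proof eventually_elim
      case (elim f)
      have "blinfun_apply \<zeta> v' + s * (blinfun_apply \<zeta> f - blinfun_apply \<zeta> u)
          = blinfun_apply \<zeta> (v' + s *\<^sub>R (f - u))"
        by (simp add: blinfun.add_right blinfun.scaleR_right blinfun.diff_right)
      also have "\<dots> \<le> norm (v' + s *\<^sub>R (f - u))" by (rule blinfun_apply_le_1[OF \<zeta>(1)])
      finally show ?case using elim by simp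
    qed
    ultimately have "blinfun_apply \<zeta> v' + s * (blinfun_apply \<phi> \<zeta> - blinfun_apply \<zeta> u) \<le> norm \<phi> + e"
      by (rule tendsto_upperbound[OF _ _ nb])
    then have "norm u * blinfun_apply \<zeta> v + s * t * blinfun_apply \<psi> \<zeta> \<le> norm \<phi> + e"
      by (simp add: v'_def \<phi> blinfun.scaleR_right)
    moreover have "norm u * (1 - 2 * e) \<le> norm u * blinfun_apply \<zeta> v"
      using v(2) \<zeta>e by (intro mult_left_mono) auto
    moreover have "s * t * (1 - e) \<le> s * t * blinfun_apply \<psi> \<zeta>"
      using \<zeta>(2) s t by (intro mult_left_mono) auto
    ultimately show ?thesis by linarith
  qed
  have "norm u + s * t \<le> norm \<phi>"
  proof (rule field_le_epsilon)
    fix \<eta> :: real assume \<eta>: "0 < \<eta>"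
    \<comment> \<open>\<open>R\<close> collects the coefficients of \<open>e\<close> in
      \<open>ineq\<close> after all error terms are moved to the right.\<close>
    define R where "R = 1 + 2 * norm u + s * t"
    have R: "0 < R" using s t by (simp add: R_def add_pos_nonneg)
    have "norm u + s * t \<le> norm \<phi> + R * (\<eta> / R)"
      using ineq[of "\<eta> / R"] \<eta> R by (simp add: R_def algebra_simps del: times_divide_eq_right times_divide_eq_left)
    then show "norm u + s * t \<le> norm \<phi> + \<eta>" using R by simp
  qed
  then show ?thesis by (simp add: \<phi>_def)
qed

text \<open>The claim says that \<open>x0\<close> lies in the weak-star closure of the slice of the
  bidual ball where \<open>\<psi> \<ge> s / 2\<close>. A point of that slice stays at distance at
  least \<open>s / 2\<close> from \<open>x0\<close>, as \<open>\<psi>\<close> vanishes at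
  \<open>x0\<close>. Goldstine's theorem replaces it by some \<open>z\<close> in the ball of the
  space, and \<open>y = z - x0\<close>.\<close>

lemma nonreflexive_imp_flat_at:
  fixes x0 :: "'a::banach"
  assumes M: "property_Mstar TYPE('a) 1 s" and s: "0 < s"
    and nr: "\<not> reflexive_space TYPE('a)" and x0: "norm x0 = 1"
  shows "flat_at x0"
proof -
  obtain \<psi> :: "(('a \<Rightarrow>\<^sub>L real) \<Rightarrow>\<^sub>L real) \<Rightarrow>\<^sub>L real"
    where \<psi>: "norm \<psi> = 1" "\<And>x. blinfun_apply \<psi> (bidual_embedding x) = 0"
    using nonreflexive_annihilator[OF nr] by blast
  have claim: "\<exists>\<zeta>. norm \<zeta> \<le> 1 \<and> s / 2 \<le> blinfun_apply \<psi> \<zeta> \<and>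
      (\<forall>w\<in>W. \<bar>blinfun_apply \<zeta> w - blinfun_apply w x0\<bar> < \<eta>)"
    if W: "finite W" and \<eta>: "0 < \<eta>" for W \<eta>
  proof (rule ccontr)
    assume neg: "\<not> ?thesis"
    define C where "C = {\<zeta>. norm \<zeta> \<le> 1 \<and> s / 2 \<le> blinfun_apply \<psi> \<zeta>}"
    have "C = cball 0 1 \<inter> {\<zeta>. s / 2 \<le> blinfun_apply \<psi> \<zeta>}" by (auto simp: C_def)
    moreover have "convex {\<zeta>. s / 2 \<le> blinfun_apply \<psi> \<zeta>}"
    proof (rule convexI)
      fix x y and p q :: real
      assume "x \<in> {\<zeta>. s / 2 \<le> blinfun_apply \<psi> \<zeta>}" "y \<in> {\<zeta>. s / 2 \<le> blinfun_apply \<psi> \<zeta>}"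
        and pq: "0 \<le> p" "0 \<le> q" "p + q = 1"
      then have "p * (s / 2) + q * (s / 2) \<le> p * blinfun_apply \<psi> x + q * blinfun_apply \<psi> y"
        by (intro add_mono mult_left_mono) auto
      moreover have "p * (s / 2) + q * (s / 2) = s / 2" using pq by (simp flip: distrib_right)
      ultimately show "p *\<^sub>R x + q *\<^sub>R y \<in> {\<zeta>. s / 2 \<le> blinfun_apply \<psi> \<zeta>}"
        by (simp add: blinfun.add_right blinfun.scaleR_right)
    qed
    ultimately have C: "convex C" by (simp add: convex_Int)
    have far: "\<exists>w\<in>W. \<eta> \<le> \<bar>blinfun_apply (bidual_embedding x0 - d) w\<bar>" if "d \<in> C" for d
      using neg that by (force simp: C_def blinfun.diff_left abs_minus_commute not_less)
    have lin: "linear (\<lambda>\<xi> :: ('a \<Rightarrow>\<^sub>L real) \<Rightarrow>\<^sub>L real. blinfun_apply \<xi> w)" for w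
      by (intro linearI) (auto simp: blinfun.add_left blinfun.scaleR_left)
    obtain a where a: "\<And>d. d \<in> C \<Longrightarrow>
        (\<Sum>w\<in>W. a w * blinfun_apply d w) + \<eta> \<le> (\<Sum>w\<in>W. a w * blinfun_apply (bidual_embedding x0) w)"
      by (rule finite_separation[of W "\<lambda>w \<xi>. blinfun_apply \<xi> w" C \<eta> "bidual_embedding x0", OF W lin C \<eta> far]) blast+
    define u where "u = (\<Sum>w\<in>W. a w *\<^sub>R w)"
    have u: "(\<Sum>w\<in>W. a w * blinfun_apply \<zeta> w) = blinfun_apply \<zeta> u" for \<zeta>
      by (simp add: u_def blinfun.sum_right blinfun.scaleR_right)
    \<comment> \<open>The weight of \<open>\<psi>\<close> equals the separation margin. A
      \<open>\<zeta>\<close> almost norming \<open>\<phi>\<close> must then lie in \<open>C\<close>,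
      so its value at \<open>u\<close> is at most \<open>norm u - \<eta>\<close>; since
      \<open>\<psi>\<close> is at most 1 on the ball, the weighted \<open>\<psi>\<close> cannot make
      up for this loss.\<close>
    define \<phi> where "\<phi> = bidual_embedding u + \<eta> *\<^sub>R \<psi>"
    have \<phi>: "norm u + s * \<eta> \<le> norm \<phi>"
      unfolding \<phi>_def using \<eta> by (intro Mstar_norm_annihilator[OF M s \<psi>]) simp
    have "0 < s * \<eta> / 2" using s \<eta> by simp
    then obtain \<zeta> where \<zeta>: "norm \<zeta> \<le> 1" "norm \<phi> - s * \<eta> / 2 < blinfun_apply \<phi> \<zeta>"
      by (rule blinfun_almost_norming)
    have *: "norm u + s * \<eta> / 2 < blinfun_apply \<zeta> u + \<eta> * blinfun_apply \<psi> \<zeta>"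
      using \<zeta>(2) \<phi> by (simp add: \<phi>_def blinfun.add_left blinfun.scaleR_left)
    have "blinfun_apply \<zeta> u \<le> norm u" by (rule blinfun_apply_le_1[OF \<zeta>(1)])
    with * have "\<eta> * (s / 2) < \<eta> * blinfun_apply \<psi> \<zeta>" by (simp add: mult.commute)
    then have "s / 2 < blinfun_apply \<psi> \<zeta>" using \<eta> by simp
    then have "\<zeta> \<in> C" using \<zeta>(1) by (simp add: C_def)
    from a[OF this] have "blinfun_apply \<zeta> u + \<eta> \<le> blinfun_apply u x0"
      unfolding u by simp
    moreover have "blinfun_apply u x0 \<le> norm u" using blinfun_apply_le[of u x0] x0 by simp
    moreover have "\<eta> * blinfun_apply \<psi> \<zeta> \<le> \<eta> * 1"
      using blinfun_apply_le[of \<psi> \<zeta>] \<psi>(1) \<zeta>(1) \<eta> by (intro mult_left_mono) auto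
    ultimately show False using * \<open>0 < s * \<eta> / 2\<close> by linarith
  qed
  have "\<exists>y. s / 4 \<le> norm y \<and> norm (x0 + y) \<le> 1 + \<eta> \<and> (\<forall>w\<in>W. \<bar>blinfun_apply w y\<bar> \<le> \<eta>)"
    if W: "finite W" and \<eta>: "0 < \<eta>" for W :: "('a \<Rightarrow>\<^sub>L real) set" and \<eta>
  proof -
    obtain \<zeta> where \<zeta>: "norm \<zeta> \<le> 1" "s / 2 \<le> blinfun_apply \<psi> \<zeta>"
        "\<And>w. w \<in> W \<Longrightarrow> \<bar>blinfun_apply \<zeta> w - blinfun_apply w x0\<bar> < \<eta> / 2"
      using claim[OF W, of "\<eta> / 2"] \<eta> by auto
    have "blinfun_apply \<psi> (\<zeta> - bidual_embedding x0) = blinfun_apply \<psi> \<zeta>"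
      by (simp add: blinfun.diff_right \<psi>(2))
    then have n: "s / 2 \<le> norm (\<zeta> - bidual_embedding x0)"
      using blinfun_apply_le[of \<psi> "\<zeta> - bidual_embedding x0"] \<psi>(1) \<zeta>(2) by simp
    have "0 < s / 8" using s by simp
    then obtain f where f: "norm f \<le> 1" "norm (\<zeta> - bidual_embedding x0) - s / 8
        < blinfun_apply (\<zeta> - bidual_embedding x0) f"
      by (rule blinfun_almost_norming)
    have "finite (insert f W)" "0 < min (\<eta> / 2) (s / 8)" using W \<eta> s by auto
    then obtain z where z: "norm z \<le> norm \<zeta>"
      "\<And>w. w \<in> insert f W \<Longrightarrow> \<bar>blinfun_apply w z - blinfun_apply \<zeta> w\<bar> < min (\<eta> / 2) (s / 8)"
      by (rule goldstine[of _ _ \<zeta>]) blast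
    \<comment> \<open>One loss of \<open>s / 8\<close> is from \<open>f\<close> only almost norming
      the difference, the other from approximating \<open>\<zeta>\<close> at
      \<open>f\<close>.\<close>
    have "s / 2 - s / 8 - s / 8 \<le> blinfun_apply f (z - x0)"
    proof -
      have "\<bar>blinfun_apply f z - blinfun_apply \<zeta> f\<bar> < s / 8" using z(2)[of f] by simp
      then show ?thesis
        using f(2) n unfolding blinfun.diff_left blinfun.diff_right bidual_embedding_apply by linarith
    qed
    then have "s / 4 \<le> norm (z - x0)"
      using blinfun_apply_le_1[OF f(1), of "z - x0"] by simp
    moreover have "\<bar>blinfun_apply w (z - x0)\<bar> \<le> \<eta>" if "w \<in> W" for w
    proof -
      have "\<bar>blinfun_apply w z - blinfun_apply \<zeta> w\<bar> < \<eta> / 2" using z(2)[of w] that by simp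
      then show ?thesis using \<zeta>(3)[OF that] unfolding blinfun.diff_right by linarith
    qed
    ultimately show ?thesis
      using z(1) \<zeta>(1) \<eta> by (intro exI[of _ "z - x0"]) auto
  qed
  then show ?thesis
    unfolding flat_at_def using x0 s by (intro conjI exI[of _ "s / 4"]) auto
qed

subsection \<open>Copies of c0\<close>

lemma apply_Bcontfun_nat:
  fixes a :: "nat \<Rightarrow> real"
  assumes "bounded (range a)"
  shows "apply_bcontfun (Bcontfun a) = a"
  using assms by (intro Bcontfun_inverse) (simp add: bcontfun_def)

lemma apply_Bcontfun_convergent:
  fixes a :: "nat \<Rightarrow> real"
  assumes "a \<longlonglongrightarrow> 0"
  shows "apply_bcontfun (Bcontfun a) = a" "Bcontfun a \<in> c0"
proof -
  show "apply_bcontfun (Bcontfun a) = a"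
    using assms by (intro apply_Bcontfun_nat convergent_imp_bounded)
  with assms show "Bcontfun a \<in> c0" by (simp add: c0_def)
qed

lemma c0_add: "a \<in> c0 \<Longrightarrow> b \<in> c0 \<Longrightarrow> a + b \<in> c0"
  unfolding c0_def using tendsto_add by (fastforce simp: plus_bcontfun.rep_eq)

lemma c0_scaleR: "a \<in> c0 \<Longrightarrow> t *\<^sub>R a \<in> c0"
  unfolding c0_def using tendsto_mult_left[of "apply_bcontfun a" 0 sequentially t]
  by (simp add: scaleR_bcontfun.rep_eq)

text \<open>An isomorphic copy of \<open>c0\<close> as seen by its embedding \<open>T\<close>, defined on null sequences, and
  Hahn--Banach extensions \<open>f k\<close> of its coordinate functionals.\<close>

lemma c0_copy_coordinates:
  assumes "contains_copy_of_c0 TYPE('a)"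
  obtains T :: "(nat \<Rightarrow> real) \<Rightarrow> 'a::real_normed_vector" and f :: "nat \<Rightarrow> 'a \<Rightarrow>\<^sub>L real" and K
  where "0 < K"
    "\<And>a b. a \<longlonglongrightarrow> 0 \<Longrightarrow> b \<longlonglongrightarrow> 0 \<Longrightarrow> T (\<lambda>n. a n + b n) = T a + T b"
    "\<And>t a. a \<longlonglongrightarrow> 0 \<Longrightarrow> T (\<lambda>n. t * a n) = t *\<^sub>R T a"
    "\<And>a B. a \<longlonglongrightarrow> 0 \<Longrightarrow> (\<And>n. \<bar>a n\<bar> \<le> B) \<Longrightarrow> norm (T a) \<le> K * B"
    "\<And>k. norm (f k) \<le> K"
    "\<And>k a. a \<longlonglongrightarrow> 0 \<Longrightarrow> blinfun_apply (f k) (T a) = a k"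
proof -
  obtain S :: "(nat \<Rightarrow>\<^sub>C real) \<Rightarrow> 'a" and m C where m: "0 < m"
    and add: "\<And>a b. a \<in> c0 \<Longrightarrow> b \<in> c0 \<Longrightarrow> S (a + b) = S a + S b"
    and scale: "\<And>a t. a \<in> c0 \<Longrightarrow> S (t *\<^sub>R a) = t *\<^sub>R S a"
    and lb: "\<And>a. a \<in> c0 \<Longrightarrow> m * norm a \<le> norm (S a)"
    and ub: "\<And>a. a \<in> c0 \<Longrightarrow> norm (S a) \<le> C * norm a"
    using assms unfolding contains_copy_of_c0_def by blast
  define T where "T a = S (Bcontfun a)" for a
  \<comment> \<open>\<open>1 / m\<close> bounds the coordinate functionals, \<open>C\<close> bounds
    the embedding, and the 1 ensures positivity.\<close>
  define K where "K = max (1 / m) (max C 1)"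
  have K: "0 < K" "C \<le> K" "1 / m \<le> K" by (auto simp: K_def)
  have zero: "(0 :: nat \<Rightarrow>\<^sub>C real) \<in> c0" by (simp add: c0_def zero_bcontfun.rep_eq)
  have "\<exists>f :: 'a \<Rightarrow>\<^sub>L real. norm f \<le> K \<and> (\<forall>a\<in>c0. blinfun_apply f (S a) = apply_bcontfun a k)" for k
  proof -
    \<comment> \<open>The graph is a linear subspace, so the lower bound holds for both signs and
      becomes an equality.\<close>
    define G where "G = (\<lambda>a. (S a, apply_bcontfun a k)) ` c0"
    have G: "(S a, apply_bcontfun a k) \<in> G" if "a \<in> c0" for a using that by (auto simp: G_def)
    have S0: "S 0 = 0" using scale[OF zero, of 0] by simp
    obtain f :: "'a \<Rightarrow>\<^sub>L real" where f: "norm f \<le> K" "\<And>z r. (z, r) \<in> G \<Longrightarrow> r \<le> blinfun_apply f z"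
    proof (rule mazur_orlicz_norm[of K G])
      show "0 \<in> G" using G[OF zero] S0 by (simp add: zero_prod_def zero_bcontfun.rep_eq)
      fix p q assume "p \<in> G" "q \<in> G"
      then obtain a b where *: "a \<in> c0" "p = (S a, apply_bcontfun a k)" "b \<in> c0" "q = (S b, apply_bcontfun b k)"
        by (auto simp: G_def)
      show "p + q \<in> G"
        using G[OF c0_add[OF *(1,3)]] * by (simp add: add plus_bcontfun.rep_eq)
    next
      fix t :: real and p assume "p \<in> G"
      then obtain a where *: "a \<in> c0" "p = (S a, apply_bcontfun a k)" by (auto simp: G_def)
      show "t *\<^sub>R p \<in> G"
        using G[OF c0_scaleR[OF *(1)], of t] * by (simp add: scale scaleR_bcontfun.rep_eq)
    next
      fix z r assume "(z, r) \<in> G"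
      then obtain a where a: "a \<in> c0" "z = S a" "r = apply_bcontfun a k" by (auto simp: G_def)
      have "r \<le> norm a" using norm_bounded[of a k] a(3) by simp
      also have "\<dots> \<le> (1 / m) * norm (S a)" using lb[OF a(1)] m by (simp add: field_simps)
      also have "\<dots> \<le> K * norm (S a)" using K(3) by (rule mult_right_mono) simp
      finally show "r \<le> K * norm z" using a(2) by simp
    qed (use K in auto)
    have "blinfun_apply f (S a) = apply_bcontfun a k" if a: "a \<in> c0" for a
    proof (rule antisym)
      show "apply_bcontfun a k \<le> blinfun_apply f (S a)" by (rule f(2)[OF G[OF a]])
      show "blinfun_apply f (S a) \<le> apply_bcontfun a k"
        using f(2)[OF G[OF c0_scaleR[OF a, of "- 1"]]] scale[OF a, of "- 1"]
        by (simp add: uminus_bcontfun.rep_eq blinfun.minus_right)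
    qed
    with f(1) show ?thesis by blast
  qed
  then obtain f :: "nat \<Rightarrow> 'a \<Rightarrow>\<^sub>L real" where f: "\<And>k. norm (f k) \<le> K"
    "\<And>k a. a \<in> c0 \<Longrightarrow> blinfun_apply (f k) (S a) = apply_bcontfun a k" by metis
  show ?thesis
  proof (rule that[OF K(1), of T f])
    fix a b :: "nat \<Rightarrow> real" assume ab: "a \<longlonglongrightarrow> 0" "b \<longlonglongrightarrow> 0"
    have "(\<lambda>n. a n + b n) \<longlonglongrightarrow> 0" using tendsto_add[OF ab] by simp
    note * = apply_Bcontfun_convergent(1)[OF this] apply_Bcontfun_convergent(1)[OF ab(1)]
      apply_Bcontfun_convergent(1)[OF ab(2)]
    have "Bcontfun (\<lambda>n. a n + b n) = Bcontfun a + Bcontfun b"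
      by (rule bcontfun_eqI) (simp add: plus_bcontfun.rep_eq *)
    then show "T (\<lambda>n. a n + b n) = T a + T b"
      using add[OF apply_Bcontfun_convergent(2)[OF ab(1)] apply_Bcontfun_convergent(2)[OF ab(2)]]
      by (simp add: T_def)
  next
    fix t and a :: "nat \<Rightarrow> real" assume a: "a \<longlonglongrightarrow> 0"
    have "(\<lambda>n. t * a n) \<longlonglongrightarrow> 0" using tendsto_mult_left[OF a, of t] by simp
    note * = apply_Bcontfun_convergent(1)[OF this] apply_Bcontfun_convergent(1)[OF a]
    have "Bcontfun (\<lambda>n. t * a n) = t *\<^sub>R Bcontfun a"
      by (rule bcontfun_eqI) (simp add: scaleR_bcontfun.rep_eq *)
    then show "T (\<lambda>n. t * a n) = t *\<^sub>R T a"
      using scale[OF apply_Bcontfun_convergent(2)[OF a]] by (simp add: T_def)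
  next
    fix a :: "nat \<Rightarrow> real" and B assume a: "a \<longlonglongrightarrow> 0" and B: "\<And>n. \<bar>a n\<bar> \<le> B"
    have "norm (Bcontfun a) \<le> B"
      using B by (intro norm_bound) (simp add: apply_Bcontfun_convergent(1)[OF a])
    have "norm (T a) \<le> C * norm (Bcontfun a)" unfolding T_def by (rule ub[OF apply_Bcontfun_convergent(2)[OF a]])
    also have "\<dots> \<le> K * norm (Bcontfun a)" using K by (intro mult_right_mono) auto
    also have "\<dots> \<le> K * B" using K \<open>norm (Bcontfun a) \<le> B\<close> by (intro mult_left_mono) auto
    finally show "norm (T a) \<le> K * B" .
  next
    fix k and a :: "nat \<Rightarrow> real" assume a: "a \<longlonglongrightarrow> 0"
    show "blinfun_apply (f k) (T a) = a k"
      using f(2)[OF apply_Bcontfun_convergent(2)[OF a]] by (simp add: T_def apply_Bcontfun_convergent(1)[OF a])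
  qed (rule f(1))
qed

lemma finite_indicator_tendsto_0:
  "finite A \<Longrightarrow> (indicator A :: nat \<Rightarrow> real) \<longlonglongrightarrow> 0"
proof (rule tendsto_eventually)
  assume "finite A"
  then obtain N where "A \<subseteq> {..<N}" by (meson finite_nat_iff_bounded)
  have "eventually (\<lambda>n. N \<le> n) sequentially" by (rule eventually_ge_at_top)
  then show "eventually (\<lambda>n. indicator A n = (0::real)) sequentially"
    by eventually_elim (use \<open>A \<subseteq> {..<N}\<close> in \<open>auto simp: indicator_def\<close>)
qed

text \<open>The initial segments \<open>\<sigma> n\<close> and the coordinate functionals
  \<open>f k\<close> have values 1 for \<open>k < n\<close> and 0 otherwise. If \<open>x\<close> is
  a weak limit of the \<open>\<sigma> n\<close> and \<open>l\<close> a weak-star limit of the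
  \<open>f k\<close>, the two iterated limits give \<open>l\<close> the values 1 and 0 at
  \<open>x\<close>.\<close>

lemma c0_copy_imp_not_reflexive:
  assumes "contains_copy_of_c0 TYPE('a::real_normed_vector)"
  shows "\<not> reflexive_space TYPE('a)"
proof
  assume refl: "reflexive_space TYPE('a)"
  obtain T :: "(nat \<Rightarrow> real) \<Rightarrow> 'a" and f :: "nat \<Rightarrow> 'a \<Rightarrow>\<^sub>L real" and K
    where bound: "\<And>a B. a \<longlonglongrightarrow> 0 \<Longrightarrow> (\<And>n. \<bar>a n\<bar> \<le> B) \<Longrightarrow> norm (T a) \<le> K * B"
    and f: "\<And>k. norm (f k) \<le> K" "\<And>k a. a \<longlonglongrightarrow> 0 \<Longrightarrow> blinfun_apply (f k) (T a) = a k"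
    by (rule c0_copy_coordinates[OF assms]) blast
  define \<sigma> where "\<sigma> n = T (indicator {..<n})" for n :: nat
  have "norm (\<sigma> n) \<le> K" for n
    unfolding \<sigma>_def using bound[OF finite_indicator_tendsto_0, of "{..<n}" 1] by (auto simp: indicator_def)
  have fs: "blinfun_apply (f k) (\<sigma> n) = indicator {..<n} k" for k n
    unfolding \<sigma>_def by (rule f(2)[OF finite_indicator_tendsto_0]) simp
  obtain U :: "nat filter" where U: "U \<le> sequentially" "ultrafilter U"
    using ex_ultrafilter[OF sequentially_bot] by blast
  have nb: "U \<noteq> bot" using U by (simp add: ultrafilter_def)
  obtain x where x: "\<And>w :: 'a \<Rightarrow>\<^sub>L real. ((\<lambda>n. blinfun_apply w (\<sigma> n)) \<longlongrightarrow> blinfun_apply w x) U"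
    using reflexive_weak_limit[OF refl U(2), of \<sigma> K] \<open>\<And>n. norm (\<sigma> n) \<le> K\<close> by auto
  obtain l where l: "\<And>x. ((\<lambda>k. blinfun_apply (f k) x) \<longlongrightarrow> blinfun_apply l x) U"
    by (rule ultrafilter_weak_star_limit[OF U(2), of f K]) (use f(1) in auto)
  have fx: "blinfun_apply (f k) x = 1" for k
  proof (rule tendsto_unique[OF nb x])
    have "eventually (\<lambda>n. blinfun_apply (f k) (\<sigma> n) = 1) sequentially"
      using eventually_gt_at_top[of k] by eventually_elim (simp add: fs)
    then show "((\<lambda>n. blinfun_apply (f k) (\<sigma> n)) \<longlongrightarrow> 1) U"
      by (intro tendsto_eventually filter_leD[OF U(1)])
  qed
  have ls: "blinfun_apply l (\<sigma> n) = 0" for n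
  proof (rule tendsto_unique[OF nb l])
    have "eventually (\<lambda>k. blinfun_apply (f k) (\<sigma> n) = 0) sequentially"
      using eventually_ge_at_top[of n] by eventually_elim (simp add: fs)
    then show "((\<lambda>k. blinfun_apply (f k) (\<sigma> n)) \<longlongrightarrow> 0) U"
      by (intro tendsto_eventually filter_leD[OF U(1)])
  qed
  have "blinfun_apply l x = 1" using tendsto_unique[OF nb l[of x]] by (simp add: fx)
  moreover have "blinfun_apply l x = 0" using tendsto_unique[OF nb x[of l]] by (simp add: ls)
  ultimately show False by simp
qed

lemma topcontinuous_at_weak_LIMSEQ:
  assumes c: "topcontinuous_at (subtopology weak_topology S) euclidean (\<lambda>y. y) x"
    and z: "\<And>n. z n \<in> S" and lim: "limitin weak_topology z x sequentially"
  shows "z \<longlonglongrightarrow> x"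
proof (rule topological_tendstoI)
  fix V assume "open V" "x \<in> V"
  then obtain U where U: "openin (subtopology weak_topology S) U" "x \<in> U" "U \<subseteq> V"
    using c unfolding topcontinuous_at_def by (metis open_openin subsetI)
  then obtain U' where U': "openin weak_topology U'" "U = U' \<inter> S" by (auto simp: openin_subtopology)
  then have "eventually (\<lambda>n. z n \<in> U') sequentially"
    using lim U(2) unfolding limitin_def by blast
  then show "eventually (\<lambda>n. z n \<in> V) sequentially"
    by eventually_elim (use U U' z in auto)
qed

text \<open>The counterexample is the set of rescaled images of indicators of finite sets. Its
  points are uniformly separated in norm, yet adding one far coordinate to a finite set produces
  other points that converge weakly to the given one.\<close>

lemma c0_copy_imp_not_PCP:
  assumes "contains_copy_of_c0 TYPE('a::real_normed_vector)"
  shows "\<not> point_of_continuity_property TYPE('a)"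
proof
  assume pcp: "point_of_continuity_property TYPE('a)"
  obtain T :: "(nat \<Rightarrow> real) \<Rightarrow> 'a" and f :: "nat \<Rightarrow> 'a \<Rightarrow>\<^sub>L real" and K
    where K: "0 < K"
    and add: "\<And>a b. a \<longlonglongrightarrow> 0 \<Longrightarrow> b \<longlonglongrightarrow> 0 \<Longrightarrow> T (\<lambda>n. a n + b n) = T a + T b"
    and scale: "\<And>t a. a \<longlonglongrightarrow> 0 \<Longrightarrow> T (\<lambda>n. t * a n) = t *\<^sub>R T a"
    and bound: "\<And>a B. a \<longlonglongrightarrow> 0 \<Longrightarrow> (\<And>n. \<bar>a n\<bar> \<le> B) \<Longrightarrow> norm (T a) \<le> K * B"
    and f: "\<And>k. norm (f k) \<le> K" "\<And>k a. a \<longlonglongrightarrow> 0 \<Longrightarrow> blinfun_apply (f k) (T a) = a k"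
    by (rule c0_copy_coordinates[OF assms]) blast
  define p where "p A = (1 / K) *\<^sub>R T (indicator A)" for A :: "nat set"
  have fp: "blinfun_apply (f k) (p A) = indicator A k / K" if "finite A" for A k
    using f(2)[OF finite_indicator_tendsto_0[OF that]] by (simp add: p_def blinfun.scaleR_right)
  have sep: "1 / K / K \<le> norm (p A - p B)" if AB: "finite A" "finite B" "A \<noteq> B" for A B
  proof -
    obtain k where "k \<in> (A - B) \<union> (B - A)" using AB(3) by auto
    then have "1 / K = \<bar>blinfun_apply (f k) (p A - p B)\<bar>"
      using K by (auto simp: blinfun.diff_right fp AB)
    also have "\<dots> \<le> norm (f k) * norm (p A - p B)" using norm_blinfun[of "f k"] by simp
    also have "\<dots> \<le> K * norm (p A - p B)" using f(1) by (rule mult_right_mono) simp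
    finally show ?thesis using K by (simp add: field_simps)
  qed
  define S where "S = p ` {A. finite A}"
  \<comment> \<open>Uniform separation gives norm closedness, all that the definition of PCP asks of
    a test set.\<close>
  have cl: "closed S"
  proof (rule discrete_imp_closed[of "1 / K / K"])
    show "\<forall>x\<in>S. \<forall>y\<in>S. dist y x < 1 / K / K \<longrightarrow> y = x"
    proof (intro ballI impI)
      fix x y assume "x \<in> S" "y \<in> S" and d: "dist y x < 1 / K / K"
      then obtain A B where "finite A" "x = p A" "finite B" "y = p B" unfolding S_def by blast
      then show "y = x" using sep[of B A] d by (cases "A = B") (auto simp: dist_norm)
    qed
  qed (use K in simp)
  have ne: "S \<noteq> {}" by (auto simp: S_def)
  have "norm (p A) \<le> 1" if "finite A" for A
  proof -
    have "norm (T (indicator A)) \<le> K * 1"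
      by (rule bound[OF finite_indicator_tendsto_0[OF that]]) (simp add: indicator_def)
    then show ?thesis using K by (simp add: p_def)
  qed
  then have sub: "S \<subseteq> cball 0 1" by (auto simp: S_def)
  have "\<exists>x\<in>S. topcontinuous_at (subtopology weak_topology S) euclidean (\<lambda>y. y) x"
    by (rule pcp[unfolded point_of_continuity_property_def, rule_format, OF ne cl sub])
  then obtain x where x: "x \<in> S" "topcontinuous_at (subtopology weak_topology S) euclidean (\<lambda>y. y) x"
    by (elim bexE)
  then obtain A where A: "finite A" "x = p A" by (auto simp: S_def)
  \<comment> \<open>Signed sums of the images of the unit vectors are bounded by \<open>K\<close>,
    so \<open>c0_sequence_weakly_null\<close> applies to them.\<close>
  define u where "u k = T (indicator {k})" for k
  have usum: "(\<Sum>k<n. e k *\<^sub>R u k) = T (\<lambda>k. if k < n then e k else 0)" for e n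
  proof (induction n)
    case 0
    have "T (\<lambda>n. 0 * indicator {} n) = 0 *\<^sub>R T (indicator {})" by (intro scale finite_indicator_tendsto_0) simp
    then show ?case by simp
  next
    case (Suc n)
    have fin: "(\<lambda>k. if k < n then e k else 0) \<longlonglongrightarrow> 0"
      by (intro tendsto_eventually) (use eventually_ge_at_top[of n] in eventually_elim, simp)
    have "(\<lambda>k. e n * indicator {n} k) \<longlonglongrightarrow> 0"
      using tendsto_mult_left[OF finite_indicator_tendsto_0[of "{n}"], of "e n"] by simp
    from add[OF fin this] scale[OF finite_indicator_tendsto_0[of "{n}"], of "e n"]
    have "T (\<lambda>k. (if k < n then e k else 0) + e n * indicator {n} k)
        = T (\<lambda>k. if k < n then e k else 0) + e n *\<^sub>R u n" by (simp add: u_def)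
    moreover have "(\<lambda>k. (if k < n then e k else 0) + e n * indicator {n} k) = (\<lambda>k. if k < Suc n then e k else 0)"
      by (rule ext) (auto simp: indicator_def less_Suc_eq)
    ultimately show ?case using Suc by simp
  qed
  have ubound: "norm (\<Sum>k<n. e k *\<^sub>R u k) \<le> K" if e: "\<And>k. e k \<in> {-1, 0, 1 :: real}" for n e
  proof -
    have "norm (T (\<lambda>k. if k < n then e k else 0)) \<le> K * 1"
    proof (rule bound)
      show "(\<lambda>k. if k < n then e k else 0) \<longlonglongrightarrow> 0"
        by (intro tendsto_eventually) (use eventually_ge_at_top[of n] in eventually_elim, simp)
      show "\<bar>if k < n then e k else 0\<bar> \<le> 1" for k using e[of k] by auto
    qed
    then show ?thesis by (simp add: usum)
  qed
  obtain N where N: "A \<subseteq> {..<N}" using A(1) by (meson finite_nat_iff_bounded)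
  \<comment> \<open>The offset \<open>N\<close> keeps the added coordinate outside
    \<open>A\<close>.\<close>
  define z where "z n = p (insert (N + n) A)" for n
  have zx: "z n = x + (1 / K) *\<^sub>R u (N + n)" for n
  proof -
    have "(\<lambda>k. indicator A k + indicator {N + n} k :: real) = indicator (insert (N + n) A)"
      using N by (auto simp: indicator_def fun_eq_iff)
    then show ?thesis
      using add[OF finite_indicator_tendsto_0[OF A(1)] finite_indicator_tendsto_0[of "{N + n}"]]
      by (simp add: z_def p_def u_def A(2) scaleR_add_right)
  qed
  have "z \<longlonglongrightarrow> x"
  proof (rule topcontinuous_at_weak_LIMSEQ[OF x(2)])
    show "z n \<in> S" for n using A(1) by (auto simp: z_def S_def)
    show "limitin weak_topology z x sequentially"
      unfolding limitin_weak_topology_iff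
    proof
      fix w :: "'a \<Rightarrow>\<^sub>L real"
      have "(\<lambda>k. blinfun_apply w (u k)) \<longlonglongrightarrow> 0" by (rule c0_sequence_weakly_null[OF ubound])
      from LIMSEQ_ignore_initial_segment[OF this, of N]
      have "(\<lambda>n. blinfun_apply w (u (N + n))) \<longlonglongrightarrow> 0" by (simp add: add.commute)
      from tendsto_add[OF tendsto_const[of "blinfun_apply w x"] tendsto_mult_left[OF this, of "1 / K"]]
      show "(\<lambda>n. blinfun_apply w (z n)) \<longlonglongrightarrow> blinfun_apply w x"
        by (simp add: zx blinfun.add_right blinfun.scaleR_right)
    qed
  qed
  then have "eventually (\<lambda>n. dist (z n) x < 1 / K / K) sequentially"
    using K by (intro tendstoD) auto
  then obtain n where "dist (z n) x < 1 / K / K" by (auto simp: eventually_sequentially)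
  moreover have "insert (N + n) A \<noteq> A" using N by auto
  ultimately show False using sep[of "insert (N + n) A" A] A by (simp add: z_def dist_norm)
qed

section \<open>Failure of the Radon-Nikodym property in the presence of \<open>c0\<close>\<close>

text \<open>Differences of a measurable and a simple function are only measurable by splitting along the
  values of the latter: in a nonseparable space the Borel sets of the product need not come from
  rectangles.\<close>

lemma borel_measurable_diff_simple:
  fixes g s :: "'w \<Rightarrow> 'a::real_normed_vector"
  assumes g: "g \<in> borel_measurable M" and s: "simple_function M s"
  shows "(\<lambda>w. norm (g w - s w)) \<in> borel_measurable M"
proof (rule borel_measurableI_le)
  fix c
  have "{w \<in> space M. norm (g w - s w) \<le> c}
      = (\<Union>v\<in>s ` space M. {w \<in> space M. norm (g w - v) \<le> c} \<inter> (s -` {v} \<inter> space M))"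
    by auto
  also have "\<dots> \<in> sets M"
  proof (rule sets.finite_UN)
    show "finite (s ` space M)" using s by (simp add: simple_function_def)
    fix v assume "v \<in> s ` space M"
    then have "s -` {v} \<inter> space M \<in> sets M" using s by (auto simp: simple_function_def)
    moreover have "(\<lambda>w. norm (g w - v)) \<in> borel_measurable M"
      using g by (rule borel_measurable_continuous_on[rotated]) (intro continuous_intros)
    moreover from this have "{w \<in> space M. norm (g w - v) \<le> c} \<in> sets M" by measurable
    ultimately show "{w \<in> space M. norm (g w - v) \<le> c} \<inter> (s -` {v} \<inter> space M) \<in> sets M" by blast
  qed
  finally show "{w \<in> space M. norm (g w - s w) \<le> c} \<in> sets M" .
qed

text \<open>Composing the approximating simple functions with \<open>f\<close> leads to scalar
  integrals, where the usual integration theory is available.\<close>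

lemma has_Bochner_integral_blinfun:
  fixes f :: "'a::real_normed_vector \<Rightarrow>\<^sub>L real"
  assumes "has_Bochner_integral M g x"
  shows "has_bochner_integral M (\<lambda>w. blinfun_apply f (g w)) (blinfun_apply f x)"
proof -
  obtain s where g: "g \<in> borel_measurable M"
    and s: "\<And>i. Bochner_Integration.simple_bochner_integrable M (s i)"
    and lim: "(\<lambda>i. \<integral>\<^sup>+w. ennreal (norm (g w - s i w)) \<partial>M) \<longlonglongrightarrow> 0"
      "(\<lambda>i. Bochner_Integration.simple_bochner_integral M (s i)) \<longlonglongrightarrow> x"
    using assms unfolding has_Bochner_integral_def by blast
  show ?thesis
  proof (rule has_bochner_integral.intros[where s="\<lambda>i w. blinfun_apply f (s i w)"])
    show "(\<lambda>w. blinfun_apply f (g w)) \<in> borel_measurable M"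
      using g by (rule borel_measurable_continuous_on[rotated]) (intro continuous_intros)
    show "Bochner_Integration.simple_bochner_integrable M (\<lambda>w. blinfun_apply f (s i w))" for i
      by (rule Bochner_Integration.simple_bochner_integrable_compose2[where p="\<lambda>x y. blinfun_apply f x", OF _ s s]) simp
    have "(\<lambda>i. blinfun_apply f (Bochner_Integration.simple_bochner_integral M (s i)))
        \<longlonglongrightarrow> blinfun_apply f x"
      by (intro tendsto_intros lim)
    moreover have "Bochner_Integration.simple_bochner_integral M (\<lambda>w. blinfun_apply f (s i w))
        = blinfun_apply f (Bochner_Integration.simple_bochner_integral M (s i))" for i
      by (rule Bochner_Integration.simple_bochner_integral_linear[OF linear_blinfun_apply s])
    ultimately show "(\<lambda>i. Bochner_Integration.simple_bochner_integral M (\<lambda>w. blinfun_apply f (s i w)))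
        \<longlonglongrightarrow> blinfun_apply f x" by simp
    have le: "(\<integral>\<^sup>+w. ennreal (norm (blinfun_apply f (g w) - blinfun_apply f (s i w))) \<partial>M)
        \<le> ennreal (norm f) * (\<integral>\<^sup>+w. ennreal (norm (g w - s i w)) \<partial>M)" for i
    proof -
      have [measurable]: "(\<lambda>w. norm (g w - s i w)) \<in> borel_measurable M"
        using s[of i] by (intro borel_measurable_diff_simple g)
          (auto elim: Bochner_Integration.simple_bochner_integrable.cases)
      have "(\<integral>\<^sup>+w. ennreal (norm (blinfun_apply f (g w) - blinfun_apply f (s i w))) \<partial>M)
          \<le> (\<integral>\<^sup>+w. ennreal (norm f) * ennreal (norm (g w - s i w)) \<partial>M)"
        using norm_blinfun[of f]
        by (intro nn_integral_mono) (simp flip: ennreal_mult' blinfun.diff_right)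
      also have "\<dots> = ennreal (norm f) * (\<integral>\<^sup>+w. ennreal (norm (g w - s i w)) \<partial>M)"
        by (rule nn_integral_cmult) simp
      finally show ?thesis .
    qed
    have "(\<lambda>i. ennreal (norm f) * (\<integral>\<^sup>+w. ennreal (norm (g w - s i w)) \<partial>M)) \<longlonglongrightarrow> ennreal (norm f) * 0"
      by (intro ennreal_tendsto_cmult lim) simp
    then have lim0: "(\<lambda>i. ennreal (norm f) * (\<integral>\<^sup>+w. ennreal (norm (g w - s i w)) \<partial>M)) \<longlonglongrightarrow> 0"
      by simp
    show "(\<lambda>i. \<integral>\<^sup>+w. ennreal (norm (blinfun_apply f (g w) - blinfun_apply f (s i w))) \<partial>M) \<longlonglongrightarrow> 0"
      by (rule tendsto_sandwich[OF _ _ tendsto_const lim0];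
        intro always_eventually allI zero_le le)
  qed
qed

text \<open>Choose a simple function whose distance to \<open>g\<close> integrates to less than
  \<open>e\<close> times the total measure. If it were within \<open>e\<close> of \<open>g\<close>
  only on a null part of each of its finitely many level sets, that integral would be too
  large.\<close>

lemma has_Bochner_integral_small_oscillation:
  fixes g :: "'w \<Rightarrow> 'a::real_normed_vector"
  assumes M: "finite_measure M" and pos: "0 < measure M (space M)" and e: "0 < e"
    and int: "has_Bochner_integral M (\<lambda>w. indicator (space M) w *\<^sub>R g w) x"
  obtains B v where "B \<in> sets M" "0 < measure M B" "\<And>w. w \<in> B \<Longrightarrow> norm (g w - v) \<le> e"
proof (rule ccontr)
  assume neg: "\<not> thesis"
  note thesisI = that
  interpret finite_measure M by fact
  define h where "h w = indicator (space M) w *\<^sub>R g w" for w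
  obtain s where h: "h \<in> borel_measurable M"
    and s: "\<And>i. Bochner_Integration.simple_bochner_integrable M (s i)"
    and lim: "(\<lambda>i. \<integral>\<^sup>+w. ennreal (norm (h w - s i w)) \<partial>M) \<longlonglongrightarrow> 0"
    using int unfolding has_Bochner_integral_def h_def by blast
  have "0 < ennreal e * emeasure M (space M)"
    using e pos by (simp add: emeasure_eq_measure ennreal_zero_less_mult_iff)
  then have "eventually (\<lambda>i. (\<integral>\<^sup>+w. ennreal (norm (h w - s i w)) \<partial>M) < ennreal e * emeasure M (space M)) sequentially"
    using lim by (intro order_tendstoD(2))
  then obtain i where i: "(\<integral>\<^sup>+w. ennreal (norm (h w - s i w)) \<partial>M) < ennreal e * emeasure M (space M)"
    by (auto simp: eventually_sequentially)
  have sf: "simple_function M (s i)" using s[of i] by (auto elim: Bochner_Integration.simple_bochner_integrable.cases)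
  define D where "D v = {w \<in> space M. norm (h w - v) \<le> e} \<inter> (s i -` {v} \<inter> space M)" for v
  have D: "D v \<in> sets M" if "v \<in> s i ` space M" for v
  proof -
    have "(\<lambda>w. norm (h w - v)) \<in> borel_measurable M"
      using h by (rule borel_measurable_continuous_on[rotated]) (intro continuous_intros)
    then have "{w \<in> space M. norm (h w - v) \<le> e} \<in> sets M" by measurable
    with sf that show ?thesis by (auto simp: D_def simple_function_def)
  qed
  have "measure M (D v) = 0" if v: "v \<in> s i ` space M" for v
  proof (rule ccontr)
    assume "measure M (D v) \<noteq> 0"
    then have "0 < measure M (D v)" using measure_nonneg[of M "D v"] by linarith
    moreover have "norm (g w - v) \<le> e" if "w \<in> D v" for w
      using that by (auto simp: D_def h_def)
    ultimately show False
      using neg thesisI[OF D[OF v]] by blast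
  qed
  then have null: "D v \<in> null_sets M" if "v \<in> s i ` space M" for v
    using D[OF that] that by (simp add: null_sets_def emeasure_eq_measure)
  have "(\<Union>v\<in>s i ` space M. D v) \<in> null_sets M"
    using sf null by (intro null_sets.finite_UN) (auto simp: simple_function_def)
  then have "AE w in M. w \<notin> (\<Union>v\<in>s i ` space M. D v)" by (rule AE_not_in)
  then have "AE w in M. ennreal e \<le> ennreal (norm (h w - s i w))"
    by (rule AE_mp) (auto intro!: AE_I2 ennreal_leI simp: D_def not_le intro: less_imp_le)
  then have "(\<integral>\<^sup>+w. ennreal e \<partial>M) \<le> (\<integral>\<^sup>+w. ennreal (norm (h w - s i w)) \<partial>M)"
    by (rule nn_integral_mono_AE)
  with i show False by (simp add: not_le[symmetric])
qed

text \<open>The measure sends \<open>E\<close> to the image of the null sequence of the numbers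
  \<open>measure M (E \<inter> A n)\<close>, so coordinate \<open>n\<close> of a density would have
  to be the indicator of \<open>A n\<close>. Where the density is almost a constant
  \<open>v\<close>, averaging over a part inside \<open>A n\<close> and a part outside forces the
  same number \<open>f n\<close> at \<open>v\<close> to be close to both 1 and 0.\<close>

lemma c0_copy_imp_not_RNP_vanishing_covers:
  fixes M :: "'w measure" and A :: "nat \<Rightarrow> 'w set"
  assumes copy: "contains_copy_of_c0 TYPE('a::real_normed_vector)"
    and M: "finite_measure M" and pos: "0 < measure M (space M)"
    and A: "\<And>n. A n \<in> sets M" "(\<lambda>n. measure M (A n)) \<longlonglongrightarrow> 0"
    and cover: "\<And>e. 0 < e \<Longrightarrow> \<exists>N. finite N \<and> space M \<subseteq> (\<Union>n\<in>N. A n) \<and> (\<forall>n\<in>N. measure M (A n) < e)"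
  shows "\<not> radon_nikodym_property TYPE('w) TYPE('a)"
proof
  assume rnp: "radon_nikodym_property TYPE('w) TYPE('a)"
  interpret finite_measure M by fact
  obtain T :: "(nat \<Rightarrow> real) \<Rightarrow> 'a" and f :: "nat \<Rightarrow> 'a \<Rightarrow>\<^sub>L real" and K
    where K: "0 < K"
    and add: "\<And>a b. a \<longlonglongrightarrow> 0 \<Longrightarrow> b \<longlonglongrightarrow> 0 \<Longrightarrow> T (\<lambda>n. a n + b n) = T a + T b"
    and bound: "\<And>a B. a \<longlonglongrightarrow> 0 \<Longrightarrow> (\<And>n. \<bar>a n\<bar> \<le> B) \<Longrightarrow> norm (T a) \<le> K * B"
    and f: "\<And>k. norm (f k) \<le> K" "\<And>k a. a \<longlonglongrightarrow> 0 \<Longrightarrow> blinfun_apply (f k) (T a) = a k"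
    by (rule c0_copy_coordinates[OF copy]) blast
  define a where "a E n = measure M (E \<inter> A n)" for E n
  define G where "G E = T (a E)" for E
  have a0: "a E \<longlonglongrightarrow> 0" if "E \<in> sets M" for E
  proof (rule tendsto_sandwich[OF _ _ tendsto_const A(2)])
    show "eventually (\<lambda>n. 0 \<le> a E n) sequentially" by (simp add: a_def)
    show "eventually (\<lambda>n. a E n \<le> measure M (A n)) sequentially"
      using A(1) that by (auto simp: a_def intro!: always_eventually finite_measure_mono)
  qed
  have Gb: "norm (G E) \<le> K * measure M E" if E: "E \<in> sets M" for E
    unfolding G_def using E A(1)
    by (intro bound[OF a0[OF E]]) (auto simp: a_def intro!: finite_measure_mono)
  have Gadd: "G (E \<union> F) = G E + G F" if "E \<in> sets M" "F \<in> sets M" "E \<inter> F = {}" for E F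
  proof -
    have "a (E \<union> F) = (\<lambda>n. a E n + a F n)"
    proof
      fix n
      have "(E \<union> F) \<inter> A n = (E \<inter> A n) \<union> (F \<inter> A n)" by auto
      then show "a (E \<union> F) n = a E n + a F n"
        using that A(1)[of n] by (auto simp: a_def intro!: finite_measure_Union)
    qed
    then show ?thesis using add[OF a0 a0] that by (simp add: G_def)
  qed
  \<comment> \<open>Countable additivity follows from finite additivity and \<open>Gb\<close>,
    because the measures of the tails tend to 0.\<close>
  have "vector_measure M G"
    unfolding vector_measure_def
  proof (intro allI impI)
    fix E :: "nat \<Rightarrow> 'w set" assume E: "range E \<subseteq> sets M" "disjoint_family E"
    define R where "R N = (\<Union>i. E i) - (\<Union>i<N. E i)" for N
    have sets: "(\<Union>i. E i) \<in> sets M" "(\<Union>i<N. E i) \<in> sets M" "R N \<in> sets M" for N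
      using E(1) by (auto simp: R_def)
    have fin: "(\<Sum>i<N. G (E i)) = G (\<Union>i<N. E i)" for N
    proof (induction N)
      case 0
      show ?case using Gb[of "{}"] by simp
    next
      case (Suc N)
      have "(\<Union>i<N. E i) \<inter> E N = {}"
        using E(2) by (auto simp: disjoint_family_on_def) (metis IntI UNIV_I empty_iff less_irrefl)
      then have "G ((\<Union>i<N. E i) \<union> E N) = G (\<Union>i<N. E i) + G (E N)"
        using E(1) sets(2) by (intro Gadd) auto
      then show ?case using Suc by (simp add: lessThan_Suc Un_commute)
    qed
    have l0: "(\<lambda>N. K * measure M (R N)) \<longlonglongrightarrow> K * 0"
    proof (intro tendsto_mult_left)
      have "(\<lambda>N. \<Sum>i<N. measure M (E i)) \<longlonglongrightarrow> measure M (\<Union>i. E i)"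
        using finite_measure_UNION[OF E] unfolding sums_def .
      moreover have "measure M (R N) = measure M (\<Union>i. E i) - (\<Sum>i<N. measure M (E i))" for N
        unfolding R_def using sets E
        by (subst finite_measure_Diff)
          (auto intro!: finite_measure_finite_Union simp: disjoint_family_on_def)
      ultimately show "(\<lambda>N. measure M (R N)) \<longlonglongrightarrow> 0"
        using tendsto_diff[OF tendsto_const[of "measure M (\<Union>i. E i)"]] by fastforce
    qed
    have nb: "norm ((\<Sum>i<N. G (E i)) - G (\<Union>i. E i)) \<le> K * measure M (R N)" for N
    proof -
      have eq: "(\<Union>i. E i) = (\<Union>i<N. E i) \<union> R N" by (auto simp: R_def)
      have "G (\<Union>i. E i) = G (\<Union>i<N. E i) + G (R N)"
        by (subst eq, rule Gadd[OF sets(2) sets(3)]) (auto simp: R_def)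
      then show ?thesis using Gb[OF sets(3)[of N]] by (simp add: fin)
    qed
    have "(\<lambda>N. (\<Sum>i<N. G (E i)) - G (\<Union>i. E i)) \<longlonglongrightarrow> 0"
      by (rule Lim_null_comparison[OF always_eventually l0[simplified]]) (rule allI, rule nb)
    then show "(\<lambda>i. G (E i)) sums G (\<Union>i. E i)" unfolding sums_def by (rule LIM_zero_cancel)
  qed
  moreover have "bounded_variation_measure M G"
    unfolding bounded_variation_measure_def
  proof (intro exI allI impI)
    fix P assume P: "finite P" "P \<subseteq> sets M" "partition_on (space M) P"
    have "(\<Sum>E\<in>P. norm (G E)) \<le> (\<Sum>E\<in>P. K * measure M E)"
      using Gb P by (intro sum_mono) auto
    also have "\<dots> = K * measure M (\<Union>E\<in>P. E)"
      using P by (subst finite_measure_finite_Union)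
        (auto simp: sum_distrib_left partition_on_def disjoint_family_on_def disjoint_def)
    also have "\<dots> \<le> K * measure M (space M)"
      using K by (intro mult_left_mono bounded_measure) auto
    finally show "(\<Sum>E\<in>P. norm (G E)) \<le> K * measure M (space M)" .
  qed
  moreover have "\<forall>E\<in>null_sets M. G E = 0"
  proof
    fix E assume "E \<in> null_sets M"
    then have "E \<in> sets M" "measure M E = 0" by (auto simp: null_sets_def measure_def)
    then show "G E = 0" using Gb[of E] by simp
  qed
  ultimately obtain g where g: "\<And>E. E \<in> sets M \<Longrightarrow> has_Bochner_integral M (\<lambda>w. indicator E w *\<^sub>R g w) (G E)"
    using rnp M unfolding radon_nikodym_property_def by blast
  \<comment> \<open>As the coordinate functionals have norm at most \<open>K\<close>, an oscillation
    of \<open>e\<close> changes each coordinate by at most 1/4.\<close>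
  define e where "e = 1 / (4 * K)"
  have e: "0 < e" using K by (simp add: e_def)
  obtain B v where B: "B \<in> sets M" "0 < measure M B" "\<And>w. w \<in> B \<Longrightarrow> norm (g w - v) \<le> e"
    using has_Bochner_integral_small_oscillation[OF M pos e g[OF sets.top]] by metis
  have avg: "\<bar>a E k - measure M E * blinfun_apply (f k) v\<bar> \<le> measure M E * (1 / 4)"
    if E: "E \<in> sets M" "E \<subseteq> B" for E k
  proof -
    have i1: "has_bochner_integral M (\<lambda>w. blinfun_apply (f k) (indicator E w *\<^sub>R g w)) (a E k)"
      using has_Bochner_integral_blinfun[OF g[OF E(1)], of "f k"] f(2)[OF a0[OF E(1)]] by (simp add: G_def)
    have i2: "has_bochner_integral M (\<lambda>w. indicator E w * c) (measure M E * c)" for c :: real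
      using has_bochner_integral_mult_left[of c M "indicator E" "measure M E"]
        has_bochner_integral_real_indicator[OF E(1)] by (simp add: emeasure_eq_measure)
    have i3: "has_bochner_integral M (\<lambda>w. \<bar>blinfun_apply (f k) (indicator E w *\<^sub>R g w) - indicator E w * blinfun_apply (f k) v\<bar>)
        (\<integral>w. \<bar>blinfun_apply (f k) (indicator E w *\<^sub>R g w) - indicator E w * blinfun_apply (f k) v\<bar> \<partial>M)"
      using has_bochner_integral_diff[OF i1 i2[of "blinfun_apply (f k) v"]]
      by (intro has_bochner_integral_integrable integrable_abs) (auto simp: has_bochner_integral_iff)
    have "a E k - measure M E * blinfun_apply (f k) v
        = (\<integral>w. blinfun_apply (f k) (indicator E w *\<^sub>R g w) - indicator E w * blinfun_apply (f k) v \<partial>M)"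
      using has_bochner_integral_diff[OF i1 i2[of "blinfun_apply (f k) v"]]
      by (simp add: has_bochner_integral_integral_eq)
    then have "\<bar>a E k - measure M E * blinfun_apply (f k) v\<bar>
        \<le> (\<integral>w. \<bar>blinfun_apply (f k) (indicator E w *\<^sub>R g w) - indicator E w * blinfun_apply (f k) v\<bar> \<partial>M)"
      by (simp add: integral_abs_bound)
    also have "\<dots> \<le> (\<integral>w. indicator E w * (1 / 4) \<partial>M)"
    proof (rule integral_mono[OF integrable.intros[OF i3] integrable.intros[OF i2[of "1 / 4"]]])
      fix w
      show "\<bar>blinfun_apply (f k) (indicator E w *\<^sub>R g w) - indicator E w * blinfun_apply (f k) v\<bar>
          \<le> indicator E w * (1 / 4)"
      proof (cases "w \<in> E")
        case True
        have "\<bar>blinfun_apply (f k) (g w - v)\<bar> \<le> norm (f k) * norm (g w - v)"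
          using norm_blinfun[of "f k" "g w - v"] by simp
        also have "\<dots> \<le> K * e" using f(1) B(3) E(2) True K by (intro mult_mono) auto
        also have "\<dots> = 1 / 4" using K by (simp add: e_def)
        finally show ?thesis using True by (simp add: blinfun.diff_right)
      qed simp
    qed
    also have "\<dots> = measure M E * (1 / 4)" by (rule has_bochner_integral_integral_eq[OF i2])
    finally show ?thesis .
  qed
  \<comment> \<open>A cover by sets smaller than \<open>B\<close> provides an \<open>A n\<close>
    that meets \<open>B\<close> in positive measure and also leaves positive measure of
    \<open>B\<close> outside.\<close>
  obtain N where N: "finite N" "space M \<subseteq> (\<Union>n\<in>N. A n)" "\<forall>n\<in>N. measure M (A n) < measure M B"
    using cover[OF B(2)] by blast
  have "\<exists>n\<in>N. measure M (B \<inter> A n) \<noteq> 0"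
  proof (rule ccontr)
    assume "\<not> ?thesis"
    then have "(\<Union>n\<in>N. B \<inter> A n) \<in> null_sets M"
      using N(1) A(1) B(1) by (intro null_sets.finite_UN) (auto simp: null_sets_def emeasure_eq_measure)
    moreover have "(\<Union>n\<in>N. B \<inter> A n) = B" using N(2) sets.sets_into_space[OF B(1)] by auto
    ultimately show False using B(2) by (auto simp: null_sets_def measure_def)
  qed
  then obtain n where n: "n \<in> N" "measure M (B \<inter> A n) \<noteq> 0" by blast
  define c where "c = blinfun_apply (f n) v"
  define E1 where "E1 = B \<inter> A n"
  define E2 where "E2 = B - A n"
  have E: "E1 \<in> sets M" "E2 \<in> sets M" "E1 \<subseteq> B" "E2 \<subseteq> B"
    using A(1) B(1) by (auto simp: E1_def E2_def)
  have p1: "0 < measure M E1" using n(2) measure_nonneg[of M E1] by (auto simp: E1_def less_le)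
  have "measure M E1 \<le> measure M (A n)" using A(1) by (auto simp: E1_def intro: finite_measure_mono)
  also have "\<dots> < measure M B" using N(3) n(1) by blast
  also have "measure M B = measure M E1 + measure M E2"
  proof -
    have "E1 \<union> E2 = B" "E1 \<inter> E2 = {}" by (auto simp: E1_def E2_def)
    then show ?thesis using finite_measure_Union[OF E(1,2)] by simp
  qed
  finally have p2: "0 < measure M E2" by simp
  have "E1 \<inter> A n = E1" "E2 \<inter> A n = {}" by (auto simp: E1_def E2_def)
  then have a1: "a E1 n = measure M E1" and a2: "a E2 n = 0" by (simp_all add: a_def)
  have "measure M E1 - measure M E1 * c = measure M E1 * (1 - c)" by (simp add: algebra_simps)
  then have "measure M E1 * \<bar>1 - c\<bar> \<le> measure M E1 * (1 / 4)"
    using avg[OF E(1,3), of n] p1 by (simp add: a1 abs_mult flip: c_def)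
  then have c1: "\<bar>1 - c\<bar> \<le> 1 / 4" using p1 by simp
  have "measure M E2 * \<bar>c\<bar> \<le> measure M E2 * (1 / 4)"
    using avg[OF E(2,4), of n] p2 by (simp add: a2 c_def abs_mult)
  then have c2: "\<bar>c\<bar> \<le> 1 / 4" using p2 by simp
  from c1 c2 show False by linarith
qed

text \<open>The pairs with \<open>i + j = k\<close> yield the \<open>k + 1\<close> closed intervals
  of length \<open>1 / (k + 1)\<close> that tile the unit interval; the pairing enumerates all
  levels \<open>k\<close> at once, though not level by level in the order of
  \<open>i\<close>.\<close>

definition typewriter :: "nat \<Rightarrow> real set" where
  "typewriter n = (case prod_decode n of (i, j) \<Rightarrow>
    {real i / real (Suc (i + j)) .. real (Suc i) / real (Suc (i + j))})"

lemma typewriter_subset: "typewriter n \<subseteq> {0..1}"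
  by (auto simp: typewriter_def field_simps split: prod.splits)

lemma typewriter:
  shows "(\<lambda>n. measure lborel (typewriter n)) \<longlonglongrightarrow> 0"
    and "0 < e \<Longrightarrow> \<exists>N. finite N \<and> {0..1} \<subseteq> (\<Union>n\<in>N. typewriter n) \<and>
      (\<forall>n\<in>N. measure lborel (typewriter n) < e)"
proof -
  define L where "L n = fst (prod_decode n) + snd (prod_decode n)" for n
  have I: "typewriter n = {real (fst (prod_decode n)) / real (Suc (L n)) .. real (Suc (fst (prod_decode n))) / real (Suc (L n))}" for n
    by (simp add: typewriter_def L_def split_beta)
  have mI: "measure lborel (typewriter n) = 1 / real (Suc (L n))" for n
    unfolding I by (simp add: divide_right_mono diff_divide_distrib[symmetric])
  have L: "filterlim L at_top sequentially"
    unfolding filterlim_at_top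
  proof
    fix Z
    have "{n. L n < Z} \<subseteq> prod_encode ` ({..Z} \<times> {..Z})"
    proof
      fix n assume "n \<in> {n. L n < Z}"
      then have "prod_decode n \<in> {..Z} \<times> {..Z}" by (cases "prod_decode n") (auto simp: L_def)
      then show "n \<in> prod_encode ` ({..Z} \<times> {..Z})" by (metis image_eqI prod_decode_inverse)
    qed
    then have "finite {n. L n < Z}" by (rule finite_subset) simp
    then show "eventually (\<lambda>n. Z \<le> L n) sequentially"
      by (simp add: eventually_cofinite not_le flip: cofinite_eq_sequentially)
  qed
  have lim: "(\<lambda>k. 1 / real (Suc k)) \<longlonglongrightarrow> 0"
    using LIMSEQ_inverse_real_of_nat by (simp add: inverse_eq_divide)
  show "(\<lambda>n. measure lborel (typewriter n)) \<longlonglongrightarrow> 0"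
    unfolding mI by (rule filterlim_compose[OF lim L])
  assume e: "0 < e"
  have "eventually (\<lambda>k. 1 / real (Suc k) < e) sequentially" using lim e by (rule order_tendstoD(2))
  then obtain k where k: "1 / real (Suc k) < e" by (auto simp: eventually_sequentially)
  define N where "N = (\<lambda>i. prod_encode (i, k - i)) ` {..k}"
  have LN: "L n = k" if "n \<in> N" for n using that by (auto simp: N_def L_def)
  have "{0..1} \<subseteq> (\<Union>n\<in>N. typewriter n)"
  proof
    fix t :: real assume t: "t \<in> {0..1}"
    \<comment> \<open>The minimum with \<open>k\<close> is needed for the right endpoint
      \<open>t = 1\<close>, where the floor would be \<open>k + 1\<close>.\<close>
    define i where "i = min k (nat \<lfloor>t * real (Suc k)\<rfloor>)"
    have "real i \<le> t * real (Suc k)"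
    proof -
      have "real (nat \<lfloor>t * real (Suc k)\<rfloor>) \<le> t * real (Suc k)" using t by simp
      then show ?thesis by (simp add: i_def)
    qed
    moreover have "t * real (Suc k) \<le> real (Suc i)"
    proof (cases "i = k")
      case True
      then show ?thesis using t mult_right_mono[of t 1 "real (Suc k)"] by simp
    next
      case False
      then have "i = nat \<lfloor>t * real (Suc k)\<rfloor>" by (auto simp: i_def min_def split: if_splits)
      then show ?thesis using t by simp linarith
    qed
    ultimately have "t \<in> typewriter (prod_encode (i, k - i))"
      using t unfolding I by (simp add: L_def i_def field_simps)
    moreover have "prod_encode (i, k - i) \<in> N" by (auto simp: N_def i_def)
    ultimately show "t \<in> (\<Union>n\<in>N. typewriter n)" by blast
  qed
  moreover have "finite N" by (simp add: N_def)
  moreover have "\<forall>n\<in>N. measure lborel (typewriter n) < e" using k LN by (simp add: mI)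
  ultimately show "\<exists>N. finite N \<and> {0..1} \<subseteq> (\<Union>n\<in>N. typewriter n) \<and> (\<forall>n\<in>N. measure lborel (typewriter n) < e)" by blast
qed

text \<open>Lebesgue measure on the unit interval is transported along \<open>Inr\<close>; the
  summand \<open>real\<close> of the type makes room for it whatever \<open>'w\<close> is.\<close>

lemma c0_copy_imp_not_RNP:
  assumes "contains_copy_of_c0 TYPE('a::real_normed_vector)"
  shows "\<not> radon_nikodym_property TYPE('w + real) TYPE('a)"
proof -
  define M where "M = embed_measure (restrict_space lborel {0..1 :: real}) (Inr :: real \<Rightarrow> 'w + real)"
  have inj: "inj (Inr :: real \<Rightarrow> 'w + real)" by simp
  have meas: "measure M (Inr ` E) = measure lborel E" "Inr ` E \<in> sets M" if "E \<in> sets lborel" "E \<subseteq> {0..1}" for E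
  proof -
    have E: "E \<in> sets (restrict_space lborel {0..1})" using that by (auto simp: sets_restrict_space_iff)
    then show "Inr ` E \<in> sets M" unfolding M_def by (rule in_sets_embed_measure)
    show "measure M (Inr ` E) = measure lborel E"
      using that E unfolding M_def measure_def
      by (simp add: emeasure_embed_measure_image[OF inj E] emeasure_restrict_space)
  qed
  have sp: "space M = Inr ` {0..1}" by (simp add: M_def space_embed_measure space_restrict_space)
  have fin: "finite_measure M"
  proof
    have "emeasure M (space M) = emeasure lborel {0..1 :: real}"
      unfolding sp unfolding M_def
      by (subst emeasure_embed_measure_image[OF inj]) (auto simp: sets_restrict_space_iff emeasure_restrict_space)
    then show "emeasure M (space M) \<noteq> \<infinity>" by simp
  qed
  have I: "typewriter n \<in> sets lborel" "typewriter n \<subseteq> {0..1}" for n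
    using typewriter_subset by (auto simp: typewriter_def split: prod.splits)
  show ?thesis
  proof (rule c0_copy_imp_not_RNP_vanishing_covers[OF assms fin, where A="\<lambda>n. Inr ` typewriter n"])
    show "0 < measure M (space M)" by (simp add: sp meas)
    show "Inr ` typewriter n \<in> sets M" for n by (rule meas(2)[OF I])
    show "(\<lambda>n. measure M (Inr ` typewriter n)) \<longlonglongrightarrow> 0"
      using typewriter(1) by (simp add: meas(1)[OF I])
    fix e :: real assume "0 < e"
    then obtain N where "finite N" "{0..1} \<subseteq> (\<Union>n\<in>N. typewriter n)" "\<forall>n\<in>N. measure lborel (typewriter n) < e"
      using typewriter(2)[of e] by blast
    moreover from this have "Inr ` {0..1} \<subseteq> (\<Union>n\<in>N. Inr ` typewriter n)"
      unfolding image_UN[symmetric] by (intro image_mono)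
    ultimately show "\<exists>N. finite N \<and> space M \<subseteq> (\<Union>n\<in>N. Inr ` typewriter n) \<and>
        (\<forall>n\<in>N. measure M (Inr ` typewriter n) < e)"
      unfolding sp meas(1)[OF I] by blast
  qed
qed

subsection \<open>The Kadec property\<close>

text \<open>The Kadec property for nets, written with basic weak neighbourhoods. Only an upper bound
  on \<open>norm z\<close> appears, since weak closeness to \<open>x\<close> already controls the
  norm from below.\<close>

definition kadec_at :: "'a::real_normed_vector \<Rightarrow> bool" where
  "kadec_at x \<longleftrightarrow> (\<forall>e>0. \<exists>(W :: ('a \<Rightarrow>\<^sub>L real) set) \<eta>. finite W \<and> 0 < \<eta> \<and>
    (\<forall>z. (\<forall>w\<in>W. \<bar>blinfun_apply w (z - x)\<bar> \<le> \<eta>) \<longrightarrow> norm z \<le> norm x + \<eta> \<longrightarrow> norm (z - x) \<le> e))"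

text \<open>Failure of the Kadec property at \<open>x\<close> is, after division by
  \<open>norm x\<close>, flatness of the normalised point with separation constant
  \<open>e / norm x\<close>.\<close>

lemma no_c0_copy_imp_kadec_at:
  fixes x :: "'a::banach"
  assumes M: "property_Mstar TYPE('a) 1 s" "0 < s" and nc: "\<not> contains_copy_of_c0 TYPE('a)"
  shows "kadec_at x"
proof (rule ccontr)
  assume "\<not> kadec_at x"
  then obtain e where e: "0 < e" and bad: "\<And>(W :: ('a \<Rightarrow>\<^sub>L real) set) \<eta>. finite W \<Longrightarrow> 0 < \<eta> \<Longrightarrow>
      \<exists>z. (\<forall>w\<in>W. \<bar>blinfun_apply w (z - x)\<bar> \<le> \<eta>) \<and> norm z \<le> norm x + \<eta> \<and> e < norm (z - x)"
    unfolding kadec_at_def by (meson not_le)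
  \<comment> \<open>At 0 the tolerance \<open>e\<close> itself would give a \<open>z\<close> with
    \<open>norm z \<le> e < norm z\<close>.\<close>
  have x: "x \<noteq> 0" using bad[of "{}" e] e by auto
  define r where "r = norm x"
  have r: "0 < r" using x by (simp add: r_def)
  define x0 where "x0 = x /\<^sub>R r"
  have "flat_at x0"
    unfolding flat_at_def
  proof (intro conjI exI[of _ "e / r"] allI impI)
    show "norm x0 = 1" using r by (simp add: x0_def r_def)
    show "0 < e / r" using e r by simp
    fix W :: "('a \<Rightarrow>\<^sub>L real) set" and \<eta> :: real assume W: "finite W" and \<eta>: "0 < \<eta>"
    obtain z where z: "\<And>w. w \<in> W \<Longrightarrow> \<bar>blinfun_apply w (z - x)\<bar> \<le> \<eta> * r"
        "norm z \<le> r + \<eta> * r" "e < norm (z - x)"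
      using bad[OF W, of "\<eta> * r"] \<eta> r unfolding r_def by auto
    define y where "y = (z - x) /\<^sub>R r"
    have "x0 + y = z /\<^sub>R r" by (simp add: x0_def y_def scaleR_diff_right)
    then have "norm (x0 + y) = norm z / r" using r by (simp add: divide_inverse_commute)
    also have "\<dots> \<le> 1 + \<eta>" using z(2) r by (simp add: field_simps)
    finally have "norm (x0 + y) \<le> 1 + \<eta>" .
    moreover have "e / r \<le> norm y" using z(3) r by (simp add: y_def divide_inverse_commute)
    moreover have "\<bar>blinfun_apply w y\<bar> \<le> \<eta>" if "w \<in> W" for w
    proof -
      have "\<bar>blinfun_apply w y\<bar> = \<bar>blinfun_apply w (z - x)\<bar> / r"
        using r by (simp add: y_def blinfun.scaleR_right abs_mult divide_inverse_commute)
      then show ?thesis using z(1)[OF that] r by (simp add: pos_divide_le_eq)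
    qed
    ultimately show "\<exists>y. e / r \<le> norm y \<and> norm (x0 + y) \<le> 1 + \<eta> \<and> (\<forall>w\<in>W. \<bar>blinfun_apply w y\<bar> \<le> \<eta>)"
      by blast
  qed
  then obtain y g d where "c0_sequence (0 :: 'a) y g d"
    by (rule flat_imp_c0_sequence[OF M, of x0 0]) simp_all
  then show False using c0_sequence_imp_copy nc by blast
qed

lemma kadec_imp_KKP:
  assumes "\<And>x :: 'a::real_normed_vector. kadec_at x"
  shows "kadec_klee_property TYPE('a)"
  unfolding kadec_klee_property_def
proof (intro allI impI)
  fix z :: "nat \<Rightarrow> 'a" and x
  assume z: "range z \<subseteq> sphere 0 1" and x: "x \<in> sphere 0 1"
    and lim: "limitin weak_topology z x sequentially"
  show "z \<longlonglongrightarrow> x"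
  proof (rule tendstoI)
    fix e :: real assume e: "0 < e"
    then have "0 < e / 2" by simp
    then obtain W :: "('a \<Rightarrow>\<^sub>L real) set" and \<eta> where W: "finite W" "0 < \<eta>"
        "\<And>z. (\<forall>w\<in>W. \<bar>blinfun_apply w (z - x)\<bar> \<le> \<eta>) \<Longrightarrow> norm z \<le> norm x + \<eta> \<Longrightarrow> norm (z - x) \<le> e / 2"
      using assms[of x] unfolding kadec_at_def by meson
    have "eventually (\<lambda>n. \<bar>blinfun_apply w (z n - x)\<bar> < \<eta>) sequentially" for w
      using lim tendstoD[of "\<lambda>n. blinfun_apply w (z n)" "blinfun_apply w x" sequentially \<eta>] W(2)
      unfolding limitin_weak_topology_iff by (simp add: dist_real_def blinfun.diff_right)
    then have "eventually (\<lambda>n. \<forall>w\<in>W. \<bar>blinfun_apply w (z n - x)\<bar> < \<eta>) sequentially"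
      by (intro eventually_ball_finite W(1)) blast
    then show "eventually (\<lambda>n. dist (z n) x < e) sequentially"
    proof eventually_elim
      case (elim n)
      have "z n \<in> sphere 0 1" using z by blast
      then have "norm (z n) = norm x" using x by simp
      then have "norm (z n - x) \<le> e / 2" using elim W(2) by (intro W(3)) (auto intro: less_imp_le)
      then show ?case using e by (simp add: dist_norm)
    qed
  qed
qed

text \<open>Slicing close to the supremum of one functional confines its values to an interval of
  length \<open>\<eta>\<close>, and this persists in subsets. The family is abstract so that it
  covers both the weakly open pieces used for PCP and the average ranges used for RNP.\<close>

lemma slice_refine_oscillation:
  fixes \<B> :: "'a::real_normed_vector set set"
  assumes ne: "\<And>S. S \<in> \<B> \<Longrightarrow> S \<noteq> {}" and bd: "\<And>S z. S \<in> \<B> \<Longrightarrow> z \<in> S \<Longrightarrow> norm z \<le> C"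
    and slice: "\<And>S z (f :: 'a \<Rightarrow>\<^sub>L real) a. S \<in> \<B> \<Longrightarrow> z \<in> S \<Longrightarrow> a < blinfun_apply f z \<Longrightarrow>
      \<exists>S'\<in>\<B>. S' \<subseteq> S \<and> (\<forall>y\<in>S'. a \<le> blinfun_apply f y)"
    and S: "S \<in> \<B>" and W: "finite (W :: ('a \<Rightarrow>\<^sub>L real) set)" and \<eta>: "0 < \<eta>"
  shows "\<exists>S'\<in>\<B>. S' \<subseteq> S \<and> (\<forall>w\<in>W. \<forall>y\<in>S'. \<forall>z\<in>S'. \<bar>blinfun_apply w y - blinfun_apply w z\<bar> \<le> \<eta>)"
  using W
proof induction
  case empty
  show ?case using S by blast
next
  case (insert w W)
  then obtain S1 where S1: "S1 \<in> \<B>" "S1 \<subseteq> S"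
      "\<And>w y z. w \<in> W \<Longrightarrow> y \<in> S1 \<Longrightarrow> z \<in> S1 \<Longrightarrow> \<bar>blinfun_apply w y - blinfun_apply w z\<bar> \<le> \<eta>"
    by blast
  have "blinfun_apply w z \<le> norm w * C" if "z \<in> S1" for z
    using blinfun_apply_le[of w z] mult_left_mono[OF bd[OF S1(1) that], of "norm w"] by simp
  then have bdd: "bdd_above (blinfun_apply w ` S1)" by (intro bdd_aboveI2)
  define m where "m = Sup (blinfun_apply w ` S1)"
  have le_m: "blinfun_apply w z \<le> m" if "z \<in> S1" for z
    unfolding m_def using bdd that by (intro cSup_upper) auto
  have "m - \<eta> < m" using \<eta> by simp
  then obtain z where z: "z \<in> S1" "m - \<eta> < blinfun_apply w z"
    using less_cSup_iff[OF _ bdd, of "m - \<eta>"] ne[OF S1(1)] by (auto simp: m_def)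
  from slice[OF S1(1) z] obtain S2 where S2: "S2 \<in> \<B>" "S2 \<subseteq> S1"
      "\<And>y. y \<in> S2 \<Longrightarrow> m - \<eta> \<le> blinfun_apply w y" by blast
  have "\<bar>blinfun_apply w y - blinfun_apply w z\<bar> \<le> \<eta>" if "y \<in> S2" "z \<in> S2" for y z
  proof -
    have "y \<in> S1" "z \<in> S1" using that S2(2) by auto
    then show ?thesis
      using le_m[of y] le_m[of z] S2(3)[OF that(1)] S2(3)[OF that(2)] by linarith
  qed
  then show ?case using S1 S2 by (intro bexI[of _ S2]) blast+
qed

text \<open>Slicing by norming functionals makes the suprema of the norm converge along a decreasing
  sequence of members, so at a weak cluster point the Kadec property applies.\<close>

lemma slice_refine_small:
  fixes \<B> :: "'a::real_normed_vector set set"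
  assumes refl: "reflexive_space TYPE('a)" and kadec: "\<And>x :: 'a. kadec_at x"
    and ne: "\<And>S. S \<in> \<B> \<Longrightarrow> S \<noteq> {}" and bd: "\<And>S z. S \<in> \<B> \<Longrightarrow> z \<in> S \<Longrightarrow> norm z \<le> C"
    and slice: "\<And>S z (f :: 'a \<Rightarrow>\<^sub>L real) a. S \<in> \<B> \<Longrightarrow> z \<in> S \<Longrightarrow> a < blinfun_apply f z \<Longrightarrow>
      \<exists>S'\<in>\<B>. S' \<subseteq> S \<and> (\<forall>y\<in>S'. a \<le> blinfun_apply f y)"
    and S: "S \<in> \<B>" and e: "0 < e"
  obtains S' x where "S' \<in> \<B>" "S' \<subseteq> S" "\<And>y. y \<in> S' \<Longrightarrow> norm (y - x) \<le> e"
proof -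
  define N where "N S = Sup (norm ` S)" for S :: "'a set"
  have bdd: "bdd_above (norm ` S)" if "S \<in> \<B>" for S using bd[OF that] by (intro bdd_aboveI2)
  have le_N: "norm z \<le> N S" if "S \<in> \<B>" "z \<in> S" for S z
    unfolding N_def using bdd that by (intro cSup_upper) auto
  \<comment> \<open>The functional norms a point of almost maximal norm in \<open>S1\<close>, so the
    slice keeps only points whose norm is nearly the supremum over \<open>S1\<close>.\<close>
  define Q where "Q n S1 S2 \<longleftrightarrow> S2 \<subseteq> S1 \<and> (\<exists>f :: 'a \<Rightarrow>\<^sub>L real. norm f \<le> 1 \<and>
      (\<forall>y\<in>S2. N S1 - 1 / real (Suc n) \<le> blinfun_apply f y))" for n S1 S2
  have "\<exists>T. \<forall>n. (T n \<in> \<B> \<and> T n \<subseteq> S) \<and> Q n (T n) (T (Suc n))"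
  proof (rule dependent_nat_choice)
    show "\<exists>S'. S' \<in> \<B> \<and> S' \<subseteq> S" using S by blast
    fix S1 and n :: nat assume S1: "S1 \<in> \<B> \<and> S1 \<subseteq> S"
    have "N S1 - 1 / real (Suc n) < Sup (norm ` S1)" by (simp add: N_def)
    then obtain z where z: "z \<in> S1" "N S1 - 1 / real (Suc n) < norm z"
      using less_cSup_iff[OF _ bdd[of S1], of "N S1 - 1 / real (Suc n)"] S1 ne[of S1] by auto
    obtain f :: "'a \<Rightarrow>\<^sub>L real" where f: "norm f \<le> 1" "blinfun_apply f z = norm z"
      by (rule norming_functional)
    obtain S2 where "S2 \<in> \<B>" "S2 \<subseteq> S1" "\<forall>y\<in>S2. N S1 - 1 / real (Suc n) \<le> blinfun_apply f y"
      using slice[of S1 z "N S1 - 1 / real (Suc n)" f] S1 z f(2) by auto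
    then show "\<exists>S2. (S2 \<in> \<B> \<and> S2 \<subseteq> S) \<and> Q n S1 S2"
      unfolding Q_def using S1 f(1) by (intro exI[of _ S2]) blast
  qed
  then obtain T where T: "\<And>n. T n \<in> \<B>" "\<And>n. T n \<subseteq> S" "\<And>n. Q n (T n) (T (Suc n))" by blast
  have anti: "T n \<subseteq> T m" if "m \<le> n" for m n
    by (rule lift_Suc_antimono_le[OF _ that]) (use T(3) in \<open>auto simp: Q_def\<close>)
  have "\<exists>f :: 'a \<Rightarrow>\<^sub>L real. norm f \<le> 1 \<and> (\<forall>y\<in>T (Suc n). N (T n) - 1 / real (Suc n) \<le> blinfun_apply f y)" for n
    using T(3)[of n] unfolding Q_def by blast
  then obtain f :: "nat \<Rightarrow> 'a \<Rightarrow>\<^sub>L real" where f: "\<And>n. norm (f n) \<le> 1"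
      "\<And>n y. y \<in> T (Suc n) \<Longrightarrow> N (T n) - 1 / real (Suc n) \<le> blinfun_apply (f n) y"
    by metis
  have "\<exists>S'\<in>\<B>. S' \<subseteq> T n \<and> (\<forall>w\<in>W. \<forall>y\<in>S'. \<forall>z\<in>S'. \<bar>blinfun_apply w y - blinfun_apply w z\<bar> \<le> 1 / real (Suc n))"
    if "finite W" for W :: "('a \<Rightarrow>\<^sub>L real) set" and n
    by (rule slice_refine_oscillation[OF ne bd slice T(1) that]) auto
  then obtain R where R: "\<And>W n. finite W \<Longrightarrow> R W n \<in> \<B>" "\<And>W n. finite W \<Longrightarrow> R W n \<subseteq> T n"
      "\<And>W n w y z. finite W \<Longrightarrow> w \<in> W \<Longrightarrow> y \<in> R W n \<Longrightarrow> z \<in> R W n \<Longrightarrow>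
        \<bar>blinfun_apply w y - blinfun_apply w z\<bar> \<le> 1 / real (Suc n)"
    by metis
  define z where "z i = (SOME z. z \<in> R (fst i) (snd i))" for i :: "('a \<Rightarrow>\<^sub>L real) set \<times> nat"
  have z: "z i \<in> R (fst i) (snd i)" if "finite (fst i)" for i
    unfolding z_def using ne[OF R(1)[OF that]] by (simp add: some_in_eq)
  \<comment> \<open>Larger finite \<open>W\<close> and larger \<open>n\<close> direct the choice of
    points from \<open>R W n\<close>; along this net each functional is eventually tested and each
    \<open>T n\<close> eventually entered.\<close>
  define F where "F = finite_subsets_at_top (UNIV :: ('a \<Rightarrow>\<^sub>L real) set) \<times>\<^sub>F sequentially"
  have "F \<noteq> bot" by (simp add: F_def prod_filter_eq_bot)
  then obtain U where U: "U \<le> F" "ultrafilter U" by (rule ex_ultrafilter)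
  have nb: "U \<noteq> bot" using U(2) by (simp add: ultrafilter_def)
  have ev: "eventually (\<lambda>i. finite (fst i) \<and> W \<subseteq> fst i \<and> n \<le> snd i) U" if "finite W" for W n
  proof (rule filter_leD[OF U(1)])
    have "eventually (\<lambda>V. finite V \<and> W \<subseteq> V) (finite_subsets_at_top UNIV)"
      unfolding eventually_finite_subsets_at_top using that by (intro exI[of _ W]) auto
    from eventually_prodI[OF this eventually_ge_at_top[of n]]
    show "eventually (\<lambda>i. finite (fst i) \<and> W \<subseteq> fst i \<and> n \<le> snd i) F"
      unfolding F_def by eventually_elim auto
  qed
  have "eventually (\<lambda>i. norm (z i) \<le> C) U"
    using ev[OF finite.emptyI, of 0] by eventually_elim (use z bd R(1) in blast)
  then obtain x where x: "\<And>w :: 'a \<Rightarrow>\<^sub>L real. ((\<lambda>i. blinfun_apply w (z i)) \<longlongrightarrow> blinfun_apply w x) U"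
    using reflexive_weak_limit[OF refl U(2)] by metis
  \<comment> \<open>The slicing functional \<open>f n\<close> is eventually large along the net, so
    it is large at the weak limit: \<open>x\<close> has almost the largest norm occurring in
    \<open>T n\<close>.\<close>
  have Nx: "N (T n) \<le> norm x + 1 / real (Suc n)" for n
  proof -
    have "eventually (\<lambda>i. N (T n) - 1 / real (Suc n) \<le> blinfun_apply (f n) (z i)) U"
      using ev[OF finite.emptyI, of "Suc n"]
      by eventually_elim (use z R(2) anti f(2) in blast)
    then have "N (T n) - 1 / real (Suc n) \<le> blinfun_apply (f n) x"
      by (rule tendsto_lowerbound[OF x _ nb])
    then show ?thesis using blinfun_apply_le_1[OF f(1)[of n], of x] by simp
  qed
  obtain W \<eta> where W: "finite W" "0 < \<eta>"
      "\<And>z. (\<forall>w\<in>W. \<bar>blinfun_apply w (z - x)\<bar> \<le> \<eta>) \<Longrightarrow> norm z \<le> norm x + \<eta> \<Longrightarrow> norm (z - x) \<le> e"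
    using kadec[of x] e unfolding kadec_at_def by meson
  \<comment> \<open>Half of \<open>\<eta>\<close> covers the distance from \<open>z i\<close> to
    \<open>x\<close> on \<open>W\<close>, the other half the oscillation of \<open>W\<close> over
    the chosen member.\<close>
  obtain n where n: "1 / real (Suc n) < \<eta> / 2"
    using W(2) by (metis nat_approx_posE half_gt_zero)
  have "eventually (\<lambda>i. \<bar>blinfun_apply w (z i) - blinfun_apply w x\<bar> < \<eta> / 2) U" for w
    using tendstoD[OF x, of "\<eta> / 2" w] W(2) by (simp add: dist_real_def)
  then have "eventually (\<lambda>i. \<forall>w\<in>W. \<bar>blinfun_apply w (z i) - blinfun_apply w x\<bar> < \<eta> / 2) U"
    by (intro eventually_ball_finite W(1)) blast
  from eventually_happens'[OF nb eventually_conj[OF this ev[OF W(1), of n]]]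
  obtain i where i: "\<And>w. w \<in> W \<Longrightarrow> \<bar>blinfun_apply w (z i) - blinfun_apply w x\<bar> < \<eta> / 2"
      "finite (fst i)" "W \<subseteq> fst i" "n \<le> snd i" by blast
  show ?thesis
  proof (rule that[of "R (fst i) (snd i)" x])
    show "R (fst i) (snd i) \<in> \<B>" by (rule R(1)[OF i(2)])
    show "R (fst i) (snd i) \<subseteq> S" using R(2)[OF i(2)] T(2) by blast
    fix y assume y: "y \<in> R (fst i) (snd i)"
    show "norm (y - x) \<le> e"
    proof (rule W(3))
      have "1 / real (Suc (snd i)) \<le> 1 / real (Suc n)" using i(4) by (intro divide_left_mono) auto
      then have *: "1 / real (Suc (snd i)) < \<eta> / 2" using n by linarith
      show "\<forall>w\<in>W. \<bar>blinfun_apply w (y - x)\<bar> \<le> \<eta>"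
      proof
        fix w assume w: "w \<in> W"
        have "\<bar>blinfun_apply w y - blinfun_apply w (z i)\<bar> \<le> 1 / real (Suc (snd i))"
          using R(3)[OF i(2) _ y z[OF i(2)]] w i(3) by blast
        then show "\<bar>blinfun_apply w (y - x)\<bar> \<le> \<eta>"
          using i(1)[OF w] * unfolding blinfun.diff_right by linarith
      qed
      have "y \<in> T n" using y R(2)[OF i(2)] anti[OF i(4)] by blast
      then have "norm y \<le> N (T n)" by (rule le_N[OF T(1)])
      then show "norm y \<le> norm x + \<eta>" using Nx[of n] n W(2) by linarith
    qed
  qed
qed

section \<open>The point of continuity property\<close>

text \<open>Finite sets \<open>W\<close> give a base of the weak topology, and inserting a pair into
  \<open>W\<close> is exactly a slice.\<close>

definition open_polyhedron :: "(('a::real_normed_vector \<Rightarrow>\<^sub>L real) \<times> real) set \<Rightarrow> 'a set" where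
  "open_polyhedron W = {z. \<forall>(w, a)\<in>W. a < blinfun_apply w z}"

lemma openin_weak_open_polyhedron:
  assumes "finite W"
  shows "openin weak_topology (open_polyhedron W)"
  using assms
proof induction
  case empty
  have "openin weak_topology (topspace weak_topology :: 'a set)" by (rule openin_topspace)
  then show ?case by (simp add: open_polyhedron_def weak_topology_def topspace_pullback_topology)
next
  case (insert p W)
  obtain w :: "'a \<Rightarrow>\<^sub>L real" and a where p: "p = (w, a)" by (cases p)
  have "open {g :: ('a \<Rightarrow>\<^sub>L real) \<Rightarrow> real. a < g w}"
    by (intro open_Collect_less continuous_on_const continuous_on_product_coordinates)
  then have "openin weak_topology {z. a < blinfun_apply w z}"
    unfolding weak_topology_def openin_pullback_topology
    by (intro exI[of _ "{g. a < g w}"]) auto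
  moreover have "open_polyhedron (insert p W) = {z. a < blinfun_apply w z} \<inter> open_polyhedron W"
    by (auto simp: open_polyhedron_def p)
  ultimately show ?case using insert.IH by (simp add: openin_Int)
qed

text \<open>Moving each threshold halfway towards the value at \<open>p\<close> leaves
  \<open>p\<close> strictly inside and makes room for the closure.\<close>

lemma open_polyhedron_shrink:
  fixes p :: "'a::real_normed_vector"
  assumes "finite W" "p \<in> open_polyhedron W"
  obtains W' where "finite W'" "p \<in> open_polyhedron W'" "closure (open_polyhedron W') \<subseteq> open_polyhedron W"
proof (rule that[of "(\<lambda>(w, a). (w, (a + blinfun_apply w p) / 2)) ` W"])
  let ?W = "(\<lambda>(w, a). (w, (a + blinfun_apply w p) / 2)) ` W"
  show "finite ?W" using assms(1) by simp
  show "p \<in> open_polyhedron ?W" using assms(2) by (auto simp: open_polyhedron_def)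
  let ?D = "\<Inter>(w, a)\<in>W. {z. (a + blinfun_apply w p) / 2 \<le> blinfun_apply w z}"
  have "closed ?D"
    by (intro closed_INT ballI) (auto split: prod.splits intro!: closed_Collect_le continuous_intros)
  moreover have "open_polyhedron ?W \<subseteq> ?D" by (force simp: open_polyhedron_def)
  ultimately have "closure (open_polyhedron ?W) \<subseteq> ?D" by (rule closure_minimal[rotated])
  also have "?D \<subseteq> open_polyhedron W" using assms(2) by (force simp: open_polyhedron_def)
  finally show "closure (open_polyhedron ?W) \<subseteq> open_polyhedron W" .
qed

text \<open>A nested sequence of weakly open pieces of \<open>K\<close> with diameters tending to 0
  shrinks to a point \<open>x\<close>. Requiring the closure of each polyhedron to lie in the
  previous one keeps \<open>x\<close> inside all of them, so they are weak neighbourhoods of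
  \<open>x\<close> with small trace on \<open>K\<close>.\<close>

lemma kadec_reflexive_imp_PCP:
  assumes refl: "reflexive_space TYPE('a::banach)" and kadec: "\<And>x :: 'a. kadec_at x"
  shows "point_of_continuity_property TYPE('a)"
  unfolding point_of_continuity_property_def
proof (intro allI impI)
  fix K :: "'a set" assume K: "K \<noteq> {}" "closed K" "K \<subseteq> cball 0 1"
  define \<B> where "\<B> = {K \<inter> open_polyhedron W |W. finite W \<and> K \<inter> open_polyhedron W \<noteq> {}}"
  have small: "\<exists>W' c. finite W' \<and> K \<inter> open_polyhedron W' \<noteq> {} \<and>
      K \<inter> open_polyhedron W' \<subseteq> K \<inter> open_polyhedron W \<and> (\<forall>y\<in>K \<inter> open_polyhedron W'. norm (y - c) \<le> e)"
    if W: "finite W" "K \<inter> open_polyhedron W \<noteq> {}" and e: "0 < e" for W e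
  proof -
    have "K \<inter> open_polyhedron W \<in> \<B>" using W by (auto simp: \<B>_def)
    then obtain S' c where "S' \<in> \<B>" "S' \<subseteq> K \<inter> open_polyhedron W" "\<And>y. y \<in> S' \<Longrightarrow> norm (y - c) \<le> e"
    proof (rule slice_refine_small[OF refl kadec, rotated 3, OF _ e])
      show "S \<noteq> {}" if "S \<in> \<B>" for S using that by (auto simp: \<B>_def)
      show "norm z \<le> 1" if "S \<in> \<B>" "z \<in> S" for S z using that K(3) by (auto simp: \<B>_def)
      fix S z a and f :: "'a \<Rightarrow>\<^sub>L real" assume "S \<in> \<B>" "z \<in> S" "a < blinfun_apply f z"
      then obtain V where V: "S = K \<inter> open_polyhedron V" "finite V" by (auto simp: \<B>_def)
      have "z \<in> K \<inter> open_polyhedron (insert (f, a) V)"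
        using \<open>z \<in> S\<close> \<open>a < blinfun_apply f z\<close> V by (auto simp: open_polyhedron_def)
      then have "K \<inter> open_polyhedron (insert (f, a) V) \<in> \<B>" using V(2) by (auto simp: \<B>_def)
      moreover have "K \<inter> open_polyhedron (insert (f, a) V) \<subseteq> S"
        "\<forall>y\<in>K \<inter> open_polyhedron (insert (f, a) V). a \<le> blinfun_apply f y"
        by (auto simp: V(1) open_polyhedron_def)
      ultimately show "\<exists>S'\<in>\<B>. S' \<subseteq> S \<and> (\<forall>y\<in>S'. a \<le> blinfun_apply f y)" by blast
    qed blast
    then show ?thesis unfolding \<B>_def by blast
  qed
  define Q where "Q n W W' \<longleftrightarrow> closure (open_polyhedron W') \<subseteq> open_polyhedron W \<and>
      (\<exists>c. \<forall>y\<in>K \<inter> open_polyhedron W'. norm (y - c) \<le> 1 / real (Suc n))"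
    for n :: nat and W W' :: "(('a \<Rightarrow>\<^sub>L real) \<times> real) set"
  have "\<exists>W. \<forall>n. (finite (W n) \<and> K \<inter> open_polyhedron (W n) \<noteq> {}) \<and> Q n (W n) (W (Suc n))"
  proof (rule dependent_nat_choice)
    show "\<exists>W. finite W \<and> K \<inter> open_polyhedron W \<noteq> {}"
      using K(1) by (intro exI[of _ "{}"]) (auto simp: open_polyhedron_def)
    fix W and n :: nat assume W: "finite W \<and> K \<inter> open_polyhedron W \<noteq> {}"
    have "0 < 1 / real (Suc n)" by simp
    from small[OF conjunct1[OF W] conjunct2[OF W] this]
    obtain W1 c where W1: "finite W1" "K \<inter> open_polyhedron W1 \<noteq> {}"
        "K \<inter> open_polyhedron W1 \<subseteq> K \<inter> open_polyhedron W"
        "\<And>y. y \<in> K \<inter> open_polyhedron W1 \<Longrightarrow> norm (y - c) \<le> 1 / real (Suc n)" by blast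
    then obtain p where p: "p \<in> K" "p \<in> open_polyhedron W1" by blast
    \<comment> \<open>The smaller piece lies in the polyhedron of \<open>W\<close> only within
      \<open>K\<close>. Adding the constraints of \<open>W\<close> makes the inclusion hold in the
      whole space, as the closure condition demands.\<close>
    have un: "open_polyhedron (W1 \<union> W) = open_polyhedron W1 \<inter> open_polyhedron W"
      by (auto simp: open_polyhedron_def)
    have "finite (W1 \<union> W)" "p \<in> open_polyhedron (W1 \<union> W)" using W W1 p by (auto simp: un)
    then obtain W' where W': "finite W'" "p \<in> open_polyhedron W'"
        "closure (open_polyhedron W') \<subseteq> open_polyhedron (W1 \<union> W)"
      by (rule open_polyhedron_shrink)
    then have "open_polyhedron W' \<subseteq> open_polyhedron W1" using closure_subset un by blast
    then have "Q n W W'"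
      unfolding Q_def using W'(3) W1(4) un by blast
    then show "\<exists>W'. (finite W' \<and> K \<inter> open_polyhedron W' \<noteq> {}) \<and> Q n W W'"
      using W' p by blast
  qed
  then obtain W where W: "\<And>n. finite (W n)" "\<And>n. K \<inter> open_polyhedron (W n) \<noteq> {}"
      "\<And>n. Q n (W n) (W (Suc n))" by blast
  have cl: "closure (open_polyhedron (W (Suc n))) \<subseteq> open_polyhedron (W n)" for n
    using W(3)[of n] by (simp add: Q_def)
  have anti: "open_polyhedron (W n) \<subseteq> open_polyhedron (W m)" if "m \<le> n" for m n
    by (rule lift_Suc_antimono_le[OF _ that]) (use cl closure_subset in blast)
  have diam: "norm (y - z) \<le> 2 / real (Suc n)"
    if "y \<in> K \<inter> open_polyhedron (W (Suc n))" "z \<in> K \<inter> open_polyhedron (W (Suc n))" for y z n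
  proof -
    obtain c where c: "\<And>y. y \<in> K \<inter> open_polyhedron (W (Suc n)) \<Longrightarrow> norm (y - c) \<le> 1 / real (Suc n)"
      using W(3)[of n] unfolding Q_def by blast
    have "norm (y - z) \<le> norm (y - c) + norm (z - c)"
      using norm_triangle_ineq4[of "y - c" "z - c"] by simp
    then show ?thesis using c[OF that(1)] c[OF that(2)] by simp
  qed
  have "\<exists>p. \<forall>n. p n \<in> K \<inter> open_polyhedron (W n)" using W(2) by (intro choice) blast
  then obtain p where p: "\<And>n. p n \<in> K \<inter> open_polyhedron (W n)" by blast
  have small_n: "\<exists>n. 2 / real (Suc n) < e" if "0 < e" for e :: real
    using nat_approx_posE[of "e / 2"] that by (metis half_gt_zero less_divide_eq_numeral1(1) mult.commute times_divide_eq_right mult_1 mult_numeral_1_right)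
  have "Cauchy p"
  proof (rule metric_CauchyI)
    fix e :: real assume "0 < e"
    then obtain n where n: "2 / real (Suc n) < e" using small_n by blast
    have "dist (p k) (p m) < e" if "Suc n \<le> k" "Suc n \<le> m" for k m
      using diam[of "p k" n "p m"] p[of k] p[of m] anti[OF that(1)] anti[OF that(2)] n
      by (force simp: dist_norm)
    then show "\<exists>N. \<forall>m\<ge>N. \<forall>k\<ge>N. dist (p m) (p k) < e" by blast
  qed
  then obtain x where x: "p \<longlonglongrightarrow> x" using Cauchy_convergent convergent_def by blast
  have xK: "x \<in> K"
    using closed_sequentially[OF K(2) _ x] p by blast
  have xW: "x \<in> open_polyhedron (W n)" for n
  proof -
    have "x \<in> closure (open_polyhedron (W (Suc n)))"
    proof (rule closed_sequentially[OF closed_closure])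
      show "(\<lambda>k. p (k + Suc n)) \<longlonglongrightarrow> x" by (rule LIMSEQ_ignore_initial_segment[OF x])
      show "p (k + Suc n) \<in> closure (open_polyhedron (W (Suc n)))" for k
        using p[of "k + Suc n"] anti[of "Suc n" "k + Suc n"] closure_subset by fastforce
    qed
    then show ?thesis using cl by blast
  qed
  show "\<exists>x\<in>K. topcontinuous_at (subtopology weak_topology K) euclidean (\<lambda>y. y) x"
  proof (intro bexI[OF _ xK])
    have ts: "topspace (subtopology weak_topology K) = K"
      by (simp add: weak_topology_def topspace_pullback_topology)
    show "topcontinuous_at (subtopology weak_topology K) euclidean (\<lambda>y. y) x"
      unfolding topcontinuous_at_def ts
    proof (intro conjI allI impI xK)
      fix V assume "openin euclidean V \<and> x \<in> V"
      then obtain e where e: "0 < e" "ball x e \<subseteq> V" by (meson open_contains_ball open_openin)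
      then obtain n where n: "2 / real (Suc n) < e" using small_n by blast
      have "openin (subtopology weak_topology K) (open_polyhedron (W (Suc n)) \<inter> K)"
        unfolding openin_subtopology using openin_weak_open_polyhedron[OF W(1)] by blast
      moreover have "y \<in> V" if "y \<in> open_polyhedron (W (Suc n)) \<inter> K" for y
        using diam[of x n y] that xK xW n e(2) by (force simp: dist_norm)
      ultimately show "\<exists>U. openin (subtopology weak_topology K) U \<and> x \<in> U \<and> (\<forall>y\<in>U. y \<in> V)"
        using xK xW by blast
    qed auto
  qed
qed

subsection \<open>Vector measures\<close>

text \<open>An exhaustion: each step picks, among the sets disjoint from those chosen, one of more
  than half the supremal measure, or the empty set if none is left. A set missed by all choices
  would keep the chosen measures above half its own, but disjoint sets have summable
  measures.\<close>

lemma (in finite_measure) greedy_disjoint_family: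
  assumes P: "\<And>A. A \<in> \<P> \<Longrightarrow> A \<in> sets M" "\<And>A. A \<in> \<P> \<Longrightarrow> 0 < measure M A"
  obtains D :: "nat \<Rightarrow> 'a set" where "disjoint_family D" "\<And>n. D n = {} \<or> D n \<in> \<P>"
    "\<And>A. A \<in> \<P> \<Longrightarrow> A \<inter> (\<Union>n. D n) \<noteq> {}"
proof -
  define \<Q> where "\<Q> U = {A \<in> \<P>. A \<inter> U = {}}" for U
  define S where "S U = Sup (measure M ` \<Q> U)" for U
  have bdd: "bdd_above (measure M ` \<Q> U)" for U
    by (rule bdd_aboveI2[of _ _ "measure M (space M)"]) (rule bounded_measure)
  define R where "R (n :: nat) = (\<lambda>(U, _ :: 'a set) (U', A'). U' = U \<union> A' \<and>
      (if \<Q> U = {} then A' = {} else A' \<in> \<Q> U \<and> S U / 2 < measure M A'))" for n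
  have "\<exists>f. \<forall>n. (n = 0 \<longrightarrow> fst (f n) = {}) \<and> R n (f n) (f (Suc n))"
  proof (rule dependent_nat_choice)
    fix p :: "'a set \<times> 'a set" and n :: nat
    obtain U A where p: "p = (U, A)" by (cases p)
    show "\<exists>q. (Suc n = 0 \<longrightarrow> fst q = {}) \<and> R n p q"
    proof (cases "\<Q> U = {}")
      case True
      then show ?thesis by (auto simp: R_def p)
    next
      case False
      then obtain B where B: "B \<in> \<Q> U" by blast
      then have "measure M B \<le> S U" unfolding S_def using bdd by (intro cSup_upper) auto
      moreover have "0 < measure M B" using B P by (auto simp: \<Q>_def)
      ultimately have "S U / 2 < S U" by simp
      then have "\<exists>A'\<in>\<Q> U. S U / 2 < measure M A'"
        using less_cSup_iff[OF _ bdd[of U], of "S U / 2"] False by (auto simp: S_def)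
      then show ?thesis using False by (auto simp: R_def p)
    qed
  qed (auto intro: exI[of _ "({}, {})"])
  then obtain f where f0: "fst (f 0) = {}" and f: "\<And>n. R n (f n) (f (Suc n))" by blast
  define U where "U n = fst (f n)" for n
  define D where "D n = snd (f (Suc n))" for n
  have US: "U (Suc n) = U n \<union> D n" for n
    using f[of n] by (auto simp: R_def U_def D_def split: prod.splits)
  have D: "D n = {}" if "\<Q> (U n) = {}" for n
    using f[of n] that by (auto simp: R_def U_def D_def split: prod.splits if_splits)
  have D': "D n \<in> \<Q> (U n)" "S (U n) / 2 < measure M (D n)" if "\<Q> (U n) \<noteq> {}" for n
    using f[of n] that by (auto simp: R_def U_def D_def split: prod.splits if_splits)
  have Umono: "U m \<subseteq> U n" if "m \<le> n" for m n
    by (rule lift_Suc_mono_le[OF _ that]) (simp add: US)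
  have DU: "D n \<inter> U n = {}" for n
    using D[of n] D'(1)[of n] by (cases "\<Q> (U n) = {}") (auto simp: \<Q>_def)
  have disj: "disjoint_family D"
  proof -
    have "D m \<inter> D n = {}" if "m < n" for m n
      using US[of m] Umono[of "Suc m" n] DU[of n] that by auto
    then have "D m \<inter> D n = {}" if "m \<noteq> n" for m n
      using that by (metis Int_commute nat_neq_iff)
    then show ?thesis by (auto simp: disjoint_family_on_def)
  qed
  have DP: "D n = {} \<or> D n \<in> \<P>" for n
    using D[of n] D'(1)[of n] by (auto simp: \<Q>_def)
  show ?thesis
  proof (rule that[OF disj DP])
    fix A assume A: "A \<in> \<P>"
    show "A \<inter> (\<Union>n. D n) \<noteq> {}"
    proof
      assume e: "A \<inter> (\<Union>n. D n) = {}"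
      have "U n \<subseteq> (\<Union>n. D n)" for n
        by (induction n) (use f0 in \<open>auto simp: US\<close>, simp add: U_def)
      then have AQ: "A \<in> \<Q> (U n)" for n using A e by (auto simp: \<Q>_def)
      have "measure M A / 2 < measure M (D n)" for n
      proof -
        have "measure M A \<le> S (U n)" unfolding S_def using AQ[of n] bdd by (intro cSup_upper) auto
        moreover have "\<Q> (U n) \<noteq> {}" using AQ[of n] by blast
        ultimately show ?thesis using D'(2)[of n] by linarith
      qed
      moreover have "range D \<subseteq> sets M" using DP P(1) sets.empty_sets by (metis image_subsetI)
      then have "(\<lambda>n. measure M (D n)) \<longlonglongrightarrow> 0"
        using finite_measure_UNION[OF _ disj] by (intro summable_LIMSEQ_zero) (auto intro: sums_summable)
      then have "eventually (\<lambda>n. measure M (D n) < measure M A / 2) sequentially"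
        using P(2)[OF A] by (intro order_tendstoD(2)) auto
      then obtain n where "measure M (D n) < measure M A / 2" by (auto simp: eventually_sequentially)
      ultimately show False by (meson less_asym)
    qed
  qed
qed

locale ac_vector_measure = finite_measure M for M :: "'w measure" +
  fixes G :: "'w set \<Rightarrow> 'a::real_normed_vector"
  assumes vector: "vector_measure M G" and null: "\<And>E. E \<in> null_sets M \<Longrightarrow> G E = 0"
begin

lemma G_sums: "range A \<subseteq> sets M \<Longrightarrow> disjoint_family A \<Longrightarrow> (\<lambda>i. G (A i)) sums G (\<Union>i. A i)"
  using vector unfolding vector_measure_def by blast

lemma G_measure_0: "E \<in> sets M \<Longrightarrow> measure M E = 0 \<Longrightarrow> G E = 0"
  by (rule null) (simp add: null_sets_def emeasure_eq_measure)

lemma G_empty [simp]: "G {} = 0"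
  by (rule G_measure_0) auto

lemma G_Un:
  assumes "E \<in> sets M" "F \<in> sets M" "E \<inter> F = {}"
  shows "G (E \<union> F) = G E + G F"
proof -
  have "(\<lambda>n. G (binaryset E F n)) sums G (\<Union>n. binaryset E F n)"
    using assms by (intro G_sums) (auto simp: range_binaryset_eq disjoint_family_on_def binaryset_def)
  then have "(\<lambda>n. G (binaryset E F n)) sums G (E \<union> F)" by (simp add: UN_binaryset_eq)
  moreover have "(\<lambda>n. G (binaryset E F n)) sums (G E + G F)" by (rule binaryset_sums) simp
  ultimately show ?thesis by (rule sums_unique2)
qed

lemma Int_sums:
  assumes D: "\<And>n :: nat. D n \<in> sets M" "disjoint_family D" and E: "E \<in> sets M"
    and rest: "measure M (E - (\<Union>n. D n)) = 0"
  shows "(\<lambda>n. G (E \<inter> D n)) sums G E" "(\<lambda>n. measure M (E \<inter> D n)) sums measure M E"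
proof -
  define U where "U = (\<Union>n. D n)"
  have U: "U \<in> sets M" using D(1) by (auto simp: U_def)
  have eq: "(\<Union>n. E \<inter> D n) = E \<inter> U" by (auto simp: U_def)
  have "range (\<lambda>n. E \<inter> D n) \<subseteq> sets M" "disjoint_family (\<lambda>n. E \<inter> D n)"
    using D E by (auto simp: disjoint_family_on_def)
  note s = G_sums[OF this, unfolded eq] finite_measure_UNION[OF this, unfolded eq]
  have sp: "(E \<inter> U) \<union> (E - U) = E" "(E \<inter> U) \<inter> (E - U) = {}" by auto
  have sets: "E \<inter> U \<in> sets M" "E - U \<in> sets M" using E U by auto
  have 0: "measure M (E - U) = 0" using rest by (simp add: U_def)
  have "G E = G (E \<inter> U)"
    using G_Un[OF sets sp(2)] G_measure_0[OF sets(2) 0] by (simp add: sp(1))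
  with s(1) show "(\<lambda>n. G (E \<inter> D n)) sums G E" by simp
  have "measure M E = measure M (E \<inter> U)"
    using finite_measure_Union[OF sets sp(2)] 0 by (simp add: sp(1))
  with s(2) show "(\<lambda>n. measure M (E \<inter> D n)) sums measure M E" by simp
qed

text \<open>Remove a maximal disjoint family of sets that violate the desired inequality. If only a
  null set remained, summing over the family would give the opposite of \<open>less\<close>.\<close>

lemma slice_set:
  fixes f :: "'a \<Rightarrow>\<^sub>L real"
  assumes F: "F \<in> sets M" and less: "\<alpha> * measure M F < blinfun_apply f (G F)"
  obtains B where "B \<in> sets M" "B \<subseteq> F" "0 < measure M B"
    "\<And>E. E \<in> sets M \<Longrightarrow> E \<subseteq> B \<Longrightarrow> \<alpha> * measure M E \<le> blinfun_apply f (G E)"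
proof -
  define \<P> where "\<P> = {E \<in> sets M. E \<subseteq> F \<and> blinfun_apply f (G E) < \<alpha> * measure M E}"
  have pos: "0 < measure M E" if "E \<in> \<P>" for E
  proof (rule ccontr)
    assume "\<not> ?thesis"
    then have "measure M E = 0" using measure_nonneg[of M E] by linarith
    then show False using that G_measure_0[of E] by (auto simp: \<P>_def)
  qed
  obtain D :: "nat \<Rightarrow> 'w set" where D: "disjoint_family D" "\<And>n. D n = {} \<or> D n \<in> \<P>"
    "\<And>A. A \<in> \<P> \<Longrightarrow> A \<inter> (\<Union>n. D n) \<noteq> {}"
    by (rule greedy_disjoint_family[of \<P>]) (use pos in \<open>auto simp: \<P>_def\<close>)
  have Ds: "D n \<in> sets M" "D n \<subseteq> F" "blinfun_apply f (G (D n)) \<le> \<alpha> * measure M (D n)" for n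
    using D(2)[of n] by (auto simp: \<P>_def)
  have FD: "F \<inter> D n = D n" for n using Ds(2)[of n] by auto
  define B where "B = F - (\<Union>n. D n)"
  have B: "B \<in> sets M" using F Ds(1) by (auto simp: B_def)
  have "measure M B \<noteq> 0"
  proof
    assume "measure M B = 0"
    then have s: "(\<lambda>n. G (D n)) sums G F" "(\<lambda>n. measure M (D n)) sums measure M F"
      using Int_sums[of D F] Ds(1) D(1) F FD by (simp_all add: B_def)
    have "(\<lambda>n. blinfun_apply f (G (D n))) sums blinfun_apply f (G F)"
      by (rule bounded_linear.sums[OF blinfun.bounded_linear_right s(1)])
    moreover have "(\<lambda>n. \<alpha> * measure M (D n)) sums (\<alpha> * measure M F)" by (rule sums_mult[OF s(2)])
    ultimately have "blinfun_apply f (G F) \<le> \<alpha> * measure M F" by (rule sums_le[OF Ds(3)])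
    with less show False by simp
  qed
  then have "0 < measure M B" using measure_nonneg[of M B] by linarith
  moreover have "\<alpha> * measure M E \<le> blinfun_apply f (G E)" if "E \<in> sets M" "E \<subseteq> B" for E
  proof (rule ccontr)
    assume "\<not> ?thesis"
    then have "E \<in> \<P>" using that by (auto simp: \<P>_def B_def)
    from D(3)[OF this] that(2) show False by (auto simp: B_def)
  qed
  ultimately show ?thesis using B by (intro that) (auto simp: B_def)
qed

text \<open>The variation is bounded over finite partitions, which exclude the empty set; the
  remainder of the space is added and empty members are dropped. Equal members of a disjoint family
  are empty, so no term is lost.\<close>

lemma variation_sum_le:
  assumes C: "\<forall>P. finite P \<longrightarrow> P \<subseteq> sets M \<longrightarrow> partition_on (space M) P \<longrightarrow> (\<Sum>E\<in>P. norm (G E)) \<le> C"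
    and D: "\<And>n :: nat. D n \<in> sets M" "disjoint_family D"
  shows "(\<Sum>n<N. norm (G (D n))) \<le> C"
proof -
  define R where "R = space M - (\<Union>n<N. D n)"
  define P where "P = insert R (D ` {..<N}) - {{}}"
  have R: "R \<in> sets M" using D(1) by (auto simp: R_def)
  have img: "(\<Sum>E\<in>D ` {..<N}. norm (G E)) = (\<Sum>n<N. norm (G (D n)))"
  proof (subst sum.reindex_nontrivial)
    fix m n assume "m \<noteq> n" "D m = D n"
    then have "D m = {}" using D(2) by (auto simp: disjoint_family_on_def)
    then show "norm (G (D m)) = 0" by simp
  qed auto
  have "(\<Sum>E\<in>D ` {..<N}. norm (G E)) = (\<Sum>E\<in>D ` {..<N} - {{}}. norm (G E))"
    by (rule sum.mono_neutral_right) auto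
  also have "\<dots> \<le> (\<Sum>E\<in>P. norm (G E))"
    unfolding P_def by (rule sum_mono2) auto
  also have "\<dots> \<le> C"
  proof (rule C[rule_format])
    show "finite P" by (simp add: P_def)
    show "P \<subseteq> sets M" using R D(1) by (auto simp: P_def)
    show "partition_on (space M) P"
      unfolding partition_on_def
    proof (intro conjI)
      show "\<Union> P = space M"
      proof -
        have "D n \<subseteq> space M" for n by (rule sets.sets_into_space[OF D(1)])
        then have "R \<union> (\<Union>n<N. D n) = space M" unfolding R_def by blast
        moreover have "\<Union> P = R \<union> (\<Union>n<N. D n)" unfolding P_def by blast
        ultimately show ?thesis by simp
      qed
      show "disjoint P"
      proof -
        have "D m \<inter> D n = {}" if "D m \<noteq> D n" for m n
          using D(2) that by (metis UNIV_I disjoint_family_on_def)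
        moreover have "R \<inter> D n = {}" "D n \<inter> R = {}" if "n < N" for n
          using that by (auto simp: R_def)
        ultimately show ?thesis unfolding P_def disjoint_def by blast
      qed
    qed (simp add: P_def)
  qed
  finally show ?thesis by (simp only: img)
qed

lemma local_domination:
  assumes C: "\<forall>P. finite P \<longrightarrow> P \<subseteq> sets M \<longrightarrow> partition_on (space M) P \<longrightarrow> (\<Sum>E\<in>P. norm (G E)) \<le> C"
    and A: "A \<in> sets M" "0 < measure M A"
  obtains B k where "B \<in> sets M" "B \<subseteq> A" "0 < measure M B"
    "\<And>E. E \<in> sets M \<Longrightarrow> E \<subseteq> B \<Longrightarrow> norm (G E) \<le> k * measure M E"
proof -
  \<comment> \<open>If sets with \<open>norm (G E)\<close> above \<open>k * measure M E\<close>
    filled \<open>A\<close>, the variation would be at least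
    \<open>k * measure M A = \<bar>C\<bar> + 1\<close>.\<close>
  define k where "k = (\<bar>C\<bar> + 1) / measure M A"
  have k: "0 < k" "k * measure M A = \<bar>C\<bar> + 1" using A(2) by (auto simp: k_def)
  define \<P> where "\<P> = {E \<in> sets M. E \<subseteq> A \<and> k * measure M E < norm (G E)}"
  have pos: "0 < measure M E" if "E \<in> \<P>" for E
  proof (rule ccontr)
    assume "\<not> ?thesis"
    then have "measure M E = 0" using measure_nonneg[of M E] by linarith
    then show False using that G_measure_0[of E] by (auto simp: \<P>_def)
  qed
  obtain D :: "nat \<Rightarrow> 'w set" where D: "disjoint_family D" "\<And>n. D n = {} \<or> D n \<in> \<P>"
    "\<And>A. A \<in> \<P> \<Longrightarrow> A \<inter> (\<Union>n. D n) \<noteq> {}"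
    by (rule greedy_disjoint_family[of \<P>]) (use pos in \<open>auto simp: \<P>_def\<close>)
  have Ds: "D n \<in> sets M" "D n \<subseteq> A" "k * measure M (D n) \<le> norm (G (D n))" for n
    using D(2)[of n] by (auto simp: \<P>_def)
  have AD: "A \<inter> D n = D n" for n using Ds(2)[of n] by auto
  define B where "B = A - (\<Union>n. D n)"
  have B: "B \<in> sets M" using A Ds(1) by (auto simp: B_def)
  have "measure M B \<noteq> 0"
  proof
    assume "measure M B = 0"
    then have "(\<lambda>n. measure M (D n)) sums measure M A"
      using Int_sums(2)[of D A] Ds(1) D(1) A(1) AD by (simp add: B_def)
    then have "(\<lambda>N. k * (\<Sum>n<N. measure M (D n))) \<longlonglongrightarrow> k * measure M A"
      unfolding sums_def by (intro tendsto_intros)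
    moreover have "k * (\<Sum>n<N. measure M (D n)) \<le> C" for N
    proof -
      have "k * (\<Sum>n<N. measure M (D n)) \<le> (\<Sum>n<N. norm (G (D n)))"
        unfolding sum_distrib_left by (rule sum_mono) (rule Ds(3))
      also have "\<dots> \<le> C" by (rule variation_sum_le[OF C Ds(1) D(1)])
      finally show ?thesis .
    qed
    ultimately have "k * measure M A \<le> C" by (intro LIMSEQ_le_const2) auto
    with k(2) show False by simp
  qed
  then have "0 < measure M B" using measure_nonneg[of M B] by linarith
  moreover have "norm (G E) \<le> k * measure M E" if "E \<in> sets M" "E \<subseteq> B" for E
  proof (rule ccontr)
    assume "\<not> ?thesis"
    then have "E \<in> \<P>" using that by (auto simp: \<P>_def B_def)
    from D(3)[OF this] that(2) show False by (auto simp: B_def)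
  qed
  ultimately show ?thesis using B by (intro that[of B k]) (auto simp: B_def)
qed

definition average_range :: "'w set \<Rightarrow> 'a set" where
  "average_range B = {G F /\<^sub>R measure M F |F. F \<in> sets M \<and> F \<subseteq> B \<and> 0 < measure M F}"

text \<open>Domination on \<open>A'\<close> makes the averages bounded, and \<open>slice_set\<close>
  makes the average ranges of its subsets stable under slicing, so \<open>slice_refine_small\<close>
  applies to them.\<close>

lemma small_average_range:
  assumes refl: "reflexive_space TYPE('a)" and kadec: "\<And>x :: 'a. kadec_at x"
    and C: "\<forall>P. finite P \<longrightarrow> P \<subseteq> sets M \<longrightarrow> partition_on (space M) P \<longrightarrow> (\<Sum>E\<in>P. norm (G E)) \<le> C"
    and A: "A \<in> sets M" "0 < measure M A" and e: "0 < e"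
  obtains B x where "B \<in> sets M" "B \<subseteq> A" "0 < measure M B"
    "\<And>F. F \<in> sets M \<Longrightarrow> F \<subseteq> B \<Longrightarrow> norm (G F - measure M F *\<^sub>R x) \<le> e * measure M F"
proof -
  obtain A' k where A': "A' \<in> sets M" "A' \<subseteq> A" "0 < measure M A'"
    and k: "\<And>E. E \<in> sets M \<Longrightarrow> E \<subseteq> A' \<Longrightarrow> norm (G E) \<le> k * measure M E"
    using local_domination[OF C A] by blast
  define \<B> where "\<B> = {average_range B |B. B \<in> sets M \<and> B \<subseteq> A' \<and> 0 < measure M B}"
  have "average_range A' \<in> \<B>" using A' by (auto simp: \<B>_def)
  then obtain S x where S: "S \<in> \<B>" "\<And>y. y \<in> S \<Longrightarrow> norm (y - x) \<le> e"
  proof (rule slice_refine_small[OF refl kadec, rotated 3, OF _ e])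
    show "S \<noteq> {}" if "S \<in> \<B>" for S using that by (auto simp: \<B>_def average_range_def)
    show "norm z \<le> k" if z: "S \<in> \<B>" "z \<in> S" for S z
    proof -
      obtain F where F: "F \<in> sets M" "F \<subseteq> A'" "0 < measure M F" "z = G F /\<^sub>R measure M F"
        using z by (auto simp: \<B>_def average_range_def)
      then show ?thesis using k[OF F(1,2)] by (simp add: field_simps)
    qed
    fix S z a and f :: "'a \<Rightarrow>\<^sub>L real" assume "S \<in> \<B>" "z \<in> S" and az: "a < blinfun_apply f z"
    then obtain B F where B: "S = average_range B" "B \<in> sets M" "B \<subseteq> A'"
      and F: "F \<in> sets M" "F \<subseteq> B" "0 < measure M F" "z = G F /\<^sub>R measure M F"
      by (auto simp: \<B>_def average_range_def)
    have "a * measure M F < blinfun_apply f (G F)"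
      using az F(3,4) by (simp add: blinfun.scaleR_right field_simps)
    then obtain B' where B': "B' \<in> sets M" "B' \<subseteq> F" "0 < measure M B'"
      "\<And>E. E \<in> sets M \<Longrightarrow> E \<subseteq> B' \<Longrightarrow> a * measure M E \<le> blinfun_apply f (G E)"
      using slice_set[OF F(1)] by blast
    have "B' \<subseteq> A'" using B' F B by blast
    then have "average_range B' \<in> \<B>" unfolding \<B>_def using B'(1,3) by blast
    moreover have "average_range B' \<subseteq> S"
      unfolding B(1) average_range_def using B'(2) F(2) by blast
    moreover have "a \<le> blinfun_apply f y" if y: "y \<in> average_range B'" for y
    proof -
      obtain E where E: "E \<in> sets M" "E \<subseteq> B'" "0 < measure M E" "y = G E /\<^sub>R measure M E"
        using y by (auto simp: average_range_def)
      then show ?thesis using B'(4)[OF E(1,2)] by (simp add: blinfun.scaleR_right field_simps)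
    qed
    ultimately show "\<exists>S'\<in>\<B>. S' \<subseteq> S \<and> (\<forall>y\<in>S'. a \<le> blinfun_apply f y)" by blast
  qed blast
  then obtain B where B: "S = average_range B" "B \<in> sets M" "B \<subseteq> A'" "0 < measure M B"
    by (auto simp: \<B>_def)
  show ?thesis
  proof (rule that[of B x])
    fix F assume F: "F \<in> sets M" "F \<subseteq> B"
    show "norm (G F - measure M F *\<^sub>R x) \<le> e * measure M F"
    proof (cases "measure M F = 0")
      case True
      then show ?thesis using G_measure_0[OF F(1)] by simp
    next
      case False
      then have p: "0 < measure M F" using measure_nonneg[of M F] by linarith
      then have "norm (G F /\<^sub>R measure M F - x) \<le> e"
        using F by (intro S(2)) (auto simp: B(1) average_range_def)
      moreover have "G F - measure M F *\<^sub>R x = measure M F *\<^sub>R (G F /\<^sub>R measure M F - x)"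
        using p by (simp add: scaleR_diff_right)
      ultimately show ?thesis using p by (simp add: mult.commute)
    qed
  qed (use B A' in auto)
qed

text \<open>Exhaust the space by disjoint sets on which \<open>G\<close> is nearly a constant times
  the measure. If a set of positive measure remained, \<open>small_average_range\<close> would find
  another such set in it.\<close>

lemma countable_approximation:
  assumes refl: "reflexive_space TYPE('a)" and kadec: "\<And>x :: 'a. kadec_at x"
    and C: "\<forall>P. finite P \<longrightarrow> P \<subseteq> sets M \<longrightarrow> partition_on (space M) P \<longrightarrow> (\<Sum>E\<in>P. norm (G E)) \<le> C"
    and e: "0 < e"
  obtains i :: "'w \<Rightarrow> nat" and x where "i \<in> measurable M (count_space UNIV)"
    "\<And>n F. F \<in> sets M \<Longrightarrow> F \<subseteq> i -` {n} \<Longrightarrow> norm (G F - measure M F *\<^sub>R x n) \<le> e * measure M F"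
proof -
  define good where "good B x \<longleftrightarrow> (\<forall>F\<in>sets M. F \<subseteq> B \<longrightarrow> norm (G F - measure M F *\<^sub>R x) \<le> e * measure M F)"
    for B x
  define \<P> where "\<P> = {B \<in> sets M. 0 < measure M B \<and> (\<exists>x. good B x)}"
  obtain D :: "nat \<Rightarrow> 'w set" where D: "disjoint_family D" "\<And>n. D n = {} \<or> D n \<in> \<P>"
    "\<And>A. A \<in> \<P> \<Longrightarrow> A \<inter> (\<Union>n. D n) \<noteq> {}"
    by (rule greedy_disjoint_family[of \<P>]) (auto simp: \<P>_def)
  have Ds: "D n \<in> sets M" for n using D(2)[of n] by (auto simp: \<P>_def)
  have "good {} 0" by (simp add: good_def)
  then have "\<exists>x. good (D n) x" for n using D(2)[of n] by (auto simp: \<P>_def)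
  then obtain x where x: "\<And>n. good (D n) (x n)" by metis
  define R where "R = space M - (\<Union>n. D n)"
  have R: "R \<in> sets M" using Ds by (auto simp: R_def)
  have R0: "measure M R = 0"
  proof (rule ccontr)
    assume "measure M R \<noteq> 0"
    then have "0 < measure M R" using measure_nonneg[of M R] by linarith
    from small_average_range[OF refl kadec C R this e]
    obtain B x where B: "B \<in> sets M" "B \<subseteq> R" "0 < measure M B" "good B x"
      unfolding good_def by metis
    then have "B \<in> \<P>" by (auto simp: \<P>_def)
    from D(3)[OF this] B(2) show False by (auto simp: R_def)
  qed
  \<comment> \<open>Points outside all \<open>D n\<close> share the index 0; within the space they
    form the null set \<open>R\<close>, which does not affect the estimate for that index.\<close>
  define i where "i w = (if w \<in> (\<Union>n. D n) then THE n. w \<in> D n else 0)" for w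
  have iD: "i w = n" if "w \<in> D n" for w n
  proof -
    have "(THE n. w \<in> D n) = n"
      using D(1) that by (intro the_equality) (auto simp: disjoint_family_on_def)
    then show ?thesis using that by (auto simp: i_def)
  qed
  have i0: "i w = 0" if "w \<in> R" for w using that by (auto simp: i_def R_def)
  have vim: "i -` {n} \<inter> space M = (if n = 0 then D n \<union> R else D n)" for n
  proof (rule set_eqI)
    fix w
    consider m where "w \<in> D m" | "w \<in> R" | "w \<notin> space M" by (auto simp: R_def)
    then show "w \<in> i -` {n} \<inter> space M \<longleftrightarrow> w \<in> (if n = 0 then D n \<union> R else D n)"
    proof cases
      case 1
      then have "w \<in> space M" "w \<notin> R" "w \<in> D n \<longleftrightarrow> n = m"
        using sets.sets_into_space[OF Ds, of m] iD[of w] by (auto simp: R_def)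
      then show ?thesis using iD[OF 1] by auto
    next
      case 2
      then have "w \<in> space M" "w \<notin> D n" by (auto simp: R_def)
      then show ?thesis using i0[OF 2] 2 by auto
    next
      case 3
      then show ?thesis using sets.sets_into_space[OF Ds, of n] by (auto simp: R_def)
    qed
  qed
  show ?thesis
  proof (rule that[of i x])
    have "i -` {n} \<inter> space M \<in> sets M" for n unfolding vim using Ds R by auto
    then show "i \<in> measurable M (count_space UNIV)"
      by (simp add: measurable_count_space_eq2_countable)
    fix n F assume F: "F \<in> sets M" "F \<subseteq> i -` {n}"
    have sub: "F - D n \<subseteq> R"
      using F(2) vim[of n] sets.sets_into_space[OF F(1)] by (auto split: if_splits)
    then have "measure M (F - D n) \<le> measure M R" using F Ds R by (intro finite_measure_mono) auto
    then have 0: "measure M (F - D n) = 0" using R0 measure_nonneg[of M "F - D n"] by linarith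
    have sp: "(F \<inter> D n) \<union> (F - D n) = F" "(F \<inter> D n) \<inter> (F - D n) = {}" by auto
    have FD: "F \<inter> D n \<in> sets M" "F - D n \<in> sets M" using F Ds by auto
    have "G F = G (F \<inter> D n) + G (F - D n)" using G_Un[OF FD sp(2)] by (simp only: sp(1))
    moreover have "G (F - D n) = 0" using F Ds 0 by (intro G_measure_0) auto
    moreover have "measure M F = measure M (F \<inter> D n) + measure M (F - D n)"
      using finite_measure_Union[OF FD sp(2)] by (simp only: sp(1))
    moreover have "norm (G (F \<inter> D n) - measure M (F \<inter> D n) *\<^sub>R x n) \<le> e * measure M (F \<inter> D n)"
      using x[of n] F Ds by (auto simp: good_def)
    ultimately show "norm (G F - measure M F *\<^sub>R x n) \<le> e * measure M F" using 0 by simp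
  qed
qed

end

section \<open>From countably valued approximations to a Bochner density\<close>

context ac_vector_measure
begin

text \<open>Cutting off at index \<open>N\<close> leaves finitely many values, and the integral
  becomes a finite sum that is compared with \<open>G\<close> piece by piece. The pieces are
  disjoint, so the errors add up to at most \<open>e\<close> times the total measure.\<close>

lemma simple_approximation:
  fixes i :: "'w \<Rightarrow> nat" and x :: "nat \<Rightarrow> 'a"
  assumes i: "i \<in> measurable M (count_space UNIV)" and E: "E \<in> sets M" and e: "0 \<le> e"
    and x: "\<And>n F. F \<in> sets M \<Longrightarrow> F \<subseteq> i -` {n} \<Longrightarrow> norm (G F - measure M F *\<^sub>R x n) \<le> e * measure M F"
  defines "s \<equiv> \<lambda>N w. if w \<in> E \<and> i w < N then x (i w) else 0"
  shows "Bochner_Integration.simple_bochner_integrable M (s N)"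
    and "norm (Bochner_Integration.simple_bochner_integral M (s N) - (\<Sum>n<N. G (E \<inter> (i -` {n} \<inter> space M))))
      \<le> e * measure M (space M)"
proof -
  define B where "B n = i -` {n} \<inter> space M" for n
  have B: "B n \<in> sets M" for n unfolding B_def by (rule measurable_sets[OF i]) simp
  have disj: "disjoint_family B" by (auto simp: disjoint_family_on_def B_def)
  \<comment> \<open>The value 0 of \<open>q\<close> marks the points where \<open>s N\<close> is set
    to 0, and \<open>Suc n\<close> the piece with index \<open>n\<close>. Integrating along the
    level sets of \<open>q\<close> works even when several \<open>x n\<close> coincide.\<close>
  define q where "q w = (if w \<in> E \<and> i w < N then Suc (i w) else 0)" for w
  define v where "v n = (case n of 0 \<Rightarrow> 0 | Suc m \<Rightarrow> x m)" for n
  have qv: "s N w = v (q w)" for w by (simp add: s_def q_def v_def)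
  have q_range: "q w < Suc N" for w by (simp add: q_def)
  have qB: "{w \<in> space M. q w = Suc n} = (if n < N then E \<inter> B n else {})" for n
    using sets.sets_into_space[OF E] by (auto simp: q_def B_def)
  have qS: "{w \<in> space M. q w = Suc n} \<in> sets M" for n
    using B E by (simp add: qB)
  have q0: "{w \<in> space M. q w = 0} = space M - (\<Union>n. {w \<in> space M. q w = Suc n})"
    by auto (metis not0_implies_Suc)
  have "{w \<in> space M. q w = 0} \<in> sets M" unfolding q0 using qS by auto
  then have qm: "{w \<in> space M. q w = n} \<in> sets M" for n using qS by (cases n) auto
  have sq: "simple_function M q"
    unfolding simple_function_def
  proof (intro conjI ballI)
    show "finite (q ` space M)" by (rule finite_subset[of _ "{..<Suc N}"]) (use q_range in auto)
    fix n show "q -` {n} \<inter> space M \<in> sets M"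
      using qm[of n] by (simp add: vimage_def Collect_conj_eq Int_commute)
  qed
  have "simple_function M (\<lambda>w. v (q w))" by (rule simple_function_compose1[OF sq])
  then have ss: "simple_function M (s N)" by (simp add: qv[abs_def])
  then show sb: "Bochner_Integration.simple_bochner_integrable M (s N)"
    by (intro Bochner_Integration.simple_bochner_integrable.intros) auto
  have "Bochner_Integration.simple_bochner_integral M (s N)
      = (\<Sum>y\<in>q ` space M. measure M {w \<in> space M. q w = y} *\<^sub>R v y)"
    by (rule simple_bochner_integral_partition[OF sb sq]) (simp_all add: qv)
  also have "\<dots> = (\<Sum>y<Suc N. measure M {w \<in> space M. q w = y} *\<^sub>R v y)"
  proof (rule sum.mono_neutral_left)
    show "\<forall>y\<in>{..<Suc N} - q ` space M. measure M {w \<in> space M. q w = y} *\<^sub>R v y = 0"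
    proof
      fix y assume "y \<in> {..<Suc N} - q ` space M"
      then have "{w \<in> space M. q w = y} = {}" by auto
      then show "measure M {w \<in> space M. q w = y} *\<^sub>R v y = 0" by (simp only: measure_empty scaleR_zero_left)
    qed
  qed (use q_range in auto)
  also have "\<dots> = (\<Sum>n<N. measure M (E \<inter> B n) *\<^sub>R x n)"
    unfolding sum.lessThan_Suc_shift by (simp add: v_def qB)
  finally have int: "Bochner_Integration.simple_bochner_integral M (s N) = (\<Sum>n<N. measure M (E \<inter> B n) *\<^sub>R x n)" .
  have "norm ((\<Sum>n<N. measure M (E \<inter> B n) *\<^sub>R x n) - (\<Sum>n<N. G (E \<inter> B n)))
      \<le> (\<Sum>n<N. e * measure M (E \<inter> B n))"
    unfolding sum_subtractf[symmetric]
  proof (rule sum_norm_le)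
    fix n
    have "norm (G (E \<inter> B n) - measure M (E \<inter> B n) *\<^sub>R x n) \<le> e * measure M (E \<inter> B n)"
      using E B by (intro x) (auto simp: B_def)
    then show "norm (measure M (E \<inter> B n) *\<^sub>R x n - G (E \<inter> B n)) \<le> e * measure M (E \<inter> B n)"
      by (simp add: norm_minus_commute)
  qed
  also have "\<dots> = e * measure M (\<Union>n<N. E \<inter> B n)"
  proof -
    have "measure M (\<Union>n<N. E \<inter> B n) = (\<Sum>n<N. measure M (E \<inter> B n))"
      using E B disj by (intro finite_measure_finite_Union) (auto simp: disjoint_family_on_def)
    then show ?thesis by (simp add: sum_distrib_left)
  qed
  also have "\<dots> \<le> e * measure M (space M)"
    using e by (intro mult_left_mono bounded_measure)
  finally show "norm (Bochner_Integration.simple_bochner_integral M (s N) - (\<Sum>n<N. G (E \<inter> (i -` {n} \<inter> space M))))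
      \<le> e * measure M (space M)"
    unfolding int B_def .
qed

text \<open>On each piece, \<open>norm (x n)\<close> times the measure exceeds the norm of
  \<open>G\<close> by at most \<open>e\<close> times the measure; bounded variation then bounds the
  sum.\<close>

lemma integrable_approximation:
  fixes i :: "'w \<Rightarrow> nat" and x :: "nat \<Rightarrow> 'a"
  assumes C: "\<forall>P. finite P \<longrightarrow> P \<subseteq> sets M \<longrightarrow> partition_on (space M) P \<longrightarrow> (\<Sum>E\<in>P. norm (G E)) \<le> C"
    and i: "i \<in> measurable M (count_space UNIV)" and e: "0 \<le> e"
    and x: "\<And>n F. F \<in> sets M \<Longrightarrow> F \<subseteq> i -` {n} \<Longrightarrow> norm (G F - measure M F *\<^sub>R x n) \<le> e * measure M F"
  shows "(\<integral>\<^sup>+w. ennreal (norm (x (i w))) \<partial>M) < \<infinity>"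
proof -
  define B where "B n = i -` {n} \<inter> space M" for n
  have B: "B n \<in> sets M" for n unfolding B_def by (rule measurable_sets[OF i]) simp
  have disj: "disjoint_family B" by (auto simp: disjoint_family_on_def B_def)
  have "(\<integral>\<^sup>+w. ennreal (norm (x (i w))) \<partial>M) = (\<integral>\<^sup>+w. (\<Sum>n. ennreal (norm (x n)) * indicator (B n) w) \<partial>M)"
  proof (rule nn_integral_cong)
    fix w assume "w \<in> space M"
    then have "w \<in> B (i w)" by (simp add: B_def)
    from suminf_cmult_indicator[OF disj this, of "\<lambda>n. ennreal (norm (x n))"]
    show "ennreal (norm (x (i w))) = (\<Sum>n. ennreal (norm (x n)) * indicator (B n) w)" by simp
  qed
  also have "\<dots> = (\<Sum>n. \<integral>\<^sup>+w. ennreal (norm (x n)) * indicator (B n) w \<partial>M)"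
    using B by (intro nn_integral_suminf) auto
  also have "\<dots> = (\<Sum>n. ennreal (norm (x n) * measure M (B n)))"
    using B by (simp add: nn_integral_cmult_indicator emeasure_eq_measure ennreal_mult')
  also have "\<dots> \<le> ennreal (C + e * measure M (space M))"
    unfolding suminf_eq_SUP
  proof (rule SUP_least)
    fix N
    have "(\<Sum>n<N. norm (x n) * measure M (B n)) \<le> (\<Sum>n<N. norm (G (B n)) + e * measure M (B n))"
    proof (rule sum_mono)
      fix n
      have "norm (G (B n) - measure M (B n) *\<^sub>R x n) \<le> e * measure M (B n)"
        using B by (intro x) (auto simp: B_def)
      then show "norm (x n) * measure M (B n) \<le> norm (G (B n)) + e * measure M (B n)"
        using norm_triangle_ineq2[of "measure M (B n) *\<^sub>R x n" "G (B n)"]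
        by (simp add: norm_minus_commute mult.commute)
    qed
    also have "\<dots> = (\<Sum>n<N. norm (G (B n))) + e * measure M (\<Union>n<N. B n)"
    proof -
      have "measure M (\<Union>n<N. B n) = (\<Sum>n<N. measure M (B n))"
        using B disj by (intro finite_measure_finite_Union) (auto simp: disjoint_family_on_def)
      then show ?thesis by (simp add: sum.distrib sum_distrib_left)
    qed
    also have "\<dots> \<le> C + e * measure M (space M)"
      using e by (intro add_mono variation_sum_le[OF C B disj] mult_left_mono bounded_measure)
    finally show "(\<Sum>n<N. ennreal (norm (x n) * measure M (B n))) \<le> ennreal (C + e * measure M (space M))"
      by (simp add: sum_ennreal ennreal_leI)
  qed
  finally show ?thesis by (simp add: order_le_less_trans)
qed

end

text \<open>The approximations for \<open>e k\<close> are almost everywhere uniformly Cauchy, and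
  their limit is the density. Completeness is a hypothesis because the locale fixes only a normed
  space.\<close>

lemma (in ac_vector_measure) density_exists:
  assumes complete: "\<And>u :: nat \<Rightarrow> 'a. Cauchy u \<Longrightarrow> convergent u"
    and refl: "reflexive_space TYPE('a)" and kadec: "\<And>x :: 'a. kadec_at x"
    and C: "\<forall>P. finite P \<longrightarrow> P \<subseteq> sets M \<longrightarrow> partition_on (space M) P \<longrightarrow> (\<Sum>E\<in>P. norm (G E)) \<le> C"
  obtains g where "\<And>E. E \<in> sets M \<Longrightarrow> has_Bochner_integral M (\<lambda>w. indicator E w *\<^sub>R g w) (G E)"
proof -
  define e where "e k = (1/2 :: real) ^ k" for k :: nat
  have e: "0 < e k" for k by (simp add: e_def)
  have e0: "e \<longlonglongrightarrow> 0" unfolding e_def[abs_def] by (rule LIMSEQ_power_zero) simp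
  have "\<exists>(i :: 'w \<Rightarrow> nat) x. i \<in> measurable M (count_space UNIV) \<and>
    (\<forall>n F. F \<in> sets M \<longrightarrow> F \<subseteq> i -` {n} \<longrightarrow> norm (G F - measure M F *\<^sub>R x n) \<le> e k * measure M F)" for k
    by (rule countable_approximation[OF refl kadec C e[of k]]) blast
  then obtain i :: "nat \<Rightarrow> 'w \<Rightarrow> nat" and x where i: "\<And>k. i k \<in> measurable M (count_space UNIV)"
    and x: "\<And>k n F. F \<in> sets M \<Longrightarrow> F \<subseteq> i k -` {n} \<Longrightarrow> norm (G F - measure M F *\<^sub>R x k n) \<le> e k * measure M F"
    by metis
  have close: "AE w in M. norm (x k (i k w) - x l (i l w)) \<le> e k + e l" for k l
  proof -
    \<comment> \<open>On a set \<open>D\<close> of positive measure where both functions are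
      constant, both constants are close to the average of \<open>G\<close> over \<open>D\<close>.
      There are countably many pairs of constants, so the exceptional null sets can be
      united.\<close>
    have *: "AE w in M. i k w = m \<and> i l w = n \<longrightarrow> norm (x k m - x l n) \<le> e k + e l" for m n
    proof -
      define D where "D = (i k -` {m} \<inter> space M) \<inter> (i l -` {n} \<inter> space M)"
      have D: "D \<in> sets M"
        unfolding D_def by (intro sets.Int measurable_sets[OF i]) auto
      show ?thesis
      proof (cases "measure M D = 0")
        case True
        then have "D \<in> null_sets M" using D by (simp add: null_sets_def emeasure_eq_measure)
        then have "AE w in M. w \<notin> D" by (rule AE_not_in)
        then show ?thesis by (rule AE_mp) (auto intro!: AE_I2 simp: D_def)
      next
        case False
        then have p: "0 < measure M D" using measure_nonneg[of M D] by linarith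
        have "norm (G D - measure M D *\<^sub>R x k m) \<le> e k * measure M D"
          "norm (G D - measure M D *\<^sub>R x l n) \<le> e l * measure M D"
          using D by (auto intro!: x simp: D_def)
        then have "norm (measure M D *\<^sub>R x k m - measure M D *\<^sub>R x l n) \<le> e k * measure M D + e l * measure M D"
          using norm_triangle_ineq4[of "G D - measure M D *\<^sub>R x l n" "G D - measure M D *\<^sub>R x k m"] by simp
        then have "measure M D * norm (x k m - x l n) \<le> measure M D * (e k + e l)"
          using p by (simp add: algebra_simps flip: scaleR_diff_right)
        then have "norm (x k m - x l n) \<le> e k + e l" using p by simp
        then show ?thesis by simp
      qed
    qed
    have "AE w in M. \<forall>m n. i k w = m \<and> i l w = n \<longrightarrow> norm (x k m - x l n) \<le> e k + e l"
      unfolding AE_all_countable by (intro allI *)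
    then show ?thesis by eventually_elim blast
  qed
  then have "AE w in M. \<forall>k l. norm (x k (i k w) - x l (i l w)) \<le> e k + e l"
    unfolding AE_all_countable by blast
  then obtain Z where Z: "{w \<in> space M. \<not> (\<forall>k l. norm (x k (i k w) - x l (i l w)) \<le> e k + e l)} \<subseteq> Z"
      "emeasure M Z = 0" "Z \<in> sets M" by (rule AE_E)
  \<comment> \<open>Setting the functions to 0 on \<open>Z\<close> makes them Cauchy at every point
    of the space, so the limit exists everywhere there and is measurable.\<close>
  define h where "h k w = (if w \<in> Z then 0 else x k (i k w))" for k w
  have hm: "h k \<in> borel_measurable M" for k
  proof -
    have "(\<lambda>w. x k (i k w)) \<in> borel_measurable M"
      by (rule measurable_compose[OF i]) simp
    then show ?thesis unfolding h_def[abs_def] using Z(3) by (intro measurable_If) auto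
  qed
  have hC: "norm (h k w - h l w) \<le> e k + e l" if "w \<in> space M" for k l w
    using Z(1) that e[of k] e[of l] by (auto simp: h_def)
  have "Cauchy (\<lambda>k. h k w)" if w: "w \<in> space M" for w
  proof (rule metric_CauchyI)
    fix r :: real assume "0 < r"
    then have "eventually (\<lambda>k. e k < r / 2) sequentially" using e0 by (intro order_tendstoD(2)) auto
    then obtain N where N: "\<And>k. N \<le> k \<Longrightarrow> e k < r / 2" by (auto simp: eventually_sequentially)
    have "dist (h k w) (h l w) < r" if "N \<le> k" "N \<le> l" for k l
      using hC[OF w, of k l] N[OF that(1)] N[OF that(2)] by (simp add: dist_norm)
    then show "\<exists>N. \<forall>k\<ge>N. \<forall>l\<ge>N. dist (h k w) (h l w) < r" by blast
  qed
  then have lim: "(\<lambda>k. h k w) \<longlonglongrightarrow> lim (\<lambda>k. h k w)" if "w \<in> space M" for w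
    using complete that by (simp add: convergent_LIMSEQ_iff)
  define g where "g w = lim (\<lambda>k. h k w)" for w
  have gm: "g \<in> borel_measurable M"
    by (rule borel_measurable_LIMSEQ_metric[where f=h, OF hm]) (simp add: g_def lim)
  have gh: "norm (g w - x k (i k w)) \<le> e k" if w: "w \<in> space M - Z" for w k
  proof -
    have "(\<lambda>l. norm (h l w - h k w)) \<longlonglongrightarrow> norm (g w - h k w)"
      unfolding g_def using w by (intro tendsto_intros lim) auto
    moreover have "(\<lambda>l. e l + e k) \<longlonglongrightarrow> 0 + e k" by (intro tendsto_intros e0)
    ultimately have "norm (g w - h k w) \<le> 0 + e k"
      by (rule LIMSEQ_le) (use hC w in auto)
    then show ?thesis using w by (simp add: h_def)
  qed
  have "has_Bochner_integral M (\<lambda>w. indicator E w *\<^sub>R g w) (G E)" if E: "E \<in> sets M" for E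
  proof -
    define s where "s k N w = (if w \<in> E \<and> i k w < N then x k (i k w) else 0)" for k N w
    \<comment> \<open>The cutoff must come late enough for two tails: that of the integral of the
      norm and that of the series of the values of \<open>G\<close>.\<close>
    have "\<exists>N. (\<integral>\<^sup>+w. ennreal (if i k w < N then 0 else norm (x k (i k w))) \<partial>M) < ennreal (e k) \<and>
        norm ((\<Sum>n<N. G (E \<inter> (i k -` {n} \<inter> space M))) - G E) < e k" for k
    proof -
      have fin: "(\<integral>\<^sup>+w. ennreal (norm (x k (i k w))) \<partial>M) < \<infinity>"
        by (rule integrable_approximation[OF C i less_imp_le[OF e[of k]] x]) auto
      have m: "(\<lambda>w. ennreal (if i k w < N then 0 else norm (x k (i k w)))) \<in> borel_measurable M" for N
        by (rule measurable_compose[OF i[of k]]) simp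
      have "(\<lambda>N. \<integral>\<^sup>+w. ennreal (if i k w < N then 0 else norm (x k (i k w))) \<partial>M)
          \<longlonglongrightarrow> (\<integral>\<^sup>+w. 0 \<partial>M)"
      proof (rule nn_integral_dominated_convergence[where w="\<lambda>w. ennreal (norm (x k (i k w)))"])
        show "(\<lambda>w. ennreal (norm (x k (i k w)))) \<in> borel_measurable M"
          by (rule measurable_compose[OF i[of k]]) simp
        show "AE w in M. ennreal (if i k w < N then 0 else norm (x k (i k w))) \<le> ennreal (norm (x k (i k w)))" for N
          by (intro AE_I2) simp
        show "AE w in M. (\<lambda>N. ennreal (if i k w < N then 0 else norm (x k (i k w)))) \<longlonglongrightarrow> 0"
        proof (intro AE_I2 tendsto_eventually)
          fix w
          show "eventually (\<lambda>N. ennreal (if i k w < N then 0 else norm (x k (i k w))) = 0) sequentially"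
            using eventually_gt_at_top[of "i k w"] by eventually_elim simp
        qed
      qed (use m fin in auto)
      then have ev1: "eventually (\<lambda>N. (\<integral>\<^sup>+w. ennreal (if i k w < N then 0 else norm (x k (i k w))) \<partial>M) < ennreal (e k)) sequentially"
        using e[of k] by (intro order_tendstoD(2)) auto
      have "(\<lambda>n. G (E \<inter> (i k -` {n} \<inter> space M))) sums G E"
      proof (rule Int_sums(1)[OF _ _ E])
        show "i k -` {n} \<inter> space M \<in> sets M" for n by (rule measurable_sets[OF i]) simp
        show "disjoint_family (\<lambda>n. i k -` {n} \<inter> space M)" by (auto simp: disjoint_family_on_def)
        have "E - (\<Union>n. i k -` {n} \<inter> space M) = {}" using sets.sets_into_space[OF E] by auto
        then show "measure M (E - (\<Union>n. i k -` {n} \<inter> space M)) = 0" by (simp only: measure_empty)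
      qed
      then have "eventually (\<lambda>N. dist (\<Sum>n<N. G (E \<inter> (i k -` {n} \<inter> space M))) (G E) < e k) sequentially"
        using e[of k] unfolding sums_def by (rule tendstoD)
      with ev1 have "eventually (\<lambda>N. (\<integral>\<^sup>+w. ennreal (if i k w < N then 0 else norm (x k (i k w))) \<partial>M) < ennreal (e k) \<and>
        norm ((\<Sum>n<N. G (E \<inter> (i k -` {n} \<inter> space M))) - G E) < e k) sequentially"
        by eventually_elim (simp add: dist_norm)
      then show ?thesis by (auto simp: eventually_sequentially)
    qed
    then have "\<exists>N. \<forall>k. (\<integral>\<^sup>+w. ennreal (if i k w < N k then 0 else norm (x k (i k w))) \<partial>M) < ennreal (e k) \<and>
        norm ((\<Sum>n<N k. G (E \<inter> (i k -` {n} \<inter> space M))) - G E) < e k"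
      by (intro choice allI)
    then obtain N where N: "\<And>k. (\<integral>\<^sup>+w. ennreal (if i k w < N k then 0 else norm (x k (i k w))) \<partial>M) < ennreal (e k)"
        "\<And>k. norm ((\<Sum>n<N k. G (E \<inter> (i k -` {n} \<inter> space M))) - G E) < e k"
      by blast
    have sa: "Bochner_Integration.simple_bochner_integrable M (s k K)"
      "norm (Bochner_Integration.simple_bochner_integral M (s k K) - (\<Sum>n<K. G (E \<inter> (i k -` {n} \<inter> space M))))
        \<le> e k * measure M (space M)" for k K
      unfolding s_def[abs_def]
      by (rule simple_approximation[OF i E less_imp_le[OF e] x], assumption, assumption)+
    show ?thesis
      unfolding has_Bochner_integral_def
    proof (intro conjI exI[of _ "\<lambda>k. s k (N k)"] allI)
      have "(\<lambda>w. indicator E w *\<^sub>R g w) = (\<lambda>w. if w \<in> E then g w else 0)" by (auto simp: indicator_def)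
      then show "(\<lambda>w. indicator E w *\<^sub>R g w) \<in> borel_measurable M"
        using gm E by (simp add: measurable_If)
      show "Bochner_Integration.simple_bochner_integrable M (s k (N k))" for k
        by (rule sa(1))
      show "(\<lambda>k. Bochner_Integration.simple_bochner_integral M (s k (N k))) \<longlonglongrightarrow> G E"
      proof (rule LIM_zero_cancel, rule Lim_null_comparison)
        show "eventually (\<lambda>k. norm (Bochner_Integration.simple_bochner_integral M (s k (N k)) - G E)
            \<le> e k * (measure M (space M) + 1)) sequentially"
        proof (intro always_eventually allI)
          fix k
          have eq: "Bochner_Integration.simple_bochner_integral M (s k (N k)) - G E
            = (Bochner_Integration.simple_bochner_integral M (s k (N k))
              - (\<Sum>n<N k. G (E \<inter> (i k -` {n} \<inter> space M))))
              + ((\<Sum>n<N k. G (E \<inter> (i k -` {n} \<inter> space M))) - G E)" by simp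
          have "norm (Bochner_Integration.simple_bochner_integral M (s k (N k)) - G E)
            \<le> norm (Bochner_Integration.simple_bochner_integral M (s k (N k))
              - (\<Sum>n<N k. G (E \<inter> (i k -` {n} \<inter> space M))))
              + norm ((\<Sum>n<N k. G (E \<inter> (i k -` {n} \<inter> space M))) - G E)"
            by (subst eq) (rule norm_triangle_ineq)
          also have "\<dots> \<le> e k * measure M (space M) + e k"
            using sa(2)[of k "N k"] N(2)[of k] by (intro add_mono) auto
          finally show "norm (Bochner_Integration.simple_bochner_integral M (s k (N k)) - G E)
            \<le> e k * (measure M (space M) + 1)"
            by (simp add: distrib_left)
        qed
        show "(\<lambda>k. e k * (measure M (space M) + 1)) \<longlonglongrightarrow> 0"
          using tendsto_mult_right[OF e0, of "measure M (space M) + 1"] by simp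
      qed
      show "(\<lambda>k. \<integral>\<^sup>+w. ennreal (norm (indicator E w *\<^sub>R g w - s k (N k) w)) \<partial>M) \<longlonglongrightarrow> 0"
      proof (rule tendsto_sandwich[OF _ _ tendsto_const])
        show "eventually (\<lambda>k. (\<integral>\<^sup>+w. ennreal (norm (indicator E w *\<^sub>R g w - s k (N k) w)) \<partial>M)
            \<le> ennreal (e k * (measure M (space M) + 1))) sequentially"
        proof (intro always_eventually allI)
          fix k
          have "AE w in M. w \<notin> Z" using Z by (intro AE_not_in) (simp add: null_sets_def)
          then have "AE w in M. ennreal (norm (indicator E w *\<^sub>R g w - s k (N k) w))
              \<le> ennreal (e k) + ennreal (if i k w < N k then 0 else norm (x k (i k w)))"
          proof (rule AE_mp, intro AE_I2 impI)
            fix w assume w: "w \<in> space M" "w \<notin> Z"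
            then have gw: "norm (g w - x k (i k w)) \<le> e k" using gh by auto
            have "norm (indicator E w *\<^sub>R g w - s k (N k) w) \<le> e k + (if i k w < N k then 0 else norm (x k (i k w)))"
              using gw e[of k] norm_triangle_ineq2[of "g w" "x k (i k w)"]
              by (auto simp: s_def indicator_def)
            then show "ennreal (norm (indicator E w *\<^sub>R g w - s k (N k) w))
              \<le> ennreal (e k) + ennreal (if i k w < N k then 0 else norm (x k (i k w)))"
              using e[of k] by (subst ennreal_plus[symmetric]) (auto simp del: ennreal_plus intro: ennreal_leI)
          qed
          then have "(\<integral>\<^sup>+w. ennreal (norm (indicator E w *\<^sub>R g w - s k (N k) w)) \<partial>M)
              \<le> (\<integral>\<^sup>+w. ennreal (e k) + ennreal (if i k w < N k then 0 else norm (x k (i k w))) \<partial>M)"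
            by (rule nn_integral_mono_AE)
          also have "\<dots> = (\<integral>\<^sup>+w. ennreal (e k) \<partial>M) + (\<integral>\<^sup>+w. ennreal (if i k w < N k then 0 else norm (x k (i k w))) \<partial>M)"
          proof (rule nn_integral_add)
            show "(\<lambda>w. ennreal (if i k w < N k then 0 else norm (x k (i k w)))) \<in> borel_measurable M"
              by (rule measurable_compose[OF i[of k]]) simp
          qed simp
          also have "\<dots> \<le> ennreal (e k * measure M (space M)) + ennreal (e k)"
            using N(1)[of k] e[of k]
            by (intro add_mono) (auto simp: emeasure_eq_measure ennreal_mult' less_imp_le)
          also have "\<dots> = ennreal (e k * (measure M (space M) + 1))"
            using e[of k] by (subst ennreal_plus[symmetric]) (auto simp: distrib_left)
          finally show "(\<integral>\<^sup>+w. ennreal (norm (indicator E w *\<^sub>R g w - s k (N k) w)) \<partial>M)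
            \<le> ennreal (e k * (measure M (space M) + 1))" .
        qed
        show "(\<lambda>k. ennreal (e k * (measure M (space M) + 1))) \<longlonglongrightarrow> 0"
          using tendsto_ennrealI[OF tendsto_mult_right[OF e0, of "measure M (space M) + 1"]] by simp
      qed simp
    qed
  qed
  then show ?thesis by (rule that)
qed

lemma kadec_reflexive_imp_RNP:
  assumes refl: "reflexive_space TYPE('a::banach)" and kadec: "\<And>x :: 'a. kadec_at x"
  shows "radon_nikodym_property TYPE('w) TYPE('a)"
  unfolding radon_nikodym_property_def
proof (intro allI impI)
  fix M :: "'w measure" and G :: "'w set \<Rightarrow> 'a"
  assume M: "finite_measure M" and G: "vector_measure M G" and bv: "bounded_variation_measure M G"
    and null: "\<forall>E\<in>null_sets M. G E = 0"
  interpret finite_measure M by (rule M)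
  interpret ac_vector_measure M G by unfold_locales (use G null in auto)
  obtain C where C: "\<forall>P. finite P \<longrightarrow> P \<subseteq> sets M \<longrightarrow> partition_on (space M) P \<longrightarrow> (\<Sum>E\<in>P. norm (G E)) \<le> C"
    using bv unfolding bounded_variation_measure_def by blast
  obtain g where "\<And>E. E \<in> sets M \<Longrightarrow> has_Bochner_integral M (\<lambda>w. indicator E w *\<^sub>R g w) (G E)"
    using density_exists[OF Cauchy_convergent refl kadec C] by blast
  then show "\<exists>g. \<forall>E\<in>sets M. has_Bochner_integral M (\<lambda>w. indicator E w *\<^sub>R g w) (G E)" by blast
qed

text \<open>A nonzero vector is required for (iv): the zero space is reflexive but its sphere is
  empty. As \<open>'w\<close> is arbitrary, RNP is covered for each point type with a summand
  \<open>real\<close>.\<close>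

theorem theorem3p2:
  fixes s :: real
  assumes "\<exists>x :: 'a::banach. x \<noteq> 0"
    and "0 < s" and "s \<le> 1"
    and "property_Mstar TYPE('a) 1 s"
  shows "(reflexive_space TYPE('a) \<longleftrightarrow> radon_nikodym_property TYPE('w + real) TYPE('a)) \<and>
    (reflexive_space TYPE('a) \<longleftrightarrow> point_of_continuity_property TYPE('a)) \<and>
    (reflexive_space TYPE('a) \<longleftrightarrow>
      (\<exists>x0 :: 'a. x0 \<in> sphere 0 1 \<and> sphere_topologies_seq_agree_at x0)) \<and>
    (reflexive_space TYPE('a) \<longleftrightarrow> kadec_klee_property TYPE('a)) \<and>
    (reflexive_space TYPE('a) \<longleftrightarrow> \<not> contains_copy_of_c0 TYPE('a))"
proof -
  obtain x :: 'a where "x \<noteq> 0" using assms(1) by blast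
  then have sgn: "norm (sgn x) = 1" by (simp add: norm_sgn)
  \<comment> \<open>Flatness of the single point \<open>sgn x\<close> produces sequences at every
    point of the ball: at 0 for the copy of \<open>c0\<close>, at \<open>y\<close> against agreement
    there.\<close>
  have copy: "contains_copy_of_c0 TYPE('a)" and not_agree: "norm y = 1 \<Longrightarrow> \<not> sphere_topologies_seq_agree_at y"
    if nr: "\<not> reflexive_space TYPE('a)" for y :: 'a
  proof -
    have flat: "flat_at (sgn x)"
      by (rule nonreflexive_imp_flat_at[OF assms(4,2) nr sgn])
    obtain z g d where "c0_sequence (0 :: 'a) z g d"
      by (rule flat_imp_c0_sequence[OF assms(4,2) flat, of 0]) simp_all
    then show "contains_copy_of_c0 TYPE('a)" by (rule c0_sequence_imp_copy)
    assume y: "norm y = 1"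
    obtain z g d where "c0_sequence y z g d"
      by (rule flat_imp_c0_sequence[OF assms(4,2) flat, of y]) (use y in simp_all)
    then show "\<not> sphere_topologies_seq_agree_at y" using y by (rule c0_sequence_imp_not_agree)
  qed
  have kadec: "kadec_at y" if "reflexive_space TYPE('a)" for y :: 'a
    using no_c0_copy_imp_kadec_at[OF assms(4,2)] c0_copy_imp_not_reflexive that by blast
  have kkp: "kadec_klee_property TYPE('a)" if "reflexive_space TYPE('a)"
    by (rule kadec_imp_KKP[OF kadec[OF that]])
  have agree: "\<exists>x0 :: 'a. x0 \<in> sphere 0 1 \<and> sphere_topologies_seq_agree_at x0"
    if "kadec_klee_property TYPE('a)"
    using that sgn unfolding kadec_klee_property_def sphere_topologies_seq_agree_at_def
    by (intro exI[of _ "sgn x"]) auto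
  have rnp: "radon_nikodym_property TYPE('w + real) TYPE('a)" if "reflexive_space TYPE('a)"
    by (rule kadec_reflexive_imp_RNP[OF that kadec[OF that]])
  have pcp: "point_of_continuity_property TYPE('a)" if "reflexive_space TYPE('a)"
    by (rule kadec_reflexive_imp_PCP[OF that kadec[OF that]])
  have refl_of_agree: "reflexive_space TYPE('a)"
    if "\<exists>x0 :: 'a. x0 \<in> sphere 0 1 \<and> sphere_topologies_seq_agree_at x0"
    using that not_agree by auto
  \<comment> \<open>By contraposition each of (ii), (iii) and (vi) gives reflexivity through
    \<open>copy\<close>, and (v) gives it through (iv).\<close>
  show ?thesis
    using copy c0_copy_imp_not_reflexive c0_copy_imp_not_PCP c0_copy_imp_not_RNP
      rnp pcp kkp agree refl_of_agree by blast
qed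

end
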